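(* Let $\Omega\subset\mathbb{R}^d$ be a bounded $C^2$ domain equipped with heterogeneous localization functions $\eta_\delta$, $0<\delta<\delta_0$, and let $\rho$ be an admissible, normalized kernel (all as defined in the context). Let $\delta\in(0,\delta_0)$ and suppose $u,v\in C^2(\overline{\Omega})$. Then $$B_{\rho,\delta}(u,v)=\int_\Omega \mathcal{L}_\delta u(x)\,v(x)\,dx+\int_{\partial\Omega}\frac{\partial u}{\partial\nu}(x)\,v(x)\,d\sigma(x),$$ where $\frac{\partial u}{\partial\nu}$ denotes the outward normal derivative of $u$ and $\sigma$ the surface measure on $\partial\Omega$.
   Context: Domain and localization functions. $\Omega\subset\mathbb{R}^d$ is a bounded $C^2$ domain. There are constants $\kappa_0\in(0,1)$ and $\kappa_1,\kappa_2,\bar\kappa_0>0$ depending at most on $d$ and $\Omega$ and, with $\delta_0:=\min\{1,\frac{1}{9\kappa_1^2},\frac{1}{2\bar\kappa_0^2}\}$, for every $0<\delta<\delta_0$ a function $\eta_\delta:\overline\Omega\to[0,\infty)$, positive in $\Omega$, such that: (i) $\eta_\delta(x)=\operatorname{dist}(x,\partial\Omega)^2$ for $x\in\Omega$ with $\operatorname{dist}(x,\partial\Omega)^2<\kappa_0\delta$; (ii) $\eta_\delta(x)=\delta$ for $x\in\Omega$ with $\kappa_0\operatorname{dist}(x,\partial\Omega)^2>\delta$; (iii) $\eta_\delta\in C^2(\overline\Omega)$ with $|\nabla\eta_\delta|\le\kappa_1\sqrt\delta$ and $|\nabla^2\eta_\delta|\le\kappa_2$ in $\Omega$; (iv) $\eta_\delta(x)\le\bar\kappa_0\min\{\delta,\operatorname{dist}(x,\partial\Omega)^2\}$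 in $\Omega$. Kernel. $\rho:[0,\infty)\to[0,\infty)$ is admissible if there are constants $0<\rho_0<\infty$ and $0<r_0<R_0<1$ such that $\rho\in C^1([0,\infty))$, $\rho\ge0$, $\lim_{r\to0^+}\rho'(r)/r$ exists, $\operatorname{supp}\rho\subset[0,R_0)$, and $\rho(r)\ge\rho_0$ for all $r\in[0,r_0]$. It is normalized if $\int_{B(0,1)}|z|^2\rho(|z|)\,dz=d$. For $\alpha\in\mathbb{R}$ set $\rho_{\delta,\alpha}(x,y):=\frac12\Big[\frac{1}{\eta_\delta(x)^{d+\alpha}}\rho\big(\tfrac{|y-x|}{\eta_\delta(x)}\big)+\frac{1}{\eta_\delta(y)^{d+\alpha}}\rho\big(\tfrac{|y-x|}{\eta_\delta(y)}\big)\Big]$. Operator and form: $\mathcal{L}_\delta u(x):=2\int_\Omega\rho_{\delta,2}(x,y)(u(x)-u(y))\,dy$ and $B_{\rho,\delta}(u,v):=\int_\Omega\int_\Omega\rho_{\delta,2}(x,y)(u(x)-u(y))(v(x)-v(y))\,dy\,dx$. *)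

theory Defs
  imports "HOL-Analysis.Analysis"
begin

text \<open>Throughout, \<open>'a :: euclidean_space\<close> plays the role of the Euclidean space of dimension
  \<open>d = DIM('a)\<close>; functions given only on a subset are total functions whose
  values elsewhere are irrelevant.\<close>

section \<open>Differentiability up to the boundary\<close>

definition grad :: "('a::euclidean_space \<Rightarrow> real) \<Rightarrow> 'a \<Rightarrow> 'a" where
  "grad f x = (THE g. GDERIV f x :> g)"

text \<open>\<open>u \<in> C\<^sup>2(closure \<Omega>)\<close> for an open set \<open>\<Omega>\<close>: twice differentiable in \<open>\<Omega>\<close>, and
  \<open>u\<close>, its gradient and its Hessian extend continuously to \<open>closure \<Omega>\<close> (the extension of \<open>u\<close>
  being \<open>u\<close> itself). With \<open>\<Omega> = UNIV\<close> this is the usual class \<open>C\<^sup>2\<close>.\<close>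

definition C2_closure :: "'a::euclidean_space set \<Rightarrow> ('a \<Rightarrow> real) \<Rightarrow> bool" where
  "C2_closure \<Omega> u \<longleftrightarrow> continuous_on (closure \<Omega>) u \<and>
    (\<exists>(G :: 'a \<Rightarrow> 'a) (H :: 'a \<Rightarrow> 'a \<Rightarrow>\<^sub>L 'a).
       continuous_on (closure \<Omega>) G \<and> continuous_on (closure \<Omega>) H \<and>
       (\<forall>x\<in>\<Omega>. (GDERIV u x :> G x) \<and> (G has_derivative blinfun_apply (H x)) (at x)))"

section \<open>Domains of class \<open>C\<^sup>2\<close>, outward normal and surface measure\<close>

text \<open>Inside \<open>ball x0 r\<close>, the set \<open>\<Omega>\<close> lies above the graph of a \<open>C\<^sup>2\<close> function \<open>\<gamma>\<close> over the
  coordinate hyperplane orthogonal to \<open>e\<close>, a signed standard basis vector (so the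
  coordinate axes are relabelled and reoriented). A function on that hyperplane is encoded as a
  function on the whole space that does not depend on the coordinate in direction \<open>e\<close>.\<close>

definition C2_boundary_chart ::
    "'a::euclidean_space set \<Rightarrow> 'a \<Rightarrow> real \<Rightarrow> 'a \<Rightarrow> ('a \<Rightarrow> real) \<Rightarrow> bool" where
  "C2_boundary_chart \<Omega> x0 r e \<gamma> \<longleftrightarrow>
     r > 0 \<and> (e \<in> Basis \<or> - e \<in> Basis) \<and>
     C2_closure UNIV \<gamma> \<and> (\<forall>x t. \<gamma> (x + t *\<^sub>R e) = \<gamma> x) \<and>
     \<Omega> \<inter> ball x0 r = {x \<in> ball x0 r. \<gamma> x < x \<bullet> e}"

definition C2_domain :: "'a::euclidean_space set \<Rightarrow> bool" where
  "C2_domain \<Omega> \<longleftrightarrow> \<Omega> \<noteq> {} \<and> open \<Omega> \<and> connected \<Omega> \<and>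
     (\<forall>x0\<in>frontier \<Omega>. \<exists>r e \<gamma>. C2_boundary_chart \<Omega> x0 r e \<gamma>)"

text \<open>The area measure \<open>sqrt (1 + |\<nabla>\<gamma>|\<^sup>2) dx'\<close> on the graph of \<open>\<gamma>\<close>. The Lebesgue measure \<open>dx'\<close> of
  dimension \<open>d - 1\<close> on the hyperplane orthogonal to \<open>e\<close> is obtained from \<open>lborel\<close> on the slab of
  thickness 1 over the hyperplane, each slab point being moved along \<open>e\<close> onto the graph; for
  \<open>d = 1\<close> this gives a unit point mass.\<close>

definition graph_measure :: "'a::euclidean_space \<Rightarrow> ('a \<Rightarrow> real) \<Rightarrow> 'a measure" where
  "graph_measure e \<gamma> =
     distr (density lborel (\<lambda>x. ennreal (indicator {x. 0 \<le> x \<bullet> e \<and> x \<bullet> e \<le> 1} x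
                                         * sqrt (1 + (norm (grad \<gamma> x))\<^sup>2))))
       borel (\<lambda>x. x + (\<gamma> x - x \<bullet> e) *\<^sub>R e)"

text \<open>The surface measure on the boundary is the Borel measure, carried by \<open>frontier \<Omega>\<close>,
  that is given by the area formula in every local graph chart.\<close>

definition is_surface_measure :: "'a::euclidean_space set \<Rightarrow> 'a measure \<Rightarrow> bool" where
  "is_surface_measure \<Omega> \<sigma> \<longleftrightarrow>
     sets \<sigma> = sets borel \<and> emeasure \<sigma> (- frontier \<Omega>) = 0 \<and>
     (\<forall>x0 r e \<gamma> A. C2_boundary_chart \<Omega> x0 r e \<gamma> \<and> A \<in> sets borel \<and> A \<subseteq> frontier \<Omega> \<inter> ball x0 r
        \<longrightarrow> emeasure \<sigma> A = emeasure (graph_measure e \<gamma>) A)"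

definition surface_measure :: "'a::euclidean_space set \<Rightarrow> 'a measure" where
  "surface_measure \<Omega> = (THE \<sigma>. is_surface_measure \<Omega> \<sigma>)"

text \<open>A unit vector orthogonal to the velocities of all curves in the boundary
  through \<open>x\<close>, and pointing out of \<open>\<Omega>\<close>.\<close>

definition is_outward_unit_normal :: "'a::euclidean_space set \<Rightarrow> 'a \<Rightarrow> 'a \<Rightarrow> bool" where
  "is_outward_unit_normal \<Omega> x n \<longleftrightarrow>
     norm n = 1 \<and>
     (\<forall>(c :: real \<Rightarrow> 'a) w. c 0 = x \<and> (\<forall>t. c t \<in> frontier \<Omega>) \<and> (c has_vector_derivative w) (at 0)
        \<longrightarrow> n \<bullet> w = 0) \<and>
     (\<forall>\<^sub>F t in at_right 0. x + t *\<^sub>R n \<notin> closure \<Omega> \<and> x - t *\<^sub>R n \<in> \<Omega>)"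

definition outward_normal :: "'a::euclidean_space set \<Rightarrow> 'a \<Rightarrow> 'a" where
  "outward_normal \<Omega> x = (THE n. is_outward_unit_normal \<Omega> x n)"

text \<open>On the boundary, the gradient of \<open>u\<close> means its continuous extension from \<open>\<Omega>\<close>.\<close>

definition normal_derivative :: "'a::euclidean_space set \<Rightarrow> ('a \<Rightarrow> real) \<Rightarrow> 'a \<Rightarrow> real" where
  "normal_derivative \<Omega> u x = Lim (at x within \<Omega>) (grad u) \<bullet> outward_normal \<Omega> x"

section \<open>Heterogeneous localization functions\<close>

definition localization_bound :: "real \<Rightarrow> real \<Rightarrow> real" where
  "localization_bound \<kappa>1 \<kappa>b = Min {1, 1 / (9 * \<kappa>1\<^sup>2), 1 / (2 * \<kappa>b\<^sup>2)}"

text \<open>The size of the Hessian is the operator norm of the derivative of the gradient.\<close>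

definition localization_family ::
    "'a::euclidean_space set \<Rightarrow> real \<Rightarrow> real \<Rightarrow> real \<Rightarrow> real \<Rightarrow> (real \<Rightarrow> 'a \<Rightarrow> real) \<Rightarrow> bool" where
  "localization_family \<Omega> \<kappa>0 \<kappa>1 \<kappa>2 \<kappa>b \<eta> \<longleftrightarrow>
     0 < \<kappa>0 \<and> \<kappa>0 < 1 \<and> 0 < \<kappa>1 \<and> 0 < \<kappa>2 \<and> 0 < \<kappa>b \<and>
     (\<forall>\<delta>. 0 < \<delta> \<and> \<delta> < localization_bound \<kappa>1 \<kappa>b \<longrightarrow>
        (\<forall>x\<in>closure \<Omega>. 0 \<le> \<eta> \<delta> x) \<and> (\<forall>x\<in>\<Omega>. 0 < \<eta> \<delta> x) \<and>
        (\<forall>x\<in>\<Omega>. (infdist x (frontier \<Omega>))\<^sup>2 < \<kappa>0 * \<delta> \<longrightarrow> \<eta> \<delta> x = (infdist x (frontier \<Omega>))\<^sup>2) \<and>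
        (\<forall>x\<in>\<Omega>. \<kappa>0 * (infdist x (frontier \<Omega>))\<^sup>2 > \<delta> \<longrightarrow> \<eta> \<delta> x = \<delta>) \<and>
        C2_closure \<Omega> (\<eta> \<delta>) \<and>
        (\<forall>x\<in>\<Omega>. norm (grad (\<eta> \<delta>) x) \<le> \<kappa>1 * sqrt \<delta>) \<and>
        (\<forall>x\<in>\<Omega>. onorm (frechet_derivative (grad (\<eta> \<delta>)) (at x)) \<le> \<kappa>2) \<and>
        (\<forall>x\<in>\<Omega>. \<eta> \<delta> x \<le> \<kappa>b * min \<delta> ((infdist x (frontier \<Omega>))\<^sup>2)))"

section \<open>Kernels, nonlocal operator and bilinear form\<close>

definition admissible_kernel :: "(real \<Rightarrow> real) \<Rightarrow> bool" where
  "admissible_kernel \<rho> \<longleftrightarrow>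
     (\<forall>r\<ge>0. 0 \<le> \<rho> r) \<and>
     (\<exists>\<rho>d. (\<forall>r\<ge>0. (\<rho> has_real_derivative \<rho>d r) (at r within {0..})) \<and> continuous_on {0..} \<rho>d \<and>
           (\<exists>l. ((\<lambda>r. \<rho>d r / r) \<longlongrightarrow> l) (at_right 0))) \<and>
     (\<exists>\<rho>0 r0 R0. 0 < \<rho>0 \<and> 0 < r0 \<and> r0 < R0 \<and> R0 < 1 \<and>
           closure {r. 0 \<le> r \<and> \<rho> r \<noteq> 0} \<subseteq> {0..<R0} \<and> (\<forall>r\<in>{0..r0}. \<rho>0 \<le> \<rho> r))"

definition normalized_kernel :: "'a::euclidean_space itself \<Rightarrow> (real \<Rightarrow> real) \<Rightarrow> bool" where
  "normalized_kernel _ \<rho> \<longleftrightarrow>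
     (LINT z:ball (0::'a) 1|lborel. (norm z)\<^sup>2 * \<rho> (norm z)) = real DIM('a)"

text \<open>In the following definitions \<open>h\<close> stands for \<open>\<eta> \<delta>\<close>.\<close>

definition het_kernel ::
    "(real \<Rightarrow> real) \<Rightarrow> ('a::euclidean_space \<Rightarrow> real) \<Rightarrow> real \<Rightarrow> 'a \<Rightarrow> 'a \<Rightarrow> real" where
  "het_kernel \<rho> h \<alpha> x y =
     1/2 * (1 / h x powr (real DIM('a) + \<alpha>) * \<rho> (norm (y - x) / h x)
          + 1 / h y powr (real DIM('a) + \<alpha>) * \<rho> (norm (y - x) / h y))"

definition nonlocal_op ::
    "'a::euclidean_space set \<Rightarrow> (real \<Rightarrow> real) \<Rightarrow> ('a \<Rightarrow> real) \<Rightarrow> ('a \<Rightarrow> real) \<Rightarrow> 'a \<Rightarrow> real" where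
  "nonlocal_op \<Omega> \<rho> h u x = 2 * (LINT y:\<Omega>|lborel. het_kernel \<rho> h 2 x y * (u x - u y))"

definition nonlocal_form ::
    "'a::euclidean_space set \<Rightarrow> (real \<Rightarrow> real) \<Rightarrow> ('a \<Rightarrow> real) \<Rightarrow> ('a \<Rightarrow> real) \<Rightarrow> ('a \<Rightarrow> real) \<Rightarrow> real" where
  "nonlocal_form \<Omega> \<rho> h u v =
     (LINT x:\<Omega>|lborel. (LINT y:\<Omega>|lborel. het_kernel \<rho> h 2 x y * (u x - u y) * (v x - v y)))"

end

theory Submission
  imports Defs
begin

text \<open>The identity says that the nonlocal Green formula has a purely local boundary term. Write
  \<open>h\<close> for the localization function, extended by \<open>0\<close> outside \<open>\<Omega>\<close>. Since \<open>h x\<close> is smaller than the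
  distance of \<open>x\<close> to the boundary, for \<open>|z| \<le> 1\<close> the map \<open>T x = x + h x z\<close> sends \<open>\<Omega>\<close> into itself, and
  substituting \<open>y = T x\<close> in the inner integral turns the bilinear form into the average of
  \<open>form_at u v z = \<integral>\<^sub>\<Omega> q\<^sub>u q\<^sub>v\<close> over \<open>z\<close> with weight \<open>\<rho> |z|\<close>, where \<open>q\<^sub>f = (f \<circ> T - f) / h\<close>.

  If a test function \<open>\<phi>\<close> vanishes where \<open>h\<close> is small, every double integral converges absolutely,
  and exchanging \<open>x\<close> and \<open>y\<close> shows that \<open>\<integral> (L u) \<phi>\<close> is the average of \<open>form_at u \<phi> z\<close>, without
  any boundary term (\<open>nonlocal_op_duality\<close>). The boundary term is created in the limit
  \<open>\<phi> = \<zeta>\<^sub>n v \<rightarrow> v\<close>, where \<open>\<zeta>\<^sub>n = cutoff (n h)\<close>. By the product rule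
  \<open>q\<^sub>\<phi> = \<zeta>\<^sub>n q\<^sub>v + (v \<circ> T) q\<^sub>\<zeta>\<close>. The first summand leads to \<open>form_at u v z\<close>. In the second,
  \<open>(v \<circ> T) q\<^sub>u q\<^sub>\<zeta>\<close> differs from \<open>v \<partial>\<^sub>zu \<partial>\<^sub>z\<zeta>\<^sub>n\<close> by an error that is bounded uniformly in \<open>n\<close> and lives on
  \<open>{h \<le> 3 / n}\<close>, a set shrinking to the empty set; the bound rests on \<open>|\<nabla>h| \<le> c \<surd>h\<close>. An integration
  by parts replaces the product by \<open>- \<zeta>\<^sub>n \<partial>\<^sub>z(v \<partial>\<^sub>zu)\<close>, so that \<open>form_at u (\<zeta>\<^sub>n v) z\<close> converges to
  \<open>form_at u v z - \<integral>\<^sub>\<Omega> \<partial>\<^sub>z(v \<partial>\<^sub>zu)\<close> (\<open>form_at_cutoff_limit\<close>). The weight \<open>\<rho> |z|\<close> is invariant under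
  reflections and normalized, so averaging the last integral over \<open>z\<close> gives the integral of the divergence
  of \<open>v \<nabla>u\<close>, which is the boundary integral.

  The limit on the other side needs \<open>L u\<close> to be integrable, whereas the size of the kernel only gives
  a bound of order \<open>1 / h\<close>, which is not integrable. A cancellation helps: transporting the measure by \<open>T\<close>,
  whose Jacobian is \<open>1 + \<partial>\<^sub>zh\<close>, bounds \<open>form_at u \<phi> z\<close> by a constant times the supremum of \<open>|\<phi>|\<close> for
  every bounded measurable \<open>\<phi>\<close> (\<open>form_at_bound\<close>), and \<open>\<phi>\<close> can be taken to be the sign of \<open>L u\<close>.

  Everything about integrals in several variables is reduced to lines: Lebesgue measure is
  disintegrated along an arbitrary direction over a slab (\<open>nn_integral_slab\<close>). This gives the Jacobian of \<open>T\<close>,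
  the integration by parts, and, after a shear that flattens the boundary, the divergence theorem in a
  chart. The latter determines the area measure of a chart from \<open>\<Omega>\<close> alone, which is why the area measures of
  two charts agree (\<open>graph_measures_agree\<close>) and the surface measure exists. A partition of
  unity then gives the global divergence theorem (\<open>C2_domain_divergence\<close>).\<close>

section \<open>Integration along the lines of one direction\<close>

definition slab :: "'a::euclidean_space \<Rightarrow> 'a set" where
  "slab b = {x. 0 \<le> x \<bullet> b \<and> x \<bullet> b \<le> b \<bullet> b}"

lemma slab_borel [measurable]: "slab b \<in> sets borel"
  unfolding slab_def by measurable

lemma nn_integral_translate:
  fixes f :: "'a::euclidean_space \<Rightarrow> ennreal"
  assumes [measurable]: "f \<in> borel_measurable borel"
  shows "(\<integral>\<^sup>+x. f (x + c) \<partial>lborel) = (\<integral>\<^sup>+x. f x \<partial>lborel)"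
proof -
  have "(\<integral>\<^sup>+x. f x \<partial>lborel) = (\<integral>\<^sup>+x. f x \<partial>(distr lborel borel ((+) c)))"
    by (simp add: lborel_distr_plus)
  also have "\<dots> = (\<integral>\<^sup>+x. f (x + c) \<partial>lborel)"
    by (subst nn_integral_distr) (auto simp: add.commute)
  finally show ?thesis by simp
qed

text \<open>Lebesgue measure is the average, over the points of the slab, of the lengths of the lines in
  direction \<open>b\<close>: by Tonelli and translation invariance a point is counted once for every
  parameter that moves it into the slab, and those parameters form an interval of length \<open>1\<close>. The
  slab replaces the orthogonal hyperplane, so that only Lebesgue measure on the whole space is involved.\<close>

lemma nn_integral_slab:
  fixes b :: "'a::euclidean_space" and f :: "'a \<Rightarrow> ennreal"
  assumes b: "b \<noteq> 0" and [measurable]: "f \<in> borel_measurable borel"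
  shows "(\<integral>\<^sup>+x. f x \<partial>lborel)
    = (\<integral>\<^sup>+x. \<integral>\<^sup>+t. indicator (slab b) x * f (x + t *\<^sub>R b) \<partial>lborel \<partial>lborel)"
proof -
  have bb: "b \<bullet> b > 0" using b by simp
  have "(\<integral>\<^sup>+x. \<integral>\<^sup>+t. indicator (slab b) x * f (x + t *\<^sub>R b) \<partial>lborel \<partial>lborel)
      = (\<integral>\<^sup>+t. \<integral>\<^sup>+x. indicator (slab b) x * f (x + t *\<^sub>R b) \<partial>lborel \<partial>lborel)"
    by (rule lborel_pair.Fubini') measurable
  also have "\<dots> = (\<integral>\<^sup>+t. \<integral>\<^sup>+x. indicator (slab b) (x - t *\<^sub>R b) * f x \<partial>lborel \<partial>lborel)"
  proof (rule nn_integral_cong)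
    fix t :: real
    have "(\<integral>\<^sup>+x. indicator (slab b) (x - t *\<^sub>R b) * f x \<partial>lborel)
        = (\<integral>\<^sup>+x. indicator (slab b) ((x + t *\<^sub>R b) - t *\<^sub>R b) * f (x + t *\<^sub>R b) \<partial>lborel)"
      by (rule nn_integral_translate[symmetric]) measurable
    then show "(\<integral>\<^sup>+x. indicator (slab b) x * f (x + t *\<^sub>R b) \<partial>lborel)
        = (\<integral>\<^sup>+x. indicator (slab b) (x - t *\<^sub>R b) * f x \<partial>lborel)" by simp
  qed
  also have "\<dots> = (\<integral>\<^sup>+x. \<integral>\<^sup>+t. indicator (slab b) (x - t *\<^sub>R b) * f x \<partial>lborel \<partial>lborel)"
    by (rule lborel_pair.Fubini') measurable
  also have "\<dots> = (\<integral>\<^sup>+x. f x \<partial>lborel)"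
  proof (rule nn_integral_cong)
    fix x :: 'a
    have eq: "indicator (slab b) (x - t *\<^sub>R b) = (indicator {(x \<bullet> b) / (b \<bullet> b) - 1 .. (x \<bullet> b) / (b \<bullet> b)} t :: ennreal)" for t
      using bb by (auto simp: slab_def indicator_def inner_diff_left field_simps)
    have "(\<integral>\<^sup>+t. indicator (slab b) (x - t *\<^sub>R b) * f x \<partial>lborel)
        = (\<integral>\<^sup>+t. indicator {(x \<bullet> b) / (b \<bullet> b) - 1 .. (x \<bullet> b) / (b \<bullet> b)} t \<partial>lborel) * f x"
      unfolding eq by (rule nn_integral_multc) measurable
    also have "\<dots> = f x"
      by simp
    finally show "(\<integral>\<^sup>+t. indicator (slab b) (x - t *\<^sub>R b) * f x \<partial>lborel) = f x" .
  qed
  finally show ?thesis by simp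
qed

lemma integral_slab:
  fixes b :: "'a::euclidean_space" and f :: "'a \<Rightarrow> real"
  assumes b: "b \<noteq> 0" and f: "integrable lborel f"
  shows "(\<integral>x. f x \<partial>lborel)
    = (\<integral>x. indicator (slab b) x * (\<integral>t. f (x + t *\<^sub>R b) \<partial>lborel) \<partial>lborel)"
proof -
  have [measurable]: "f \<in> borel_measurable borel" using f by auto
  have M: "lborel = distr (density (lborel \<Otimes>\<^sub>M lborel) (\<lambda>p. indicator (slab b) (fst p))) borel (\<lambda>p. fst p + snd p *\<^sub>R b)"
    (is "_ = distr ?D borel ?g")
  proof (rule measure_eqI)
    fix A :: "'a set" assume "A \<in> sets lborel"
    then have [measurable]: "A \<in> sets borel" by simp
    have "emeasure lborel A = (\<integral>\<^sup>+x. \<integral>\<^sup>+t. indicator (slab b) x * indicator A (x + t *\<^sub>R b) \<partial>lborel \<partial>lborel)"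
      by (subst nn_integral_slab[OF b, symmetric]) auto
    also have "\<dots> = (\<integral>\<^sup>+p. indicator (slab b) (fst p) * indicator A (fst p + snd p *\<^sub>R b) \<partial>(lborel \<Otimes>\<^sub>M lborel))"
      by (subst lborel.nn_integral_fst[symmetric]) auto
    also have "\<dots> = (\<integral>\<^sup>+p. indicator A (fst p + snd p *\<^sub>R b) \<partial>?D)"
      by (subst nn_integral_density) auto
    also have "\<dots> = (\<integral>\<^sup>+x. indicator A x \<partial>(distr ?D borel ?g))"
      by (subst nn_integral_distr) auto
    finally show "emeasure lborel A = emeasure (distr ?D borel ?g) A" by simp
  qed simp
  have i: "integrable (lborel \<Otimes>\<^sub>M lborel) (\<lambda>p. indicator (slab b) (fst p) * f (fst p + snd p *\<^sub>R b))"
  proof -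
    have "integrable (distr ?D borel ?g) f" using f M by metis
    then have "integrable ?D (\<lambda>p. f (?g p))"
      by (subst (asm) integrable_distr_eq) auto
    then have "integrable (density (lborel \<Otimes>\<^sub>M lborel) (\<lambda>p. ennreal (indicator (slab b) (fst p)))) (\<lambda>p. f (?g p))"
      by (simp add: ennreal_indicator)
    then show ?thesis
      by (subst (asm) integrable_density) auto
  qed
  have "(\<integral>x. f x \<partial>lborel) = (\<integral>x. f x \<partial>(distr ?D borel ?g))" using M by metis
  also have "\<dots> = (\<integral>p. f (?g p) \<partial>?D)"
    by (subst integral_distr) auto
  also have "\<dots> = (\<integral>p. f (?g p) \<partial>(density (lborel \<Otimes>\<^sub>M lborel) (\<lambda>p. ennreal (indicator (slab b) (fst p)))))"
    by (simp add: ennreal_indicator)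
  also have "\<dots> = (\<integral>p. indicator (slab b) (fst p) * f (fst p + snd p *\<^sub>R b) \<partial>(lborel \<Otimes>\<^sub>M lborel))"
    by (subst integral_density) auto
  also have "\<dots> = (\<integral>x. \<integral>t. indicator (slab b) x * f (x + t *\<^sub>R b) \<partial>lborel \<partial>lborel)"
    by (subst lborel_pair.integral_fst'[symmetric, OF i]) simp
  finally show ?thesis by simp
qed

text \<open>The map is an increasing bijection of the line, so the preimage of an interval is an
  interval and the fundamental theorem of calculus computes its measure.\<close>

lemma line_substitution_1d:
  fixes g g' :: "real \<Rightarrow> real"
  assumes der: "\<And>t. (g has_real_derivative g' t) (at t)"
    and cont: "continuous_on UNIV g'" and bd: "\<And>t. \<bar>g' t\<bar> \<le> 1/2"
  shows "lborel = distr (density lborel (\<lambda>t. ennreal (1 + g' t))) borel (\<lambda>t. t + g t)"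
    (is "_ = distr ?D borel ?G")
proof (rule lborel_eqI)
  have [measurable]: "g' \<in> borel_measurable borel" using cont by (rule borel_measurable_continuous_onI)
  have cg: "continuous_on UNIV g"
    using der by (meson DERIV_isCont continuous_at_imp_continuous_on)
  then have [measurable]: "g \<in> borel_measurable borel" by (rule borel_measurable_continuous_onI)
  have derG: "(?G has_real_derivative (1 + g' t)) (at t)" for t
    by (auto intro!: derivative_eq_intros der)
  have pos: "1 + g' t > 0" for t using bd[of t] by linarith
  have mono: "?G s < ?G t" if "s < t" for s t
    using that by (rule DERIV_pos_imp_increasing) (use derG pos in blast)
  have lip: "\<bar>g t - g 0\<bar> \<le> \<bar>t\<bar> / 2" for t
  proof -
    have "norm (g t - g 0) \<le> 1/2 * norm (t - 0)"
      by (rule field_differentiable_bound[of UNIV g g'])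
         (use der bd in auto)
    then show ?thesis by simp
  qed
  have surj: "\<exists>t. ?G t = y" for y
  proof -
    define R where "R = 2 * \<bar>y\<bar> + 2 * \<bar>g 0\<bar>"
    have R: "R \<ge> 0" "y \<le> \<bar>y\<bar>" "- y \<le> \<bar>y\<bar>" "g 0 \<le> \<bar>g 0\<bar>" "- g 0 \<le> \<bar>g 0\<bar>" "R = 2 * \<bar>y\<bar> + 2 * \<bar>g 0\<bar>"
      by (auto simp: R_def)
    have "g R \<ge> g 0 - R / 2" "g (-R) \<le> g 0 + R / 2"
      using lip[of R] lip[of "-R"] R(1) by (simp_all only: abs_le_iff abs_minus_cancel abs_of_nonneg) linarith+
    then have *: "?G (-R) \<le> y" "y \<le> ?G R" "-R \<le> R"
      using R by linarith+
    have "continuous_on {-R..R} ?G"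
      using cg by (intro continuous_intros) (auto intro: continuous_on_subset)
    then show ?thesis
      using IVT'[of ?G "-R" y R] * by blast
  qed
  fix l u :: real assume "\<And>b. b \<in> Basis \<Longrightarrow> l \<bullet> b \<le> u \<bullet> b"
  then have lu: "l \<le> u" by simp
  obtain a where a: "?G a = l" using surj by blast
  obtain b where b: "?G b = u" using surj by blast
  have ab: "a \<le> b" using lu a b mono by (metis linorder_not_less)
  have iff: "l < ?G t \<and> ?G t < u \<longleftrightarrow> a < t \<and> t < b" for t
    using mono a b by (metis linorder_less_linear order_less_asym)
  have "emeasure (distr ?D borel ?G) (box l u) = (\<integral>\<^sup>+t. indicator (box l u) t \<partial>(distr ?D borel ?G))"
    by (subst nn_integral_indicator) auto
  also have "\<dots> = (\<integral>\<^sup>+t. ennreal (1 + g' t) * indicator (box l u) (?G t) \<partial>lborel)"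
    by (subst nn_integral_distr, simp, simp, subst nn_integral_density) simp_all
  also have "\<dots> = (\<integral>\<^sup>+t. ennreal (1 + g' t) * indicator {a..b} t \<partial>lborel)"
  proof (rule nn_integral_cong_AE)
    have "AE t in lborel. t \<noteq> a \<and> t \<noteq> b" by (auto intro: AE_lborel_singleton)
    then show "AE t in lborel. ennreal (1 + g' t) * indicator (box l u) (?G t)
        = ennreal (1 + g' t) * indicator {a..b} t"
    proof eventually_elim
      case (elim t)
      then have "(l < ?G t \<and> ?G t < u) = (a \<le> t \<and> t \<le> b)" using iff[of t] by auto
      then show ?case by (simp add: indicator_def)
    qed
  qed
  also have "\<dots> = ?G b - ?G a"
    by (rule nn_integral_FTC_Icc) (use ab derG less_imp_le[OF pos] in simp_all)
  finally show "emeasure (distr ?D borel ?G) (box l u) = ennreal (\<Prod>b\<in>Basis. (u - l) \<bullet> b)"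
    using a b by simp
qed simp

text \<open>A map that moves points only in the direction \<open>z\<close> preserves every line of this direction.
  Its Jacobian determinant is therefore the derivative along the line, and the change of variables is
  one-dimensional.\<close>

lemma nn_integral_line_substitution:
  fixes h h' :: "'a::euclidean_space \<Rightarrow> real" and f :: "'a \<Rightarrow> ennreal"
  assumes der: "\<And>x. ((\<lambda>t. h (x + t *\<^sub>R z)) has_real_derivative h' x) (at 0)"
    and cont: "\<And>x. continuous_on UNIV (\<lambda>t. h' (x + t *\<^sub>R z))"
    and bd: "\<And>x. \<bar>h' x\<bar> \<le> 1/2"
    and [measurable]: "h \<in> borel_measurable borel" "h' \<in> borel_measurable borel" "f \<in> borel_measurable borel"
  shows "(\<integral>\<^sup>+x. f (x + h x *\<^sub>R z) * ennreal (1 + h' x) \<partial>lborel) = (\<integral>\<^sup>+x. f x \<partial>lborel)"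
proof (cases "z = 0")
  case True
  have "h' x = 0" for x
    using DERIV_unique[OF der[of x]] True by auto
  then show ?thesis using True by simp
next
  case False
  have der': "((\<lambda>t. h (x + t *\<^sub>R z)) has_real_derivative h' (x + s *\<^sub>R z)) (at s)" for x s
    using der[of "x + s *\<^sub>R z"] DERIV_at_within_shift[of "\<lambda>t. h (x + t *\<^sub>R z)" _ s 0 UNIV]
    by (simp add: algebra_simps)
  have in1: "(\<integral>\<^sup>+t. f (x + t *\<^sub>R z + h (x + t *\<^sub>R z) *\<^sub>R z) * ennreal (1 + h' (x + t *\<^sub>R z)) \<partial>lborel)
      = (\<integral>\<^sup>+t. f (x + t *\<^sub>R z) \<partial>lborel)" for x
  proof -
    let ?D = "density lborel (\<lambda>t. ennreal (1 + h' (x + t *\<^sub>R z)))"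
    have "(\<integral>\<^sup>+t. f (x + t *\<^sub>R z) \<partial>lborel)
        = (\<integral>\<^sup>+t. f (x + t *\<^sub>R z) \<partial>(distr ?D borel (\<lambda>t. t + h (x + t *\<^sub>R z))))"
      using line_substitution_1d[OF der' cont bd, of x] by simp
    also have "\<dots> = (\<integral>\<^sup>+t. ennreal (1 + h' (x + t *\<^sub>R z)) * f (x + (t + h (x + t *\<^sub>R z)) *\<^sub>R z) \<partial>lborel)"
      by (simp add: nn_integral_distr nn_integral_density)
    finally show ?thesis by (simp add: algebra_simps)
  qed
  show ?thesis
    by (subst (1 2) nn_integral_slab[OF False])
       (simp_all add: nn_integral_cmult in1)
qed

lemma integral_FTC_halfline:
  fixes F f :: "real \<Rightarrow> real"
  assumes der: "\<And>t. t > a \<Longrightarrow> (F has_real_derivative f t) (at t)"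
    and contF: "continuous_on {a..} F"
    and bd: "\<And>t. \<bar>f t\<bar> \<le> C" and [measurable]: "f \<in> borel_measurable borel"
    and van: "\<And>t. t \<ge> R \<Longrightarrow> F t = 0" "\<And>t. t \<ge> R \<Longrightarrow> f t = 0"
  shows "(\<integral>t. indicator {a<..} t * f t \<partial>lborel) = - F a"
proof -
  define b where "b = max a R"
  have ab: "a \<le> b" "F b = 0" using van(1)[of b] by (auto simp: b_def)
  have i: "set_integrable lborel {a..b} f"
    unfolding set_integrable_def
    by (rule integrableI_bounded_set_indicator[where B=C]) (use bd ab(1) in auto)
  have "(f has_integral (F b - F a)) {a..b}"
    by (rule fundamental_theorem_of_calculus_interior)
       (use ab der contF in \<open>auto intro: continuous_on_subset simp: has_real_derivative_iff_has_vector_derivative[symmetric]\<close>)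
  then have "(LINT t:{a..b}|lborel. f t) = F b - F a"
    using set_borel_integral_eq_integral(2)[OF i] by (simp add: integral_unique)
  moreover have "(LINT t:{a..b}|lborel. f t) = (\<integral>t. indicator {a<..} t * f t \<partial>lborel)"
    unfolding set_lebesgue_integral_def
  proof (rule integral_cong_AE)
    have "AE t in lborel. t \<noteq> a" by (rule AE_lborel_singleton)
    then show "AE t in lborel. indicator {a..b} t *\<^sub>R f t = indicator {a<..} t * f t"
      by eventually_elim (auto simp: indicator_def b_def van)
  qed auto
  ultimately show ?thesis using ab by simp
qed

text \<open>A set invariant under translation by \<open>b\<close> is a union of lines, and on each of them the
  integral of a derivative of a function with bounded support vanishes. This is used for the whole
  space and for half-spaces.\<close>

lemma integral_derivative_invariant_set:
  fixes F f :: "'a::euclidean_space \<Rightarrow> real"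
  assumes A: "\<And>x t. x \<in> A \<Longrightarrow> x + t *\<^sub>R b \<in> A" and [measurable]: "A \<in> sets borel"
    and der: "\<And>x. x \<in> A \<Longrightarrow> ((\<lambda>t. F (x + t *\<^sub>R b)) has_real_derivative f x) (at 0)"
    and bd: "\<And>x. \<bar>f x\<bar> \<le> C" and [measurable]: "f \<in> borel_measurable borel"
    and van: "\<And>x. x \<in> A \<Longrightarrow> norm x \<ge> R \<Longrightarrow> F x = 0 \<and> f x = 0"
  shows "(\<integral>x. indicator A x * f x \<partial>lborel) = 0"
proof (cases "b = 0")
  case True
  have "indicator A x * f x = 0" for x
    using DERIV_unique[OF der[of x]] True by (auto simp: indicator_def)
  then show ?thesis by (simp only: integral_zero)
next
  case False
  have der': "((\<lambda>t. F (x + t *\<^sub>R b)) has_real_derivative f (x + s *\<^sub>R b)) (at s)" if "x \<in> A" for x s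
    using der[OF A[OF that], of s] DERIV_at_within_shift[of "\<lambda>t. F (x + t *\<^sub>R b)" _ s 0 UNIV]
    by (simp add: algebra_simps)
  have A': "x + t *\<^sub>R b \<in> A \<longleftrightarrow> x \<in> A" for x t
    using A[of "x + t *\<^sub>R b" "-t"] A[of x t] by (auto simp: algebra_simps)
  have i: "integrable lborel (\<lambda>x. indicator A x * f x)"
  proof -
    have fin: "emeasure lborel (A \<inter> cball 0 R) < top"
      using emeasure_bounded_finite[of "A \<inter> cball 0 R"] by auto
    have "integrable lborel (\<lambda>x. indicator (A \<inter> cball 0 R) x *\<^sub>R f x)"
      by (rule integrableI_bounded_set_indicator[where B=C])
        (use bd fin in auto)
    moreover have "(\<lambda>x. indicator (A \<inter> cball 0 R) x *\<^sub>R f x) = (\<lambda>x. indicator A x * f x)"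
      using van by (fastforce simp: indicator_def fun_eq_iff)
    ultimately show ?thesis by simp
  qed
  have in0: "(\<integral>t. indicator A (x + t *\<^sub>R b) * f (x + t *\<^sub>R b) \<partial>lborel) = 0" for x
  proof (cases "x \<in> A")
    case True
    define S where "S = (norm x + \<bar>R\<bar>) / norm b"
    have big: "F (x + t *\<^sub>R b) = 0 \<and> f (x + t *\<^sub>R b) = 0" if "\<bar>t\<bar> \<ge> S" for t
    proof -
      have "norm (t *\<^sub>R b) \<ge> norm x + \<bar>R\<bar>"
        using that False by (simp add: S_def field_simps)
      moreover have "norm (t *\<^sub>R b) \<le> norm (x + t *\<^sub>R b) + norm x"
        by (metis add_diff_cancel_left' norm_triangle_ineq4)
      ultimately have "norm (x + t *\<^sub>R b) \<ge> R" by linarith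
      then show ?thesis using van[OF A[OF True]] by blast
    qed
    have S0: "S \<ge> 0" by (simp add: S_def)
    have "(\<integral>t. indicator {-S<..} t * f (x + t *\<^sub>R b) \<partial>lborel) = - F (x + (-S) *\<^sub>R b)"
    proof (rule integral_FTC_halfline[where C=C and R=S and F="\<lambda>t. F (x + t *\<^sub>R b)"])
      show "continuous_on {- S..} (\<lambda>t. F (x + t *\<^sub>R b))"
        using der'[OF True] by (meson DERIV_isCont continuous_at_imp_continuous_on)
    qed (use der'[OF True] bd big in auto)
    also have "\<dots> = 0" using big[of "-S"] S0 by auto
    finally have "(\<integral>t. indicator {-S<..} t * f (x + t *\<^sub>R b) \<partial>lborel) = 0" .
    moreover have "(\<lambda>t. indicator {-S<..} t * f (x + t *\<^sub>R b)) = (\<lambda>t. indicator A (x + t *\<^sub>R b) * f (x + t *\<^sub>R b))"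
      using big A' True by (fastforce simp: indicator_def fun_eq_iff)
    ultimately show ?thesis by simp
  qed (use A' in simp)
  show ?thesis
    by (subst integral_slab[OF False i]) (simp add: in0)
qed

section \<open>The divergence theorem above a graph\<close>

lemma GDERIV_along_curve:
  assumes f: "GDERIV f (c s) :> G" and c: "(c has_vector_derivative v) (at s)"
  shows "((\<lambda>t. f (c t)) has_real_derivative (v \<bullet> G)) (at s)"
proof -
  have "((\<lambda>t. f (c t)) has_derivative (\<lambda>t. (t *\<^sub>R v) \<bullet> G)) (at s)"
    using has_derivative_compose[OF c[unfolded has_vector_derivative_def] f[unfolded gderiv_def]] .
  then show ?thesis
    unfolding has_field_derivative_def
    by (rule has_derivative_eq_rhs) (auto simp: fun_eq_iff mult.commute)
qed

lemma GDERIV_direction: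
  assumes f: "GDERIV f x :> G"
  shows "((\<lambda>t. f (x + t *\<^sub>R b)) has_real_derivative (b \<bullet> G)) (at 0)"
  by (rule GDERIV_along_curve[where c="\<lambda>t. x + t *\<^sub>R b"])
     (use f in \<open>auto intro!: derivative_eq_intros\<close>)

lemma GDERIV_imp_continuous_on: "(\<And>x. x \<in> S \<Longrightarrow> GDERIV f x :> G x) \<Longrightarrow> continuous_on S f"
  unfolding gderiv_def by (meson continuous_at_imp_continuous_on has_derivative_continuous)

lemma GDERIV_unique:
  assumes "GDERIV f x :> a" "GDERIV f x :> b"
  shows "a = b"
proof -
  have "(\<lambda>h. h \<bullet> a) = (\<lambda>h. h \<bullet> b)"
    using assms unfolding gderiv_def by (rule has_derivative_unique)
  then have "(a - b) \<bullet> a = (a - b) \<bullet> b" by (rule fun_cong)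
  then have "(a - b) \<bullet> (a - b) = 0" by (simp add: inner_diff_right)
  then show ?thesis by simp
qed

lemma continuous_on_bounded_cball:
  fixes f :: "'a::euclidean_space \<Rightarrow> 'b::real_normed_vector"
  assumes "continuous_on UNIV f"
  obtains M where "M > 0" "\<And>x. norm x \<le> R \<Longrightarrow> norm (f x) \<le> M"
proof -
  have "bounded (f ` cball 0 R)"
    by (intro compact_imp_bounded compact_continuous_image continuous_on_subset[OF assms]) auto
  then obtain M where "M > 0" "\<forall>y\<in>f ` cball 0 R. norm y \<le> M" unfolding bounded_pos by blast
  then show ?thesis using that[of M] by auto
qed

lemma GDERIV_invariant:
  assumes G: "\<And>x. GDERIV \<gamma> x :> \<Gamma> x" and inv: "\<And>x t. \<gamma> (x + t *\<^sub>R e) = \<gamma> x"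
  shows "\<Gamma> (x + t *\<^sub>R e) = \<Gamma> x" "\<Gamma> x \<bullet> e = 0"
proof -
  have "((\<lambda>y. \<gamma> (y + t *\<^sub>R e)) has_derivative (\<lambda>h. h \<bullet> \<Gamma> (x + t *\<^sub>R e))) (at x)"
    by (rule has_derivative_compose[of "\<lambda>y. y + t *\<^sub>R e" "\<lambda>h. h" x UNIV \<gamma>, simplified])
       (use G[of "x + t *\<^sub>R e"] in \<open>auto intro!: derivative_eq_intros simp: gderiv_def\<close>)
  then have "GDERIV \<gamma> x :> \<Gamma> (x + t *\<^sub>R e)"
    by (simp add: inv gderiv_def)
  then show "\<Gamma> (x + t *\<^sub>R e) = \<Gamma> x"
    using GDERIV_unique[OF G[of x]] by simp
  have *: "((\<lambda>t. \<gamma> x) has_real_derivative (e \<bullet> \<Gamma> x)) (at 0)"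
    using GDERIV_direction[OF G[of x], of e] by (simp add: inv)
  show "\<Gamma> x \<bullet> e = 0"
    using DERIV_unique[OF * DERIV_const] by (simp add: inner_commute)
qed

lemma integral_shear:
  fixes \<gamma> :: "'a::euclidean_space \<Rightarrow> real" and f :: "'a \<Rightarrow> real"
  assumes inv: "\<And>x t. \<gamma> (x + t *\<^sub>R e) = \<gamma> x"
    and [measurable]: "\<gamma> \<in> borel_measurable borel" "f \<in> borel_measurable borel"
  shows "(\<integral>x. f (x + \<gamma> x *\<^sub>R e) \<partial>lborel) = (\<integral>x. f x \<partial>lborel)"
proof -
  have "lborel = distr lborel borel (\<lambda>x. x + \<gamma> x *\<^sub>R e)"
  proof (rule measure_eqI)
    fix A :: "'a set" assume "A \<in> sets lborel"
    then have [measurable]: "A \<in> sets borel" by simp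
    have "emeasure lborel A = (\<integral>\<^sup>+x. indicator A (x + \<gamma> x *\<^sub>R e) * ennreal (1 + 0) \<partial>lborel)"
      by (subst nn_integral_line_substitution) (auto simp: inv)
    also have "\<dots> = emeasure (distr lborel borel (\<lambda>x. x + \<gamma> x *\<^sub>R e)) A"
      by (subst nn_integral_indicator[symmetric], simp, subst nn_integral_distr) auto
    finally show "emeasure lborel A = emeasure (distr lborel borel (\<lambda>x. x + \<gamma> x *\<^sub>R e)) A" .
  qed simp
  then have "(\<integral>x. f x \<partial>lborel) = (\<integral>x. f x \<partial>(distr lborel borel (\<lambda>x. x + \<gamma> x *\<^sub>R e)))" by simp
  also have "\<dots> = (\<integral>x. f (x + \<gamma> x *\<^sub>R e) \<partial>lborel)"
    by (subst integral_distr) auto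
  finally show ?thesis by simp
qed

lemma integrable_bounded_support:
  fixes f :: "'a::euclidean_space \<Rightarrow> real"
  assumes [measurable]: "f \<in> borel_measurable borel" and bd: "\<And>x. \<bar>f x\<bar> \<le> C"
    and van: "\<And>x. norm x > R \<Longrightarrow> f x = 0"
  shows "integrable lborel f"
proof -
  have fin: "emeasure lborel (cball 0 R :: 'a set) < top"
    using emeasure_bounded_finite[of "cball 0 R :: 'a set"] by auto
  have "integrable lborel (\<lambda>x. indicator (cball 0 R) x *\<^sub>R f x)"
    by (rule integrableI_bounded_set_indicator[where B=C]) (use bd fin in auto)
  moreover have "(\<lambda>x. indicator (cball 0 R) x *\<^sub>R f x) = f"
    using van by (force simp: indicator_def fun_eq_iff)
  ultimately show ?thesis by simp
qed

text \<open>The shear \<open>x + \<gamma> x e\<close> preserves Lebesgue measure and maps the half-space above the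
  hyperplane onto the region above the graph. For \<open>\<psi>(x) = f (x + \<gamma> x e)\<close> a tangential derivative has
  integral zero over the half-space, and a derivative in direction \<open>e\<close> integrates to a boundary term.
  Rewriting the derivatives of \<open>f\<close> as derivatives of \<open>\<psi>\<close> produces the factor \<open>\<nabla>\<gamma> - e\<close>,
  the outward normal scaled by the area density.\<close>

lemma epigraph_divergence:
  fixes \<gamma> f :: "'a::euclidean_space \<Rightarrow> real" and \<Gamma> g :: "'a \<Rightarrow> 'a"
  assumes e: "e \<bullet> e = 1"
    and G: "\<And>x. GDERIV \<gamma> x :> \<Gamma> x" and cG: "continuous_on UNIV \<Gamma>"
    and inv: "\<And>x t. \<gamma> (x + t *\<^sub>R e) = \<gamma> x"
    and f: "\<And>x. \<gamma> x < x \<bullet> e \<Longrightarrow> GDERIV f x :> g x"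
    and cf: "continuous_on {x. \<gamma> x \<le> x \<bullet> e} f"
    and [measurable]: "g \<in> borel_measurable borel" and bd: "\<And>x. norm (g x) \<le> C"
    and van: "\<And>x. \<gamma> x \<le> x \<bullet> e \<Longrightarrow> norm x > R \<Longrightarrow> f x = 0"
      "\<And>x. norm x > R \<Longrightarrow> g x = 0"
  shows "(\<integral>x. indicator {x. \<gamma> x < x \<bullet> e} x * (g x \<bullet> b) \<partial>lborel)
    = (\<integral>x. indicator (slab e) x * (f (x + (\<gamma> x - x \<bullet> e) *\<^sub>R e) * ((\<Gamma> x - e) \<bullet> b)) \<partial>lborel)"
proof -
  have c\<gamma>: "continuous_on UNIV \<gamma>" by (rule GDERIV_imp_continuous_on[OF G])
  then have [measurable]: "\<gamma> \<in> borel_measurable borel" by (rule borel_measurable_continuous_onI)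
  have [measurable]: "\<Gamma> \<in> borel_measurable borel" using cG by (rule borel_measurable_continuous_onI)
  note Ginv = GDERIV_invariant[OF G inv]
  have e0: "e \<noteq> 0" using e by auto
  define \<psi> where "\<psi> x = f (x + \<gamma> x *\<^sub>R e)" for x
  define D where "D x = g (x + \<gamma> x *\<^sub>R e)" for x
  have [measurable]: "D \<in> borel_measurable borel" unfolding D_def by measurable
  define H where "H = {x. 0 < x \<bullet> e}"
  have [measurable]: "H \<in> sets borel" unfolding H_def by measurable
  have Hiff: "\<gamma> (x + \<gamma> x *\<^sub>R e) < (x + \<gamma> x *\<^sub>R e) \<bullet> e \<longleftrightarrow> x \<in> H" for x
    using e by (simp add: inv H_def inner_add_left)
  obtain M where M: "M > 0" "\<And>x. norm x \<le> R \<Longrightarrow> \<bar>\<gamma> x\<bar> \<le> M"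
    using continuous_on_bounded_cball[OF c\<gamma>, of R] by auto
  have big: "norm (x + \<gamma> x *\<^sub>R e) > R" if "norm x > R + M" for x
  proof (rule ccontr)
    assume "\<not> ?thesis"
    then have a: "norm (x + \<gamma> x *\<^sub>R e) \<le> R" by simp
    then have "\<bar>\<gamma> (x + \<gamma> x *\<^sub>R e)\<bar> \<le> M" by (rule M(2))
    then have "\<bar>\<gamma> x\<bar> \<le> M" by (simp add: inv)
    moreover have "norm x \<le> norm (x + \<gamma> x *\<^sub>R e) + norm (\<gamma> x *\<^sub>R e)"
      by (metis add_diff_cancel_right' norm_triangle_ineq4)
    moreover have "norm e = 1" using e by (simp add: norm_eq_sqrt_inner)
    ultimately show False using a that by simp
  qed
  obtain N where N: "N > 0" "\<And>x. norm x \<le> R + M \<Longrightarrow> norm (\<Gamma> x) \<le> N"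
    using continuous_on_bounded_cball[OF cG, of "R + M"] by auto
  have D0: "D x = 0" if "norm x > R + M" for x
    using big[OF that] van by (simp add: D_def)
  have \<psi>0: "\<psi> x = 0" if "norm x > R + M" "0 \<le> x \<bullet> e" for x
    unfolding \<psi>_def by (rule van(1)) (use big[OF that(1)] that(2) e in \<open>auto simp: inv inner_add_left\<close>)
  have DB: "norm (D x) \<le> C" for x using bd by (simp add: D_def)
  have C0: "C \<ge> 0" using norm_ge_zero bd order_trans by blast
  have inn: "\<bar>x \<bullet> y\<bar> \<le> norm x * norm y" for x y :: 'a by (rule Cauchy_Schwarz_ineq2)
  have DDB: "\<bar>D x \<bullet> y\<bar> \<le> C * norm y" for x y
    using inn[of "D x" y] DB[of x] by (meson mult_right_mono norm_ge_zero order_trans)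
  have prodB: "\<bar>(\<Gamma> x \<bullet> c) * (D x \<bullet> y)\<bar> \<le> N * norm c * (C * norm y)" for x y c
  proof (cases "norm x \<le> R + M")
    case True
    have "\<bar>\<Gamma> x \<bullet> c\<bar> \<le> N * norm c"
      using inn[of "\<Gamma> x" c] N(2)[OF True] by (meson mult_right_mono norm_ge_zero order_trans)
    then show ?thesis
      using DDB[of x y] unfolding abs_mult
      by (intro mult_mono) (auto intro: order_trans[OF abs_ge_zero])
  next
    case False
    then have "D x = 0" by (intro D0) simp
    then show ?thesis using C0 N(1) by simp
  qed
  \<comment> \<open>The direction \<open>b\<close> is split into its tangential part \<open>c\<close> and its component along \<open>e\<close>;
    \<open>m\<close> is what multiplies \<open>\<partial>\<^sub>e\<psi>\<close> after the tangential derivative is removed.\<close>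
  define c where "c = b - (b \<bullet> e) *\<^sub>R e"
  have ce: "c \<bullet> e = 0" using e by (simp add: c_def inner_diff_left)
  define m where "m x = b \<bullet> e - \<Gamma> x \<bullet> c" for x
  have [measurable]: "m \<in> borel_measurable borel" unfolding m_def by measurable
  have m\<Gamma>: "m x = - ((\<Gamma> x - e) \<bullet> b)" for x
    using Ginv(2)[of x] by (simp add: m_def c_def inner_diff_right inner_diff_left inner_commute)
  have mB: "\<bar>m x * (D x \<bullet> e)\<bar> \<le> \<bar>b \<bullet> e\<bar> * C + N * norm c * C" for x
  proof -
    have "norm e = 1" using e by (simp add: norm_eq_sqrt_inner)
    then have *: "\<bar>D x \<bullet> e\<bar> \<le> C" "\<bar>(\<Gamma> x \<bullet> c) * (D x \<bullet> e)\<bar> \<le> N * norm c * C"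
      using DDB[of x e] prodB[of x c e] by simp_all
    have "\<bar>m x * (D x \<bullet> e)\<bar> \<le> \<bar>b \<bullet> e\<bar> * \<bar>D x \<bullet> e\<bar> + \<bar>(\<Gamma> x \<bullet> c) * (D x \<bullet> e)\<bar>"
      unfolding m_def left_diff_distrib abs_mult[symmetric] by (rule abs_triangle_ineq4)
    then show ?thesis using * by (smt (verit, best) mult_left_mono abs_ge_zero)
  qed
  have m_inv: "m (x + t *\<^sub>R e) = m x" for x t by (simp add: m_def Ginv)
  have der\<psi>: "((\<lambda>t. \<psi> (x + t *\<^sub>R w)) has_real_derivative (D x \<bullet> w + (\<Gamma> x \<bullet> w) * (D x \<bullet> e))) (at 0)"
    if "x \<in> H" for x w
  proof -
    have c': "((\<lambda>t. x + t *\<^sub>R w + \<gamma> (x + t *\<^sub>R w) *\<^sub>R e) has_vector_derivative (w + (\<Gamma> x \<bullet> w) *\<^sub>R e)) (at 0)"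
      using GDERIV_direction[OF G[of x], of w]
      by (auto intro!: derivative_eq_intros simp: inner_commute)
    have f': "GDERIV f ((\<lambda>t. x + t *\<^sub>R w + \<gamma> (x + t *\<^sub>R w) *\<^sub>R e) 0) :> D x"
      using f[of "x + \<gamma> x *\<^sub>R e"] that by (simp add: Hiff D_def)
    show ?thesis
      using GDERIV_along_curve[OF f' c'] by (simp add: \<psi>_def inner_add_left inner_add_right inner_commute)
  qed
  \<comment> \<open>The half-space is a union of lines in direction \<open>c\<close>.\<close>
  have tang: "(\<integral>x. indicator H x * (D x \<bullet> c + (\<Gamma> x \<bullet> c) * (D x \<bullet> e)) \<partial>lborel) = 0"
  proof (rule integral_derivative_invariant_set[where b=c and F=\<psi> and C="C * norm c + N * norm c * (C * norm e)" and R="R + M + 1"])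
    show "x + t *\<^sub>R c \<in> H" if "x \<in> H" for x t
      using that by (simp add: H_def inner_add_left ce)
    show "\<bar>D x \<bullet> c + (\<Gamma> x \<bullet> c) * (D x \<bullet> e)\<bar> \<le> C * norm c + N * norm c * (C * norm e)" for x
      using DDB[of x c] prodB[of x c e] by linarith
    show "\<psi> x = 0 \<and> D x \<bullet> c + (\<Gamma> x \<bullet> c) * (D x \<bullet> e) = 0" if "x \<in> H" "R + M + 1 \<le> norm x" for x
      using that \<psi>0[of x] D0[of x] by (auto simp: H_def)
  qed (use der\<psi> in auto)
  have i1: "integrable lborel (\<lambda>x. indicator H x * (D x \<bullet> c + (\<Gamma> x \<bullet> c) * (D x \<bullet> e)))"
  proof (rule integrable_bounded_support[where C="C * norm c + N * norm c * (C * norm e)" and R="R + M"])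
    show "\<bar>indicator H x * (D x \<bullet> c + (\<Gamma> x \<bullet> c) * (D x \<bullet> e))\<bar> \<le> C * norm c + N * norm c * (C * norm e)" for x
      using DDB[of x c] prodB[of x c e] by (auto simp: indicator_def)
  qed (use D0 in auto)
  have i2: "integrable lborel (\<lambda>x. indicator H x * (m x * (D x \<bullet> e)))"
    by (rule integrable_bounded_support[where C="\<bar>b \<bullet> e\<bar> * C + N * norm c * C" and R="R + M"])
      (use D0 mB in \<open>auto simp: indicator_def intro: order_trans[OF abs_ge_zero]\<close>)
  \<comment> \<open>The factor \<open>m\<close> is constant on the lines in direction \<open>e\<close> and leaves the inner integral.\<close>
  have normal: "(\<integral>x. indicator H x * (m x * (D x \<bullet> e)) \<partial>lborel)
      = (\<integral>x. indicator (slab e) x * (- (m x) * \<psi> (x - (x \<bullet> e) *\<^sub>R e)) \<partial>lborel)"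
  proof -
    have inner: "(\<integral>t. indicator H (x + t *\<^sub>R e) * (m (x + t *\<^sub>R e) * (D (x + t *\<^sub>R e) \<bullet> e)) \<partial>lborel)
        = - (m x) * \<psi> (x - (x \<bullet> e) *\<^sub>R e)" for x
    proof -
      have H': "indicator H (x + t *\<^sub>R e) = (indicator {- (x \<bullet> e)<..} t :: real)" for t
        using e by (auto simp: H_def indicator_def inner_add_left)
      define S where "S = norm x + \<bar>R\<bar> + M + 1"
      have big': "norm (x + t *\<^sub>R e) > R + M" if "t \<ge> S" for t
      proof -
        have ne: "norm e = 1" using e by (simp add: norm_eq_sqrt_inner)
        have "S \<ge> 0" using M(1) by (simp add: S_def)
        have "norm (t *\<^sub>R e) \<le> norm (x + t *\<^sub>R e) + norm x"
          by (metis add_diff_cancel_left' norm_triangle_ineq4)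
        then show ?thesis using that ne \<open>S \<ge> 0\<close> by (simp add: S_def)
      qed
      have "(\<integral>t. indicator {- (x \<bullet> e)<..} t * (D (x + t *\<^sub>R e) \<bullet> e) \<partial>lborel) = - \<psi> (x + (- (x \<bullet> e)) *\<^sub>R e)"
      proof (rule integral_FTC_halfline[where C=C and R="max S (- (x \<bullet> e))" and F="\<lambda>t. \<psi> (x + t *\<^sub>R e)"])
        fix t assume "- (x \<bullet> e) < t"
        then have "x + t *\<^sub>R e \<in> H" using e by (simp add: H_def inner_add_left)
        from der\<psi>[OF this, of e]
        have "((\<lambda>s. \<psi> (x + t *\<^sub>R e + s *\<^sub>R e)) has_real_derivative D (x + t *\<^sub>R e) \<bullet> e) (at 0)"
          by (simp add: Ginv)
        then show "((\<lambda>t. \<psi> (x + t *\<^sub>R e)) has_real_derivative D (x + t *\<^sub>R e) \<bullet> e) (at t)"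
          using DERIV_at_within_shift[of "\<lambda>t. \<psi> (x + t *\<^sub>R e)" _ t 0 UNIV] by (simp add: algebra_simps)
      next
        show "continuous_on {- (x \<bullet> e)..} (\<lambda>t. \<psi> (x + t *\<^sub>R e))"
          unfolding \<psi>_def
          by (rule continuous_on_compose2[OF cf])
             (use e in \<open>auto simp: inv inner_add_left intro!: continuous_intros\<close>)
      next
        show "\<bar>D (x + t *\<^sub>R e) \<bullet> e\<bar> \<le> C" for t
          using DDB[of "x + t *\<^sub>R e" e] e by (simp add: norm_eq_sqrt_inner)
      next
        show "\<psi> (x + t *\<^sub>R e) = 0" if "max S (- (x \<bullet> e)) \<le> t" for t
          by (rule \<psi>0) (use that big'[of t] e in \<open>auto simp: inner_add_left\<close>)
        show "D (x + t *\<^sub>R e) \<bullet> e = 0" if "max S (- (x \<bullet> e)) \<le> t" for t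
          using D0 big'[of t] that by simp
      qed simp
      then have "m x * (\<integral>t. indicator {- (x \<bullet> e)<..} t * (D (x + t *\<^sub>R e) \<bullet> e) \<partial>lborel)
          = - (m x) * \<psi> (x - (x \<bullet> e) *\<^sub>R e)" by simp
      then show ?thesis
        unfolding H' m_inv by (subst (asm) integral_mult_right_zero[symmetric]) (simp add: mult.left_commute)
    qed
    show ?thesis by (subst integral_slab[OF e0 i2]) (simp only: inner)
  qed
  have "(\<integral>x. indicator {x. \<gamma> x < x \<bullet> e} x * (g x \<bullet> b) \<partial>lborel)
      = (\<integral>x. indicator {x. \<gamma> x < x \<bullet> e} (x + \<gamma> x *\<^sub>R e) * (g (x + \<gamma> x *\<^sub>R e) \<bullet> b) \<partial>lborel)"
    by (rule integral_shear[symmetric, OF inv]) measurable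
  also have "\<dots> = (\<integral>x. indicator H x * (D x \<bullet> c + (\<Gamma> x \<bullet> c) * (D x \<bullet> e)) + indicator H x * (m x * (D x \<bullet> e)) \<partial>lborel)"
  proof (rule Bochner_Integration.integral_cong[OF refl])
    fix x
    have 1: "indicator {x. \<gamma> x < x \<bullet> e} (x + \<gamma> x *\<^sub>R e) = (indicator H x :: real)"
      using Hiff[of x] by (simp add: indicator_def)
    have "b = c + (b \<bullet> e) *\<^sub>R e" by (simp add: c_def)
    then have "D x \<bullet> b = D x \<bullet> c + (b \<bullet> e) * (D x \<bullet> e)" by (metis inner_add_right inner_scaleR_right)
    then show "indicator {x. \<gamma> x < x \<bullet> e} (x + \<gamma> x *\<^sub>R e) * (g (x + \<gamma> x *\<^sub>R e) \<bullet> b)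
      = indicator H x * (D x \<bullet> c + (\<Gamma> x \<bullet> c) * (D x \<bullet> e)) + indicator H x * (m x * (D x \<bullet> e))"
      unfolding 1 D_def[symmetric] by (simp add: m_def algebra_simps)
  qed
  also have "\<dots> = (\<integral>x. indicator (slab e) x * (- (m x) * \<psi> (x - (x \<bullet> e) *\<^sub>R e)) \<partial>lborel)"
    by (subst Bochner_Integration.integral_add[OF i1 i2]) (simp add: tang normal)
  also have "\<dots> = (\<integral>x. indicator (slab e) x * (f (x + (\<gamma> x - x \<bullet> e) *\<^sub>R e) * ((\<Gamma> x - e) \<bullet> b)) \<partial>lborel)"
  proof (rule Bochner_Integration.integral_cong[OF refl])
    fix x
    have "\<gamma> (x - (x \<bullet> e) *\<^sub>R e) = \<gamma> x" using inv[of x "- (x \<bullet> e)"] by simp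
    then have "\<psi> (x - (x \<bullet> e) *\<^sub>R e) = f (x + (\<gamma> x - x \<bullet> e) *\<^sub>R e)"
      by (simp add: \<psi>_def scaleR_diff_left algebra_simps)
    then show "indicator (slab e) x * (- (m x) * \<psi> (x - (x \<bullet> e) *\<^sub>R e))
       = indicator (slab e) x * (f (x + (\<gamma> x - x \<bullet> e) *\<^sub>R e) * ((\<Gamma> x - e) \<bullet> b))"
      by (simp add: m\<Gamma>)
  qed
  finally show ?thesis .
qed

section \<open>Boundary charts and the outward normal\<close>

lemma grad_eqI: "GDERIV f x :> g \<Longrightarrow> grad f x = g"
  unfolding grad_def by (rule the_equality) (auto intro: GDERIV_unique)

definition chart_normal :: "'a::euclidean_space \<Rightarrow> ('a \<Rightarrow> real) \<Rightarrow> 'a \<Rightarrow> 'a" where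
  "chart_normal e \<gamma> x = (1 / sqrt (1 + (norm (grad \<gamma> x))\<^sup>2)) *\<^sub>R (grad \<gamma> x - e)"

definition graph_point :: "'a::euclidean_space \<Rightarrow> ('a \<Rightarrow> real) \<Rightarrow> 'a \<Rightarrow> 'a" where
  "graph_point e \<gamma> x = x + (\<gamma> x - x \<bullet> e) *\<^sub>R e"

context
  fixes \<Omega> :: "'a::euclidean_space set" and x0 r e \<gamma>
  assumes chart: "C2_boundary_chart \<Omega> x0 r e \<gamma>"
begin

lemma chart_radius: "r > 0"
  using chart by (simp add: C2_boundary_chart_def)

lemma chart_direction: "e \<bullet> e = 1"
  using chart unfolding C2_boundary_chart_def
  by (metis inner_Basis inner_minus_left inner_minus_right minus_minus)

lemma chart_norm_direction: "norm e = 1"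
  using chart_direction by (simp add: norm_eq_sqrt_inner)

lemma chart_invariant: "\<gamma> (x + t *\<^sub>R e) = \<gamma> x"
  using chart by (simp add: C2_boundary_chart_def)

lemma chart_domain: "x \<in> ball x0 r \<Longrightarrow> x \<in> \<Omega> \<longleftrightarrow> \<gamma> x < x \<bullet> e"
  using chart unfolding C2_boundary_chart_def by blast

lemma chart_GDERIV: "GDERIV \<gamma> x :> grad \<gamma> x"
  and chart_continuous_grad: "continuous_on UNIV (grad \<gamma>)"
proof -
  obtain G where G: "continuous_on UNIV G" "\<And>x. GDERIV \<gamma> x :> G x"
    using chart unfolding C2_boundary_chart_def C2_closure_def by auto
  have "grad \<gamma> = G" using grad_eqI[OF G(2)] by auto
  then show "GDERIV \<gamma> x :> grad \<gamma> x" "continuous_on UNIV (grad \<gamma>)" using G by auto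
qed

lemma chart_continuous: "continuous_on S \<gamma>"
  by (rule GDERIV_imp_continuous_on[OF chart_GDERIV])

lemma chart_measurable [measurable]: "\<gamma> \<in> borel_measurable borel"
  "grad \<gamma> \<in> borel_measurable borel"
  using chart_continuous chart_continuous_grad by (auto intro: borel_measurable_continuous_onI)

lemmas chart_grad_invariant = GDERIV_invariant[OF chart_GDERIV chart_invariant]

lemma graph_point_eqs: "\<gamma> (graph_point e \<gamma> x) = \<gamma> x" "grad \<gamma> (graph_point e \<gamma> x) = grad \<gamma> x"
  "graph_point e \<gamma> x \<bullet> e = \<gamma> x"
  using chart_direction by (simp_all add: graph_point_def chart_invariant chart_grad_invariant inner_add_left)

lemma chart_normal_graph_point: "chart_normal e \<gamma> (graph_point e \<gamma> x) = chart_normal e \<gamma> x"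
  by (simp add: chart_normal_def graph_point_eqs)

lemma graph_point_measurable [measurable]: "graph_point e \<gamma> \<in> borel_measurable borel"
  unfolding graph_point_def[abs_def] by measurable

lemma chart_normal_continuous: "continuous_on S (chart_normal e \<gamma>)"
proof -
  have "1 + (norm (grad \<gamma> x))\<^sup>2 > 0" for x by (rule add_pos_nonneg) auto
  then have *: "sqrt (1 + (norm (grad \<gamma> x))\<^sup>2) \<noteq> 0" for x by (metis less_irrefl real_sqrt_eq_0_iff)
  show ?thesis
    unfolding chart_normal_def[abs_def]
    by (intro continuous_intros continuous_on_subset[OF chart_continuous_grad]) (use * in auto)
qed

lemma chart_normal_measurable [measurable]: "chart_normal e \<gamma> \<in> borel_measurable borel"
  using chart_normal_continuous by (rule borel_measurable_continuous_onI)

lemma norm_grad_minus_direction: "norm (grad \<gamma> x - e) = sqrt (1 + (norm (grad \<gamma> x))\<^sup>2)"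
  using chart_grad_invariant(2)[of x] chart_direction
  unfolding norm_eq_sqrt_inner by (simp add: inner_diff_left inner_diff_right inner_commute)

lemma norm_chart_normal: "norm (chart_normal e \<gamma> x) = 1"
proof -
  have "1 + (norm (grad \<gamma> x))\<^sup>2 > 0" by (rule add_pos_nonneg) auto
  then show ?thesis by (simp add: chart_normal_def norm_grad_minus_direction)
qed

lemma chart_normal_direction: "chart_normal e \<gamma> x \<bullet> (- e) = 1 / sqrt (1 + (norm (grad \<gamma> x))\<^sup>2)"
  by (simp add: chart_normal_def inner_diff_left chart_grad_invariant chart_direction)

lemma chart_closure: assumes x: "x \<in> ball x0 r" shows "x \<in> closure \<Omega> \<longleftrightarrow> \<gamma> x \<le> x \<bullet> e"
proof
  assume "x \<in> closure \<Omega>"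
  then have "x \<in> closure (\<Omega> \<inter> ball x0 r)"
    using x open_Int_closure_subset[OF open_ball, of x0 r \<Omega>] by (auto simp: Int_commute)
  moreover have "\<Omega> \<inter> ball x0 r \<subseteq> {x. \<gamma> x \<le> x \<bullet> e}" using chart_domain by fastforce
  moreover have "closed {x. \<gamma> x \<le> x \<bullet> e}"
    by (intro closed_Collect_le continuous_intros chart_continuous)
  ultimately show "\<gamma> x \<le> x \<bullet> e" using closure_minimal by blast
next
  assume le: "\<gamma> x \<le> x \<bullet> e"
  have "((\<lambda>t. x + t *\<^sub>R e) \<longlongrightarrow> x + 0 *\<^sub>R e) (at_right 0)" by (intro tendsto_intros)
  then have lim: "((\<lambda>t. x + t *\<^sub>R e) \<longlongrightarrow> x) (at_right (0::real))" by simp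
  have ev: "\<forall>\<^sub>F t in at_right 0. x + t *\<^sub>R e \<in> ball x0 r"
    using lim x by (rule topological_tendstoD[OF _ open_ball])
  have "\<forall>\<^sub>F t in at_right (0::real). 0 < t" by (rule eventually_at_right_less)
  with ev have "\<forall>\<^sub>F t in at_right 0. x + t *\<^sub>R e \<in> closure \<Omega>"
  proof eventually_elim
    case (elim t)
    then have "x + t *\<^sub>R e \<in> \<Omega>"
      using le chart_direction by (subst chart_domain) (auto simp: chart_invariant inner_add_left)
    then show ?case using closure_subset by blast
  qed
  then show "x \<in> closure \<Omega>"
    using Lim_in_closed_set[OF closed_closure _ _ lim] by (simp add: trivial_limit_at_right_real)
qed

lemma chart_frontier: assumes "open \<Omega>" "x \<in> ball x0 r" shows "x \<in> frontier \<Omega> \<longleftrightarrow> \<gamma> x = x \<bullet> e"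
  using assms chart_closure chart_domain by (auto simp: frontier_def interior_open)

text \<open>The chart normal is admissible because the function \<open>x \<bullet> e - \<gamma> x\<close>, which inside the ball is
  positive exactly on \<open>\<Omega>\<close> and zero on the boundary, has its gradient in the opposite direction. Conversely, a competitor is
  orthogonal to the velocity of every curve in the graph. Since the curves must stay in the boundary for all
  times, the straight motion in the hyperplane is replaced by the bounded one \<open>\<epsilon> sin (t / \<epsilon>)\<close>, which has the
  same velocity at \<open>0\<close>. This leaves only two opposite unit vectors, and pointing outward selects one.\<close>

lemma chart_outward_normal:
  assumes op: "open \<Omega>" and x: "x \<in> frontier \<Omega>" "x \<in> ball x0 r"
  shows "outward_normal \<Omega> x = chart_normal e \<gamma> x"
  unfolding outward_normal_def
proof (rule the_equality)
  let ?N = "chart_normal e \<gamma> x" and ?s = "sqrt (1 + (norm (grad \<gamma> x))\<^sup>2)"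
  have s0: "?s > 0" by (simp add: add_pos_nonneg)
  have ss: "?s * ?s = 1 + grad \<gamma> x \<bullet> grad \<gamma> x"
    by (simp add: power2_norm_eq_inner[symmetric] add_nonneg_nonneg)
  have \<gamma>x: "\<gamma> x = x \<bullet> e" using chart_frontier[OF op x(2)] x(1) by simp
  have ex: "chart_normal e \<gamma> x = (1 / ?s) *\<^sub>R (grad \<gamma> x - e)" by (simp add: chart_normal_def)
  show N: "is_outward_unit_normal \<Omega> x ?N"
    unfolding is_outward_unit_normal_def
  proof (intro conjI allI impI)
    show "norm ?N = 1" by (rule norm_chart_normal)
  next
    fix c :: "real \<Rightarrow> 'a" and w
    assume "c 0 = x \<and> (\<forall>t. c t \<in> frontier \<Omega>) \<and> (c has_vector_derivative w) (at 0)"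
    then have c: "c 0 = x" "\<And>t. c t \<in> frontier \<Omega>" "(c has_vector_derivative w) (at 0)" by auto
    have "((\<lambda>t. \<gamma> (c t)) has_real_derivative w \<bullet> grad \<gamma> x) (at 0)"
      using GDERIV_along_curve[OF chart_GDERIV c(3)] c(1) by simp
    then have d1: "((\<lambda>t. \<gamma> (c t) - c t \<bullet> e) has_real_derivative w \<bullet> grad \<gamma> x - w \<bullet> e) (at 0)"
      by (intro DERIV_diff)
         (use bounded_linear.has_vector_derivative[OF bounded_linear_inner_left c(3)] in
            \<open>auto simp: has_real_derivative_iff_has_vector_derivative\<close>)
    have "(c \<longlongrightarrow> x) (at 0)"
      using c(1,3) has_vector_derivative_continuous continuous_at by (metis isContD)
    then have "\<forall>\<^sub>F t in at 0. c t \<in> ball x0 r"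
      using x(2) by (rule topological_tendstoD[OF _ open_ball])
    then have "\<forall>\<^sub>F t in at 0. \<gamma> (c t) - c t \<bullet> e = 0"
      by eventually_elim (use chart_frontier[OF op] c(2) in auto)
    then have ev: "\<forall>\<^sub>F t in nhds 0. \<gamma> (c t) - c t \<bullet> e = 0"
      using \<gamma>x c(1) by (simp add: eventually_nhds_conv_at)
    have "((\<lambda>t. 0) has_real_derivative w \<bullet> grad \<gamma> x - w \<bullet> e) (at 0)"
      using d1 DERIV_cong_ev[OF refl ev refl] by blast
    then have "w \<bullet> grad \<gamma> x - w \<bullet> e = 0"
      using DERIV_unique DERIV_const by blast
    then show "?N \<bullet> w = 0" unfolding ex by (simp add: inner_diff_left inner_diff_right inner_commute)
  next
    define k where "k t = (x + t *\<^sub>R ?N) \<bullet> e - \<gamma> (x + t *\<^sub>R ?N)" for t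
    have "((\<lambda>t. \<gamma> (x + t *\<^sub>R ?N)) has_real_derivative ?N \<bullet> grad \<gamma> x) (at 0)"
      by (rule GDERIV_direction[OF chart_GDERIV])
    then have dk: "(k has_real_derivative (?N \<bullet> e - ?N \<bullet> grad \<gamma> x)) (at 0)"
      unfolding k_def by (intro DERIV_diff) (auto intro!: derivative_eq_intros simp: inner_add_left)
    have "?N \<bullet> e - ?N \<bullet> grad \<gamma> x = (1 / ?s) * ((grad \<gamma> x - e) \<bullet> e - (grad \<gamma> x - e) \<bullet> grad \<gamma> x)"
      by (simp add: ex right_diff_distrib)
    also have "(grad \<gamma> x - e) \<bullet> e - (grad \<gamma> x - e) \<bullet> grad \<gamma> x = - (?s * ?s)"
      unfolding ss using chart_grad_invariant(2)[of x] chart_direction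
      by (simp add: inner_diff_left inner_diff_right inner_commute)
    finally have "?N \<bullet> e - ?N \<bullet> grad \<gamma> x = (1 / ?s) * (- (?s * ?s))" .
    moreover have "(1 / s) * (- (s * s)) = - s" if "s > 0" for s :: real using that by simp
    ultimately have "?N \<bullet> e - ?N \<bullet> grad \<gamma> x < 0" using s0 by (metis neg_less_0_iff_less)
    with dk obtain d1 d2 where d: "d1 > 0" "\<And>h. h > 0 \<Longrightarrow> h < d1 \<Longrightarrow> k 0 > k (0 + h)"
       "d2 > 0" "\<And>h. h > 0 \<Longrightarrow> h < d2 \<Longrightarrow> k 0 < k (0 - h)"
      using DERIV_neg_dec_right[OF dk] DERIV_neg_dec_left[OF dk] by blast
    have k0: "k 0 = 0" by (simp add: k_def \<gamma>x)
    have "((\<lambda>t. x + t *\<^sub>R ?N) \<longlongrightarrow> x + 0 *\<^sub>R ?N) (at_right 0)" by (intro tendsto_intros)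
    then have e1: "\<forall>\<^sub>F t in at_right 0. x + t *\<^sub>R ?N \<in> ball x0 r"
      using x(2) by (intro topological_tendstoD[OF _ open_ball]) auto
    have "((\<lambda>t. x - t *\<^sub>R ?N) \<longlongrightarrow> x - 0 *\<^sub>R ?N) (at_right 0)" by (intro tendsto_intros)
    then have e2: "\<forall>\<^sub>F t in at_right 0. x - t *\<^sub>R ?N \<in> ball x0 r"
      using x(2) by (intro topological_tendstoD[OF _ open_ball]) auto
    have e3: "\<forall>\<^sub>F t in at_right (0::real). 0 < t \<and> t < min d1 d2"
      unfolding eventually_at_right_field using d by (intro exI[of _ "min d1 d2"]) auto
    show "\<forall>\<^sub>F t in at_right 0. x + t *\<^sub>R ?N \<notin> closure \<Omega> \<and> x - t *\<^sub>R ?N \<in> \<Omega>"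
      using e1 e2 e3
    proof eventually_elim
      case (elim t)
      have "k t < 0" "k (- t) > 0" using d(2,4)[of t] elim(3) k0 by auto
      then show ?case using elim by (auto simp: chart_closure chart_domain k_def)
    qed
  qed
  fix n assume n: "is_outward_unit_normal \<Omega> x n"
  have key: "n \<bullet> w + (grad \<gamma> x \<bullet> w) * (n \<bullet> e) = 0" if we: "w \<bullet> e = 0" for w
  proof -
    define k where "k s = x + s *\<^sub>R w + (\<gamma> (x + s *\<^sub>R w) - \<gamma> x) *\<^sub>R e" for s
    have "isCont k 0" unfolding k_def
      by (intro continuous_intros continuous_at_compose[of 0 "\<lambda>s. x + s *\<^sub>R w" \<gamma>, unfolded o_def])
         (use chart_continuous[of UNIV] in \<open>auto simp: continuous_on_eq_continuous_at\<close>)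
    then have "(k \<longlongrightarrow> k 0) (nhds 0)" by (simp add: isCont_def tendsto_at_iff_tendsto_nhds)
    then have "\<forall>\<^sub>F s in nhds 0. k s \<in> ball x0 r"
      by (rule topological_tendstoD[OF _ open_ball]) (use x(2) in \<open>simp add: k_def\<close>)
    then obtain d where d: "d > 0" "\<And>s. \<bar>s\<bar> < d \<Longrightarrow> k s \<in> ball x0 r"
      unfolding eventually_nhds_metric by (auto simp: dist_real_def)
    define \<epsilon> where "\<epsilon> = d / 2"
    have \<epsilon>: "\<epsilon> > 0" "\<And>s. \<bar>s\<bar> \<le> \<epsilon> \<Longrightarrow> k s \<in> ball x0 r" using d by (auto simp: \<epsilon>_def)
    define c where "c t = k (\<epsilon> * sin (t / \<epsilon>))" for t
    have fr: "c t \<in> frontier \<Omega>" for t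
    proof -
      have "\<bar>\<epsilon> * sin (t / \<epsilon>)\<bar> \<le> \<epsilon>" using \<epsilon>(1) abs_sin_le_one[of "t / \<epsilon>"] by (simp add: abs_mult)
      then have b: "c t \<in> ball x0 r" using \<epsilon>(2) by (simp add: c_def)
      have "\<gamma> (k s) = k s \<bullet> e" for s
        using chart_direction we \<gamma>x by (simp add: k_def chart_invariant inner_add_left)
      then show ?thesis using chart_frontier[OF op b] by (simp add: c_def)
    qed
    have s': "((\<lambda>t. \<epsilon> * sin (t / \<epsilon>)) has_real_derivative 1) (at 0)"
      using \<epsilon>(1) by (auto intro!: derivative_eq_intros)
    have kd: "(k has_vector_derivative (w + (w \<bullet> grad \<gamma> x) *\<^sub>R e)) (at 0)"
      unfolding k_def
      by (auto intro!: derivative_eq_intros GDERIV_direction[OF chart_GDERIV])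
    have "(k \<circ> (\<lambda>t. \<epsilon> * sin (t / \<epsilon>)) has_vector_derivative 1 *\<^sub>R (w + (w \<bullet> grad \<gamma> x) *\<^sub>R e)) (at 0)"
      by (rule vector_diff_chain_at) (use s' kd in \<open>auto simp: has_real_derivative_iff_has_vector_derivative\<close>)
    then have "(c has_vector_derivative (w + (w \<bullet> grad \<gamma> x) *\<^sub>R e)) (at 0)"
      by (simp add: c_def[abs_def] o_def)
    moreover have "c 0 = x" by (simp add: c_def k_def)
    ultimately have "n \<bullet> (w + (w \<bullet> grad \<gamma> x) *\<^sub>R e) = 0"
      using n fr unfolding is_outward_unit_normal_def by blast
    then show ?thesis by (simp add: inner_add_right inner_commute)
  qed
  define a where "a = n \<bullet> e"
  define w where "w = n - a *\<^sub>R e + a *\<^sub>R grad \<gamma> x"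
  have we: "w \<bullet> e = 0"
    using chart_direction chart_grad_invariant(2)[of x]
    by (simp add: w_def a_def inner_diff_left inner_add_left)
  have "n \<bullet> w + a * (grad \<gamma> x \<bullet> w) - a * (e \<bullet> w) = 0"
    using key[OF we] we by (simp add: a_def inner_commute mult.commute)
  then have "w \<bullet> w = 0" by (subst (1) w_def) (simp add: inner_diff_left inner_add_left)
  then have "w = 0" by simp
  then have neq: "n = (- a) *\<^sub>R (grad \<gamma> x - e)" by (simp add: w_def algebra_simps)
  have "norm n = 1" using n by (simp add: is_outward_unit_normal_def)
  then have "\<bar>a\<bar> * ?s = 1" by (simp add: neq norm_grad_minus_direction)
  then have "\<bar>a\<bar> = 1 / ?s" using s0 by (simp add: field_simps)
  moreover have "a \<noteq> 1 / ?s"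
  proof
    assume "a = 1 / ?s"
    then have "n = - ?N" by (simp add: neq ex)
    then have "\<forall>\<^sub>F t in at_right 0. x + t *\<^sub>R ?N \<in> \<Omega>"
      using n unfolding is_outward_unit_normal_def by (auto elim: eventually_mono)
    moreover have "\<forall>\<^sub>F t in at_right 0. x + t *\<^sub>R ?N \<notin> closure \<Omega>"
      using N unfolding is_outward_unit_normal_def by (auto elim: eventually_mono)
    ultimately have "\<forall>\<^sub>F t in at_right (0::real). False"
      by eventually_elim (use closure_subset in blast)
    then show False by (simp add: trivial_limit_at_right_real)
  qed
  ultimately have "- a = 1 / ?s" using s0 by (auto simp: abs_if split: if_splits)
  then show "n = ?N" unfolding neq ex by simp
qed

end

section \<open>Test functions of class C1 and the divergence theorem in a chart\<close>

definition C1_function :: "('a::euclidean_space \<Rightarrow> real) \<Rightarrow> bool" where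
  "C1_function f \<longleftrightarrow> (\<exists>g. (\<forall>x. GDERIV f x :> g x) \<and> continuous_on UNIV g)"

lemma C1_function_mult:
  assumes "C1_function f" "C1_function g" shows "C1_function (\<lambda>x. f x * g x)"
proof -
  obtain f' g' where f: "\<And>x. GDERIV f x :> f' x" "continuous_on UNIV f'"
    and g: "\<And>x. GDERIV g x :> g' x" "continuous_on UNIV g'"
    using assms unfolding C1_function_def by blast
  have "continuous_on UNIV f" "continuous_on UNIV g"
    using GDERIV_imp_continuous_on f(1) g(1) by blast+
  with f g show ?thesis
    unfolding C1_function_def
    by (intro exI[of _ "\<lambda>x. f x *\<^sub>R g' x + g x *\<^sub>R f' x"] conjI allI GDERIV_mult continuous_intros)
qed

lemma C1_function_add:
  assumes "C1_function f" "C1_function g" shows "C1_function (\<lambda>x. f x + g x)"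
proof -
  obtain f' g' where f: "\<And>x. GDERIV f x :> f' x" "continuous_on UNIV f'"
    and g: "\<And>x. GDERIV g x :> g' x" "continuous_on UNIV g'"
    using assms unfolding C1_function_def by blast
  then show ?thesis
    unfolding C1_function_def
    by (intro exI[of _ "\<lambda>x. f' x + g' x"] conjI allI GDERIV_add continuous_intros)
qed

lemma C1_function_const: "C1_function (\<lambda>x. c)"
  unfolding C1_function_def by (intro exI[of _ "\<lambda>x. 0"]) (auto intro: GDERIV_const)

lemma C1_function_prod:
  "finite I \<Longrightarrow> (\<And>i. i \<in> I \<Longrightarrow> C1_function (f i)) \<Longrightarrow> C1_function (\<lambda>x. \<Prod>i\<in>I. f i x)"
  by (induction rule: finite_induct) (simp_all add: C1_function_const C1_function_mult)

lemma C1_function_sum: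
  "finite I \<Longrightarrow> (\<And>i. i \<in> I \<Longrightarrow> C1_function (f i)) \<Longrightarrow> C1_function (\<lambda>x. \<Sum>i\<in>I. f i x)"
  by (induction rule: finite_induct) (simp_all add: C1_function_const C1_function_add)

lemma C1_function_compose:
  assumes f: "C1_function f" and p: "\<And>t. (p has_real_derivative p' t) (at t)" "continuous_on UNIV p'"
  shows "C1_function (\<lambda>x. p (f x))"
proof -
  obtain f' where f': "\<And>x. GDERIV f x :> f' x" "continuous_on UNIV f'"
    using f unfolding C1_function_def by blast
  have "continuous_on UNIV f" using GDERIV_imp_continuous_on f'(1) by blast
  then have "continuous_on UNIV (\<lambda>x. p' (f x))"
    using continuous_on_compose2[OF p(2)] by auto
  with f' p show ?thesis
    unfolding C1_function_def
    by (intro exI[of _ "\<lambda>x. p' (f x) *\<^sub>R f' x"] conjI allI GDERIV_DERIV_compose continuous_intros) auto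
qed

lemma C1_function_affine: "C1_function (\<lambda>x. c + s * (x \<bullet> a))"
proof -
  have "GDERIV (\<lambda>x. c + s * (x \<bullet> a)) x :> s *\<^sub>R a" for x
    unfolding gderiv_def by (auto intro!: derivative_eq_intros)
  then show ?thesis unfolding C1_function_def by (intro exI[of _ "\<lambda>x. s *\<^sub>R a"]) auto
qed

definition pos_square :: "real \<Rightarrow> real" where
  "pos_square t = (max 0 t)\<^sup>2"

lemma pos_square_nonneg [simp]: "pos_square t \<ge> 0"
  and pos_square_pos: "pos_square t > 0 \<longleftrightarrow> t > 0"
  and pos_square_eq_0: "pos_square t = 0 \<longleftrightarrow> t \<le> 0"
  by (auto simp: pos_square_def max_def)

lemma pos_square_derivative: "(pos_square has_real_derivative 2 * max 0 t) (at t)"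
proof (cases t "0::real" rule: linorder_cases)
  case less
  have "((\<lambda>t. 0) has_real_derivative 0) (at t)" by simp
  then have "(pos_square has_real_derivative 0) (at t)"
    by (rule has_field_derivative_transform_within_open[of _ _ _ "{..<0}"])
       (use less in \<open>auto simp: pos_square_def max_def\<close>)
  then show ?thesis using less by simp
next
  case greater
  have "((\<lambda>t. t\<^sup>2) has_real_derivative 2 * t) (at t)" by (auto intro!: derivative_eq_intros)
  then have "(pos_square has_real_derivative 2 * t) (at t)"
    by (rule has_field_derivative_transform_within_open[of _ _ _ "{0<..}"])
       (use greater in \<open>auto simp: pos_square_def max_def\<close>)
  then show ?thesis using greater by simp
next
  case equal
  have "((\<lambda>h. max 0 h) \<longlongrightarrow> max 0 0) (at (0::real))" by (intro tendsto_intros)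
  then have "((\<lambda>h. max 0 h) \<longlongrightarrow> 0) (at (0::real))" by simp
  moreover have "(pos_square (0 + h) - pos_square 0) / h = max 0 h" for h :: real
    by (auto simp: pos_square_def max_def power2_eq_square)
  ultimately show ?thesis using equal by (simp add: DERIV_def)
qed

text \<open>As \<open>n\<close> grows these functions increase to the indicator of the positive half-line; composed with
  a nonnegative function \<open>Q\<close> of class C1 they approximate the indicator of \<open>{Q > 0}\<close> by C1 functions.\<close>

lemma pos_square_saturated_derivative:
  fixes n :: nat
  shows "\<exists>p'. (\<forall>t::real. ((\<lambda>t. n * pos_square t / (1 + n * pos_square t)) has_real_derivative p' t) (at t))
    \<and> continuous_on UNIV p'"
proof -
  have nz: "1 + n * pos_square t \<noteq> 0" for t :: real
    by (smt (verit) mult_nonneg_nonneg of_nat_0_le_iff pos_square_nonneg)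
  have cq: "continuous_on UNIV pos_square"
    using pos_square_derivative by (meson DERIV_isCont continuous_at_imp_continuous_on)
  define p' where "p' t = (n * (2 * max 0 t) * (1 + n * pos_square t) - n * pos_square t * (n * (2 * max 0 t)))
     / ((1 + n * pos_square t) * (1 + n * pos_square t))" for t :: real
  have "((\<lambda>t. n * pos_square t / (1 + n * pos_square t)) has_real_derivative p' t) (at t)" for t :: real
    unfolding p'_def
    by (rule DERIV_divide) (use nz in \<open>auto intro!: derivative_eq_intros pos_square_derivative\<close>)
  moreover have "continuous_on UNIV p'"
    unfolding p'_def[abs_def] by (intro continuous_intros cq) (use nz in auto)
  ultimately show ?thesis by blast
qed

definition ball_bump :: "'a::euclidean_space \<Rightarrow> real \<Rightarrow> 'a \<Rightarrow> real" where
  "ball_bump c s x = pos_square (s\<^sup>2 - (norm (x - c))\<^sup>2)"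

lemma ball_bump_pos: "s \<ge> 0 \<Longrightarrow> ball_bump c s x > 0 \<longleftrightarrow> x \<in> ball c s"
  and ball_bump_nonneg [simp]: "ball_bump c s x \<ge> 0"
  by (auto simp: ball_bump_def pos_square_pos dist_norm norm_minus_commute abs_le_square_iff[symmetric]
      power2_less_imp_less intro: power_strict_mono)

lemma C1_function_ball_bump: "C1_function (ball_bump c s)"
proof -
  have "GDERIV (\<lambda>x. s\<^sup>2 - (norm (x - c))\<^sup>2) x :> (-2) *\<^sub>R (x - c)" for x
    unfolding gderiv_def power2_norm_eq_inner
    by (auto intro!: derivative_eq_intros simp: inner_commute algebra_simps)
  then have "C1_function (\<lambda>x. s\<^sup>2 - (norm (x - c))\<^sup>2)"
    unfolding C1_function_def
    by (intro exI[of _ "\<lambda>x. (-2) *\<^sub>R (x - c)"]) (auto intro!: continuous_intros)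
  then show ?thesis
    unfolding ball_bump_def[abs_def]
    by (rule C1_function_compose[OF _ pos_square_derivative]) (auto intro!: continuous_intros)
qed

definition box_bump :: "'a::euclidean_space \<Rightarrow> 'a \<Rightarrow> 'a \<Rightarrow> real" where
  "box_bump a b x = (\<Prod>i\<in>Basis. pos_square (x \<bullet> i - a \<bullet> i) * pos_square (b \<bullet> i - x \<bullet> i))"

lemma box_bump_pos: "box_bump a b x > 0 \<longleftrightarrow> x \<in> box a b"
proof -
  have nn: "box_bump a b x \<ge> 0" unfolding box_bump_def by (intro prod_nonneg) auto
  have "box_bump a b x = 0 \<longleftrightarrow> x \<notin> box a b"
    unfolding box_bump_def by (auto simp: box_def pos_square_eq_0 not_less)
  then show ?thesis using nn by force
qed

lemma C1_function_box_bump: "C1_function (box_bump a b)"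
proof -
  have 1: "C1_function (\<lambda>x. pos_square (x \<bullet> i - a \<bullet> i))" for i
    by (rule C1_function_compose[OF _ pos_square_derivative])
       (use C1_function_affine[of "- (a \<bullet> i)" 1 i] in \<open>auto intro!: continuous_intros\<close>)
  have 2: "C1_function (\<lambda>x. pos_square (b \<bullet> i - x \<bullet> i))" for i
    by (rule C1_function_compose[OF _ pos_square_derivative])
       (use C1_function_affine[of "b \<bullet> i" "-1" i] in \<open>auto intro!: continuous_intros\<close>)
  show ?thesis
    unfolding box_bump_def[abs_def] by (intro C1_function_prod C1_function_mult 1 2) auto
qed

lemma C1_function_continuous: "C1_function f \<Longrightarrow> continuous_on S f"
  unfolding C1_function_def using GDERIV_imp_continuous_on by blast

context
  fixes \<Omega> :: "'a::euclidean_space set" and x0 r e \<gamma>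
  assumes chart: "C2_boundary_chart \<Omega> x0 r e \<gamma>"
begin

lemma slab_chart: "{x. 0 \<le> x \<bullet> e \<and> x \<bullet> e \<le> 1} = slab e"
  using chart_direction[OF chart] by (simp add: slab_def)

lemma nn_integral_graph_measure:
  assumes [measurable]: "k \<in> borel_measurable borel"
  shows "(\<integral>\<^sup>+y. k y \<partial>graph_measure e \<gamma>)
    = (\<integral>\<^sup>+x. ennreal (indicator (slab e) x * sqrt (1 + (norm (grad \<gamma> x))\<^sup>2)) * k (graph_point e \<gamma> x) \<partial>lborel)"
proof -
  note [measurable] = chart_measurable[OF chart] graph_point_measurable[OF chart]
  show ?thesis
    unfolding graph_measure_def slab_chart graph_point_def[symmetric]
    by (subst nn_integral_distr, simp, simp, subst nn_integral_density) auto
qed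

lemma integral_graph_measure:
  fixes k :: "'a \<Rightarrow> real"
  assumes [measurable]: "k \<in> borel_measurable borel"
  shows "(\<integral>y. k y \<partial>graph_measure e \<gamma>)
    = (\<integral>x. indicator (slab e) x * sqrt (1 + (norm (grad \<gamma> x))\<^sup>2) * k (graph_point e \<gamma> x) \<partial>lborel)"
proof -
  note [measurable] = chart_measurable[OF chart] graph_point_measurable[OF chart]
  show ?thesis
    unfolding graph_measure_def slab_chart graph_point_def[symmetric]
    by (subst integral_distr, simp, simp, subst integral_density) auto
qed

lemma sets_graph_measure [measurable_cong]: "sets (graph_measure e \<gamma>) = sets borel"
  by (simp add: graph_measure_def)

lemma graph_measure_ball_finite: "emeasure (graph_measure e \<gamma>) (ball y s) < top"
proof -
  define B where "B = 2 * (norm y + s) + 1"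
  obtain K where K: "K > 0" "\<And>x. norm x \<le> B \<Longrightarrow> norm (grad \<gamma> x) \<le> K"
    using continuous_on_bounded_cball[OF chart_continuous_grad[OF chart]] by blast
  have "emeasure (graph_measure e \<gamma>) (ball y s) = (\<integral>\<^sup>+x. indicator (ball y s) x \<partial>graph_measure e \<gamma>)"
    by (subst nn_integral_indicator) (auto simp: sets_graph_measure)
  also have "\<dots> = (\<integral>\<^sup>+x. ennreal (indicator (slab e) x * sqrt (1 + (norm (grad \<gamma> x))\<^sup>2)) * indicator (ball y s) (graph_point e \<gamma> x) \<partial>lborel)"
    by (intro nn_integral_graph_measure borel_measurable_indicator) simp
  also have "\<dots> \<le> (\<integral>\<^sup>+x. ennreal (sqrt (1 + K\<^sup>2)) * indicator (cball (0::'a) B) x \<partial>lborel)"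
  proof (rule nn_integral_mono)
    fix x
    show "ennreal (indicator (slab e) x * sqrt (1 + (norm (grad \<gamma> x))\<^sup>2)) * indicator (ball y s) (graph_point e \<gamma> x)
      \<le> ennreal (sqrt (1 + K\<^sup>2)) * indicator (cball 0 B) x"
    proof (cases "x \<in> slab e \<and> graph_point e \<gamma> x \<in> ball y s")
      case True
      let ?p = "graph_point e \<gamma> x"
      have p: "norm ?p \<le> norm y + s"
        using True norm_triangle_ineq2[of ?p y] by (auto simp: dist_norm norm_minus_commute)
      have ne: "norm e = 1" by (rule chart_norm_direction[OF chart])
      have "\<bar>\<gamma> x\<bar> \<le> norm ?p"
        using Cauchy_Schwarz_ineq2[of ?p e] by (simp add: graph_point_eqs(3)[OF chart] ne)
      moreover have "\<bar>x \<bullet> e\<bar> \<le> 1" using True by (auto simp: slab_chart[symmetric])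
      moreover have "x = ?p - (\<gamma> x - x \<bullet> e) *\<^sub>R e" by (simp add: graph_point_def)
      then have "norm x \<le> norm ?p + \<bar>\<gamma> x - x \<bullet> e\<bar>"
        using norm_triangle_ineq4[of ?p "(\<gamma> x - x \<bullet> e) *\<^sub>R e"] ne by simp
      ultimately have nx: "norm x \<le> B" using p by (simp add: B_def)
      then have "sqrt (1 + (norm (grad \<gamma> x))\<^sup>2) \<le> sqrt (1 + K\<^sup>2)"
        using K(2)[OF nx] by (simp add: power_mono)
      then show ?thesis using nx True by (simp add: ennreal_leI)
    qed auto
  qed
  also have "\<dots> = ennreal (sqrt (1 + K\<^sup>2)) * emeasure lborel (cball (0::'a) B)"
    by (rule nn_integral_cmult_indicator) simp
  also have "\<dots> < top"
    using emeasure_lborel_cball_finite[of "0::'a" B] by (simp add: ennreal_mult_less_top)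
  finally show ?thesis .
qed

text \<open>Extending \<open>f\<close> by zero outside the ball turns the statement into the one for the whole region above
  the graph. The margin between \<open>r'\<close> and \<open>r\<close> makes the extension differentiable there, although
  \<open>\<Omega>\<close> and that region coincide only inside the ball.\<close>

lemma chart_divergence:
  fixes f :: "'a \<Rightarrow> real"
  assumes op: "open \<Omega>" and f: "\<And>x. x \<in> \<Omega> \<Longrightarrow> GDERIV f x :> g x"
    and cf: "continuous_on (closure \<Omega>) f" and cg: "continuous_on \<Omega> g"
    and bd: "\<And>x. x \<in> \<Omega> \<Longrightarrow> norm (g x) \<le> C"
    and r': "r' < r" and van: "\<And>x. x \<in> closure \<Omega> \<Longrightarrow> dist x0 x \<ge> r' \<Longrightarrow> f x = 0"
      "\<And>x. x \<in> \<Omega> \<Longrightarrow> dist x0 x \<ge> r' \<Longrightarrow> g x = 0"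
  shows "(\<integral>x. indicator \<Omega> x * (g x \<bullet> b) \<partial>lborel)
    = (\<integral>y. indicator (frontier \<Omega> \<inter> ball x0 r) y * (f y * (chart_normal e \<gamma> y \<bullet> b)) \<partial>graph_measure e \<gamma>)"
proof -
  note [measurable] = chart_measurable[OF chart] graph_point_measurable[OF chart] chart_normal_measurable[OF chart]
  define f' where "f' x = (if x \<in> ball x0 r then f x else 0)" for x
  define g' where "g' x = indicator (\<Omega> \<inter> ball x0 r) x *\<^sub>R g x" for x
  have [measurable]: "g' \<in> borel_measurable borel" unfolding g'_def
    by (rule borel_measurable_continuous_on_indicator)
       (use op in \<open>auto intro: continuous_on_subset[OF cg]\<close>)
  have bf: "(\<lambda>y. indicator (closure \<Omega>) y *\<^sub>R f y) \<in> borel_measurable borel"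
    by (rule borel_measurable_continuous_on_indicator) (use cf in auto)
  have C0: "0 \<le> max 0 C" by simp
  have "(\<integral>x. indicator {x. \<gamma> x < x \<bullet> e} x * (g' x \<bullet> b) \<partial>lborel)
    = (\<integral>x. indicator (slab e) x * (f' (x + (\<gamma> x - x \<bullet> e) *\<^sub>R e) * ((grad \<gamma> x - e) \<bullet> b)) \<partial>lborel)"
  proof (rule epigraph_divergence[where C="max 0 C" and R="norm x0 + r"])
    fix x assume lt: "\<gamma> x < x \<bullet> e"
    show "GDERIV f' x :> g' x"
    proof (cases "x \<in> ball x0 r")
      case True
      then have "x \<in> \<Omega>" using lt chart_domain[OF chart] by blast
      then have "GDERIV f x :> g' x" using f True by (simp add: g'_def)
      then show ?thesis
        unfolding gderiv_def
        by (rule has_derivative_transform_within_open[where s="ball x0 r"]) (use True in \<open>auto simp: f'_def\<close>)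
    next
      case False
      let ?S = "- cball x0 r' \<inter> {x. \<gamma> x < x \<bullet> e}"
      have "open ?S"
        by (intro open_Int open_Collect_less continuous_intros chart_continuous[OF chart]) auto
      moreover have "x \<in> ?S" using False lt r' by auto
      moreover have "f' y = 0" if "y \<in> ?S" for y
        using that van(1)[of y] chart_closure[OF chart, of y] by (auto simp: f'_def)
      moreover have "GDERIV (\<lambda>x. 0) x :> 0" by (rule GDERIV_const)
      ultimately have "GDERIV f' x :> 0"
        unfolding gderiv_def by (metis (no_types, lifting) has_derivative_transform_within_open)
      then show ?thesis using False by (simp add: g'_def)
    qed
  next
    define s where "s = (r' + r) / 2"
    have s: "r' < s" "s < r" using r' by (auto simp: s_def)
    let ?E = "{x. \<gamma> x \<le> x \<bullet> e}"
    have cE: "closed ?E" by (intro closed_Collect_le continuous_intros chart_continuous[OF chart])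
    have "continuous_on (?E \<inter> cball x0 s \<union> ?E \<inter> - ball x0 s) f'"
    proof (rule continuous_on_closed_Un)
      have "continuous_on (?E \<inter> cball x0 s) f"
        by (rule continuous_on_subset[OF cf]) (use chart_closure[OF chart] s in auto)
      then show "continuous_on (?E \<inter> cball x0 s) f'"
        by (rule continuous_on_eq) (use s in \<open>auto simp: f'_def\<close>)
      have "continuous_on (?E \<inter> - ball x0 s) (\<lambda>x. 0::real)" by simp
      then show "continuous_on (?E \<inter> - ball x0 s) f'"
        by (rule continuous_on_eq) (use s van(1) chart_closure[OF chart] in \<open>auto simp: f'_def\<close>)
    qed (use cE in \<open>auto intro!: closed_Int simp: closed_Compl\<close>)
    moreover have "?E \<inter> cball x0 s \<union> ?E \<inter> - ball x0 s = ?E" by auto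
    ultimately show "continuous_on ?E f'" by simp
  next
    show "norm (g' x) \<le> max 0 C" for x using bd[of x] by (auto simp: g'_def indicator_def)
  next
    fix x :: 'a assume "norm x > norm x0 + r"
    then have "x \<notin> ball x0 r" using norm_triangle_ineq2[of x x0] by (auto simp: dist_norm norm_minus_commute)
    then show "f' x = 0" "g' x = 0" by (auto simp: f'_def g'_def)
  qed (use chart_direction[OF chart] chart_invariant[OF chart] chart_GDERIV[OF chart] chart_continuous_grad[OF chart] in auto)
  moreover have "(\<integral>x. indicator {x. \<gamma> x < x \<bullet> e} x * (g' x \<bullet> b) \<partial>lborel) = (\<integral>x. indicator \<Omega> x * (g x \<bullet> b) \<partial>lborel)"
  proof (rule Bochner_Integration.integral_cong[OF refl])
    fix x show "indicator {x. \<gamma> x < x \<bullet> e} x * (g' x \<bullet> b) = indicator \<Omega> x * (g x \<bullet> b)"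
      using chart_domain[OF chart, of x] van(2)[of x] r' by (auto simp: g'_def indicator_def)
  qed
  moreover have "(\<integral>x. indicator (slab e) x * (f' (x + (\<gamma> x - x \<bullet> e) *\<^sub>R e) * ((grad \<gamma> x - e) \<bullet> b)) \<partial>lborel)
    = (\<integral>y. indicator (frontier \<Omega> \<inter> ball x0 r) y * (f y * (chart_normal e \<gamma> y \<bullet> b)) \<partial>graph_measure e \<gamma>)"
  proof -
    have "(\<integral>y. indicator (frontier \<Omega> \<inter> ball x0 r) y * (f y * (chart_normal e \<gamma> y \<bullet> b)) \<partial>graph_measure e \<gamma>)
      = (\<integral>y. indicator (frontier \<Omega> \<inter> ball x0 r) y * ((indicator (closure \<Omega>) y *\<^sub>R f y) * (chart_normal e \<gamma> y \<bullet> b)) \<partial>graph_measure e \<gamma>)"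
      by (intro Bochner_Integration.integral_cong[OF refl]) (auto simp: indicator_def frontier_def)
    also have "\<dots> = (\<integral>x. indicator (slab e) x * sqrt (1 + (norm (grad \<gamma> x))\<^sup>2) *
       (indicator (frontier \<Omega> \<inter> ball x0 r) (graph_point e \<gamma> x) * ((indicator (closure \<Omega>) (graph_point e \<gamma> x) *\<^sub>R f (graph_point e \<gamma> x))
          * (chart_normal e \<gamma> (graph_point e \<gamma> x) \<bullet> b))) \<partial>lborel)"
    proof (rule integral_graph_measure)
      note [measurable] = bf
      have [measurable]: "frontier \<Omega> \<inter> ball x0 r \<in> sets borel"
        by (intro sets.Int borel_closed[OF frontier_closed] borel_open[OF open_ball])
      show "(\<lambda>y. indicator (frontier \<Omega> \<inter> ball x0 r) y * ((indicator (closure \<Omega>) y *\<^sub>R f y) * (chart_normal e \<gamma> y \<bullet> b))) \<in> borel_measurable borel"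
        by measurable
    qed
    also have "\<dots> = (\<integral>x. indicator (slab e) x * (f' (x + (\<gamma> x - x \<bullet> e) *\<^sub>R e) * ((grad \<gamma> x - e) \<bullet> b)) \<partial>lborel)"
    proof (rule Bochner_Integration.integral_cong[OF refl])
      fix x
      let ?p = "graph_point e \<gamma> x" and ?s = "sqrt (1 + (norm (grad \<gamma> x))\<^sup>2)"
      have "?s > 0" by (simp add: add_pos_nonneg)
      then have 1: "?s * (c * (chart_normal e \<gamma> x \<bullet> b)) = c * ((grad \<gamma> x - e) \<bullet> b)" for c
        by (simp add: chart_normal_def)
      have "?p \<in> ball x0 r \<Longrightarrow> ?p \<in> frontier \<Omega>"
        using chart_frontier[OF chart op] graph_point_eqs[OF chart, of x] by simp
      then have 2: "indicator (frontier \<Omega> \<inter> ball x0 r) ?p * ((indicator (closure \<Omega>) ?p *\<^sub>R f ?p) * c) = f' ?p * c" for c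
        by (auto simp: f'_def indicator_def frontier_def)
      show "indicator (slab e) x * ?s *
       (indicator (frontier \<Omega> \<inter> ball x0 r) ?p * ((indicator (closure \<Omega>) ?p *\<^sub>R f ?p) * (chart_normal e \<gamma> ?p \<bullet> b)))
        = indicator (slab e) x * (f' (x + (\<gamma> x - x \<bullet> e) *\<^sub>R e) * ((grad \<gamma> x - e) \<bullet> b))"
        unfolding 2 chart_normal_graph_point[OF chart] mult.assoc 1 by (simp add: graph_point_def)
    qed
    finally show ?thesis by simp
  qed
  ultimately show ?thesis by simp
qed

end

section \<open>Independence of the area measure from the chart\<close>

lemma measures_agree_integrals:
  fixes G1 G2 :: "'a::topological_space measure"
  assumes s: "sets G1 = sets borel" "sets G2 = sets borel" and W: "W \<in> sets borel"
    and eq: "\<And>A. A \<in> sets borel \<Longrightarrow> A \<subseteq> W \<Longrightarrow> emeasure G1 A = emeasure G2 A"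
  shows measures_agree_nn_integral:
      "\<And>k. k \<in> borel_measurable borel \<Longrightarrow> (\<integral>\<^sup>+y. k y * indicator W y \<partial>G1) = (\<integral>\<^sup>+y. k y * indicator W y \<partial>G2)"
    and measures_agree_integral:
      "\<And>k::'a \<Rightarrow> real. (\<integral>y. indicator W y * k y \<partial>G1) = (\<integral>y. indicator W y * k y \<partial>G2)"
    and measures_agree_integrable:
      "\<And>k::'a \<Rightarrow> real. integrable G1 (\<lambda>y. indicator W y * k y) \<longleftrightarrow> integrable G2 (\<lambda>y. indicator W y * k y)"
proof -
  have sp: "space G1 = UNIV" "space G2 = UNIV"
    using sets_eq_imp_space_eq[OF s(1)] sets_eq_imp_space_eq[OF s(2)] by simp_all
  have r: "restrict_space G1 W = restrict_space G2 W"
  proof (rule measure_eqI)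
    show "sets (restrict_space G1 W) = sets (restrict_space G2 W)"
      by (simp add: sets_restrict_space s)
    fix A assume "A \<in> sets (restrict_space G1 W)"
    then have "A \<in> sets borel" "A \<subseteq> W" using W by (auto simp: sets_restrict_space s)
    then show "emeasure (restrict_space G1 W) A = emeasure (restrict_space G2 W) A"
      using eq W by (simp add: emeasure_restrict_space s sp)
  qed
  have W': "W \<inter> space G1 \<in> sets G1" "W \<inter> space G2 \<in> sets G2" using W s sp by auto
  show "(\<integral>\<^sup>+y. k y * indicator W y \<partial>G1) = (\<integral>\<^sup>+y. k y * indicator W y \<partial>G2)"
    if "k \<in> borel_measurable borel" for k
    using nn_integral_restrict_space[OF W'(1), of k] nn_integral_restrict_space[OF W'(2), of k] r by simp
  show "(\<integral>y. indicator W y * k y \<partial>G1) = (\<integral>y. indicator W y * k y \<partial>G2)" for k :: "'a \<Rightarrow> real"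
    using integral_restrict_space[OF W'(1), of k] integral_restrict_space[OF W'(2), of k] r by simp
  show "integrable G1 (\<lambda>y. indicator W y * k y) \<longleftrightarrow> integrable G2 (\<lambda>y. indicator W y * k y)" for k :: "'a \<Rightarrow> real"
    using integrable_restrict_space[OF W'(1), of k] integrable_restrict_space[OF W'(2), of k] r by simp
qed

text \<open>Boxes are limits of C1 functions, so the measures with density \<open>w\<close> agree on boxes and hence
  everywhere; the positive density is then divided out. The density is present because in the
  application only integrals against a component of the normal are known.\<close>

lemma measures_agree_C1_test:
  fixes G1 G2 :: "'a::euclidean_space measure"
  assumes s: "sets G1 = sets borel" "sets G2 = sets borel"
    and W: "W \<in> sets borel" "W \<subseteq> ball x1 s1 \<inter> ball x2 s2" and s0: "s1 > 0" "s2 > 0"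
    and fin: "emeasure G1 W < top" "emeasure G2 W < top"
    and w[measurable]: "w \<in> borel_measurable borel" and w01: "\<And>y. 0 < w y \<and> w y \<le> 1"
    and test: "\<And>\<phi>. C1_function \<phi> \<Longrightarrow> (\<And>x. 0 \<le> \<phi> x) \<Longrightarrow> (\<And>x. x \<notin> ball x1 s1 \<inter> ball x2 s2 \<Longrightarrow> \<phi> x = 0) \<Longrightarrow>
        (\<integral>y. indicator W y * (\<phi> y * w y) \<partial>G1) = (\<integral>y. indicator W y * (\<phi> y * w y) \<partial>G2)"
    and A: "A \<in> sets borel" "A \<subseteq> W"
  shows "emeasure G1 A = emeasure G2 A"
proof -
  note [measurable_cong] = s
  note [measurable] = W(1)
  define \<mu> where "\<mu> G = density G (\<lambda>y. ennreal (indicator W y * w y))" for G :: "'a measure"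
  have s\<mu>: "sets (\<mu> G) = sets borel" if "sets G = sets borel" for G using that by (simp add: \<mu>_def)
  have box_eq: "emeasure (\<mu> G1) (box a b) = emeasure (\<mu> G2) (box a b)" for a b
  proof -
    define Q where "Q x = ball_bump x1 s1 x * ball_bump x2 s2 x * box_bump a b x" for x
    define \<phi> where "\<phi> n x = real n * pos_square (Q x) / (1 + real n * pos_square (Q x))" for n x
    have QC: "C1_function Q"
      unfolding Q_def[abs_def] by (intro C1_function_mult C1_function_ball_bump C1_function_box_bump)
    have \<phi>C: "C1_function (\<phi> n)" for n
      using pos_square_saturated_derivative[of n] C1_function_compose[OF QC] unfolding \<phi>_def[abs_def] by blast
    have [measurable]: "\<phi> n \<in> borel_measurable borel" for n
      by (rule borel_measurable_continuous_onI[OF C1_function_continuous[OF \<phi>C]])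
    have den: "1 + real n * pos_square t > 0" for n t by (intro add_pos_nonneg mult_nonneg_nonneg) auto
    have \<phi>0: "\<phi> n x \<ge> 0" for n x unfolding \<phi>_def using den[of n "Q x"] by (intro divide_nonneg_pos mult_nonneg_nonneg) auto
    have \<phi>1: "\<phi> n x \<le> 1" for n x unfolding \<phi>_def using den[of n "Q x"] by (subst divide_le_eq_1_pos) auto
    have bb0: "box_bump a b x \<ge> 0" for x unfolding box_bump_def by (intro prod_nonneg) auto
    have Qpos: "Q x > 0 \<longleftrightarrow> x \<in> ball x1 s1 \<inter> ball x2 s2 \<inter> box a b" for x
    proof -
      have "\<not> ball_bump x1 s1 x < 0" "\<not> ball_bump x2 s2 x < 0" "\<not> box_bump a b x < 0"
        using bb0 by (simp_all add: not_less)
      then have "Q x > 0 \<longleftrightarrow> ball_bump x1 s1 x > 0 \<and> ball_bump x2 s2 x > 0 \<and> box_bump a b x > 0"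
        unfolding Q_def zero_less_mult_iff by blast
      then show ?thesis
        using ball_bump_pos[of s1 x1 x] ball_bump_pos[of s2 x2 x] box_bump_pos[of a b x] s0 by simp
    qed
    have \<phi>van: "\<phi> n x = 0" if "x \<notin> ball x1 s1 \<inter> ball x2 s2 \<inter> box a b" for n x
    proof -
      have "Q x \<le> 0" using Qpos[of x] that by (meson not_less)
      then have "pos_square (Q x) = 0" by (simp add: pos_square_eq_0)
      then show ?thesis by (simp add: \<phi>_def)
    qed
    have mono: "incseq (\<lambda>n. ennreal (\<phi> n x))" for x
    proof (rule incseq_SucI)
      fix n
      have "\<phi> n x \<le> \<phi> (Suc n) x"
      proof -
        have eq: "\<phi> n x = 1 - 1 / (1 + real n * pos_square (Q x))" for n
          unfolding \<phi>_def using den[of n "Q x"] by (simp add: field_simps)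
        show ?thesis unfolding eq
          by (intro diff_left_mono divide_left_mono mult_pos_pos den add_left_mono mult_right_mono) auto
      qed
      then show "ennreal (\<phi> n x) \<le> ennreal (\<phi> (Suc n) x)" by (rule ennreal_leI)
    qed
    have lim: "(\<lambda>n. ennreal (\<phi> n x)) \<longlonglongrightarrow> indicator (ball x1 s1 \<inter> ball x2 s2 \<inter> box a b) x" for x
    proof (cases "Q x > 0")
      case True
      then have p: "pos_square (Q x) > 0" by (simp add: pos_square_pos)
      have "(\<lambda>n. 1 - 1 / (1 + real n * pos_square (Q x))) \<longlonglongrightarrow> 1 - 0"
      proof (intro tendsto_diff tendsto_const)
        have "filterlim (\<lambda>n. real n * pos_square (Q x)) at_top sequentially"
          by (rule filterlim_at_top_mult_tendsto_pos[OF tendsto_const p filterlim_real_sequentially])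
        then have "filterlim (\<lambda>n. 1 + real n * pos_square (Q x)) at_top sequentially"
          by (rule filterlim_tendsto_add_at_top[OF tendsto_const])
        then show "(\<lambda>n. 1 / (1 + real n * pos_square (Q x))) \<longlonglongrightarrow> 0"
          by (intro tendsto_divide_0[OF tendsto_const] filterlim_at_top_imp_at_infinity)
      qed
      moreover have "\<phi> n x = 1 - 1 / (1 + real n * pos_square (Q x))" for n
        unfolding \<phi>_def using den[of n "Q x"] by (simp add: field_simps)
      ultimately have "(\<lambda>n. \<phi> n x) \<longlonglongrightarrow> 1" by simp
      then have "(\<lambda>n. ennreal (\<phi> n x)) \<longlonglongrightarrow> ennreal 1" by (rule tendsto_ennrealI)
      then show ?thesis using True Qpos[of x] by simp
    next
      case False
      then show ?thesis using Qpos[of x] \<phi>van[of x] by (auto simp: indicator_def)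
    qed
    have I: "(\<lambda>n. ennreal (\<integral>y. indicator W y * (\<phi> n y * w y) \<partial>G)) \<longlonglongrightarrow> emeasure (\<mu> G) (box a b)"
      if G: "sets G = sets borel" and fin: "emeasure G W < top" for G :: "'a measure"
    proof -
      note [measurable_cong] = G
      have i: "integrable G (\<lambda>y. indicator W y * (\<phi> n y * w y))" for n
      proof -
        have "integrable G (\<lambda>y. indicator W y *\<^sub>R (\<phi> n y * w y))"
        proof (rule integrableI_bounded_set_indicator[where B=1])
          show "AE x in G. x \<in> W \<longrightarrow> norm (\<phi> n x * w x) \<le> 1"
          proof (intro AE_I2 impI)
            fix x
            have "\<phi> n x * w x \<le> 1"
              using \<phi>0[of n x] \<phi>1[of n x] w01[of x] by (intro mult_le_one) auto
            then show "norm (\<phi> n x * w x) \<le> 1"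
              using \<phi>0[of n x] w01[of x] by (simp add: abs_mult)
          qed
        qed (use fin in auto)
        then show ?thesis by simp
      qed
      have "(\<lambda>n. \<integral>\<^sup>+y. ennreal (\<phi> n y) \<partial>\<mu> G) \<longlonglongrightarrow> (\<integral>\<^sup>+y. indicator (ball x1 s1 \<inter> ball x2 s2 \<inter> box a b) y \<partial>\<mu> G)"
        by (rule nn_integral_LIMSEQ) (use mono lim in \<open>auto simp: \<mu>_def incseq_def le_fun_def\<close>)
      moreover have "(\<integral>\<^sup>+y. ennreal (\<phi> n y) \<partial>\<mu> G) = ennreal (\<integral>y. indicator W y * (\<phi> n y * w y) \<partial>G)" for n
      proof -
        have "(\<integral>\<^sup>+y. ennreal (\<phi> n y) \<partial>\<mu> G) = (\<integral>\<^sup>+y. ennreal (indicator W y * (\<phi> n y * w y)) \<partial>G)"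
          unfolding \<mu>_def by (subst nn_integral_density)
            (auto simp: mult.commute[of "\<phi> n _"] ennreal_mult w01[THEN conjunct1, THEN less_imp_le] \<phi>0
              intro!: nn_integral_cong split: split_indicator)
        also have "\<dots> = ennreal (\<integral>y. indicator W y * (\<phi> n y * w y) \<partial>G)"
          by (rule nn_integral_eq_integral[OF i]) (intro AE_I2 mult_nonneg_nonneg \<phi>0 w01[THEN conjunct1, THEN less_imp_le] indicator_pos_le)
        finally show ?thesis .
      qed
      moreover have "(\<integral>\<^sup>+y. indicator (ball x1 s1 \<inter> ball x2 s2 \<inter> box a b) y \<partial>\<mu> G) = emeasure (\<mu> G) (box a b)"
      proof -
        have "(\<integral>\<^sup>+y. indicator (ball x1 s1 \<inter> ball x2 s2 \<inter> box a b) y \<partial>\<mu> G) = (\<integral>\<^sup>+y. indicator (box a b) y \<partial>\<mu> G)"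
        proof -
          have eq: "ennreal (indicator W y * w y) * indicator (ball x1 s1 \<inter> ball x2 s2 \<inter> box a b) y
            = ennreal (indicator W y * w y) * indicator (box a b) y" for y
            using W(2) by (cases "y \<in> W") (auto simp: indicator_def subset_iff)
          have m: "indicator (ball x1 s1 \<inter> ball x2 s2 \<inter> box a b) \<in> borel_measurable G"
            "indicator (box a b) \<in> borel_measurable G"
            by (auto simp: G intro!: borel_measurable_indicator)
          show ?thesis
            unfolding \<mu>_def by (subst (1 2) nn_integral_density) (use m in \<open>auto simp: eq\<close>)
        qed
        then show ?thesis by (simp add: s\<mu> G)
      qed
      ultimately show ?thesis by simp
    qed
    have "(\<lambda>n. ennreal (\<integral>y. indicator W y * (\<phi> n y * w y) \<partial>G1)) = (\<lambda>n. ennreal (\<integral>y. indicator W y * (\<phi> n y * w y) \<partial>G2))"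
      using test[OF \<phi>C \<phi>0] \<phi>van by (intro ext arg_cong[of _ _ ennreal]) blast
    from I[OF s(1) fin(1), unfolded this] I[OF s(2) fin(2)] show ?thesis
      by (rule LIMSEQ_unique)
  qed
  have \<mu>fin: "emeasure (\<mu> G) X < top" if G: "sets G = sets borel" and fin: "emeasure G W < top"
    and X: "X \<in> sets borel" for G X
  proof -
    note [measurable_cong] = G
    note [measurable] = X
    have "emeasure (\<mu> G) X = (\<integral>\<^sup>+y. ennreal (indicator W y * w y) * indicator X y \<partial>G)"
      unfolding \<mu>_def by (rule emeasure_density) auto
    also have "\<dots> \<le> (\<integral>\<^sup>+y. indicator W y \<partial>G)"
      using w01 by (intro nn_integral_mono) (auto split: split_indicator simp: ennreal_le_1)
    also have "\<dots> = emeasure G W" by simp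
    finally show ?thesis using fin by simp
  qed
  have "\<mu> G1 = \<mu> G2"
  proof (rule measure_eqI_generator_eq[where E="range (\<lambda>(a, b). box a b)" and \<Omega>=UNIV
        and A="\<lambda>n::nat. box (- (real n *\<^sub>R One)) (real n *\<^sub>R One)"])
    show "Int_stable (range (\<lambda>(a, b). box a b :: 'a set))"
      by (auto simp: Int_stable_def box_Int_box)
    show "sets (\<mu> G1) = sigma_sets UNIV (range (\<lambda>(a, b). box a b))"
      "sets (\<mu> G2) = sigma_sets UNIV (range (\<lambda>(a, b). box a b))"
      using s\<mu> s by (simp_all add: borel_eq_box)
    show "(\<Union>n::nat. box (- (real n *\<^sub>R One)) (real n *\<^sub>R One)) = (UNIV :: 'a set)"
      by (rule UN_box_eq_UNIV)
    show "emeasure (\<mu> G1) (box (- (real n *\<^sub>R One)) (real n *\<^sub>R One)) \<noteq> \<infinity>" for n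
      using \<mu>fin[OF s(1) fin(1), of "box (- (real n *\<^sub>R One)) (real n *\<^sub>R One)"] by auto
  qed (use box_eq in auto)
  moreover have "emeasure G A = (\<integral>\<^sup>+y. ennreal (1 / w y) * indicator A y \<partial>\<mu> G)" if G: "sets G = sets borel" for G
  proof -
    note [measurable_cong] = G
    note [measurable] = A(1)
    have "(\<integral>\<^sup>+y. ennreal (1 / w y) * indicator A y \<partial>\<mu> G)
      = (\<integral>\<^sup>+y. ennreal (indicator W y * w y) * (ennreal (1 / w y) * indicator A y) \<partial>G)"
      unfolding \<mu>_def by (rule nn_integral_density) auto
    also have "\<dots> = (\<integral>\<^sup>+y. indicator A y \<partial>G)"
    proof (rule nn_integral_cong)
      fix y
      have "ennreal (w y) * ennreal (1 / w y) = 1"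
        using w01[of y] by (subst ennreal_mult[symmetric]) auto
      then show "ennreal (indicator W y * w y) * (ennreal (1 / w y) * indicator A y) = indicator A y"
        using A(2) by (auto split: split_indicator)
    qed
    also have "\<dots> = emeasure G A" by simp
    finally show ?thesis by simp
  qed
  ultimately show ?thesis using s by simp
qed

lemma GDERIV_locally_zero:
  assumes f: "GDERIV f x :> g" and S: "open S" "x \<in> S" "\<And>y. y \<in> S \<Longrightarrow> f y = 0"
  shows "g = 0"
proof -
  have "GDERIV (\<lambda>y. 0) x :> g"
    using f unfolding gderiv_def
    by (rule has_derivative_transform_within_open[where s=S]) (use S in auto)
  then show ?thesis using GDERIV_unique[OF _ GDERIV_const] by blast
qed

lemma bounded_continuous_closure:
  fixes g :: "'a::euclidean_space \<Rightarrow> 'b::real_normed_vector"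
  assumes "bounded \<Omega>" "continuous_on (closure \<Omega>) g"
  obtains C where "C > 0" "\<And>x. x \<in> closure \<Omega> \<Longrightarrow> norm (g x) \<le> C"
proof -
  have "compact (closure \<Omega>)" using assms(1) by simp
  then have "bounded (g ` closure \<Omega>)" using assms(2) by (intro compact_imp_bounded compact_continuous_image)
  then obtain C where "C > 0" "\<forall>y\<in>g ` closure \<Omega>. norm y \<le> C" unfolding bounded_pos by blast
  then show ?thesis using that by auto
qed

text \<open>For a C1 function \<open>\<phi>\<close> supported in both balls, both charts compute the integral of
  \<open>\<nabla>\<phi> \<bullet> b\<close> over \<open>\<Omega>\<close> as a boundary integral of \<open>\<phi>\<close> times \<open>\<nu> \<bullet> b\<close>, and the normal \<open>\<nu>\<close> depends on
  \<open>\<Omega>\<close> only. The direction \<open>b = - e\<close> of the first chart makes \<open>\<nu> \<bullet> b\<close> positive.\<close>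

lemma graph_measures_agree:
  fixes \<Omega> :: "'a::euclidean_space set"
  assumes bd: "bounded \<Omega>" and op: "open \<Omega>"
    and c1: "C2_boundary_chart \<Omega> x1 r1 e1 \<gamma>1" and c2: "C2_boundary_chart \<Omega> x2 r2 e2 \<gamma>2"
    and A: "A \<in> sets borel" "A \<subseteq> frontier \<Omega> \<inter> ball x1 r1 \<inter> ball x2 r2"
  shows "emeasure (graph_measure e1 \<gamma>1) A = emeasure (graph_measure e2 \<gamma>2) A"
proof -
  let ?G1 = "graph_measure e1 \<gamma>1" and ?G2 = "graph_measure e2 \<gamma>2"
  note [measurable] = chart_normal_measurable[OF c1] A(1)
  have sub: "emeasure ?G1 A' = emeasure ?G2 A'"
    if A': "A' \<in> sets borel" "A' \<subseteq> frontier \<Omega> \<inter> ball x1 s1 \<inter> ball x2 s2"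
      and s: "0 < s1" "s1 < r1" "0 < s2" "s2 < r2" for A' s1 s2
  proof (rule measures_agree_C1_test[where W="frontier \<Omega> \<inter> ball x1 s1 \<inter> ball x2 s2" and w="\<lambda>y. chart_normal e1 \<gamma>1 y \<bullet> (- e1)"])
    let ?W = "frontier \<Omega> \<inter> ball x1 s1 \<inter> ball x2 s2"
    show "?W \<in> sets borel"
      by (intro sets.Int borel_closed[OF frontier_closed] borel_open[OF open_ball])
    have "emeasure ?G1 ?W \<le> emeasure ?G1 (ball x1 r1)" "emeasure ?G2 ?W \<le> emeasure ?G2 (ball x1 r1)"
      using s by (auto intro!: emeasure_mono simp: sets_graph_measure[OF c1] sets_graph_measure[OF c2])
    then show "emeasure ?G1 ?W < top" "emeasure ?G2 ?W < top"
      using graph_measure_ball_finite[OF c1, of x1 r1] graph_measure_ball_finite[OF c2, of x1 r1]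
      by (auto intro: le_less_trans)
    show "0 < chart_normal e1 \<gamma>1 y \<bullet> - e1 \<and> chart_normal e1 \<gamma>1 y \<bullet> - e1 \<le> 1" for y
    proof -
      have "1 \<le> sqrt (1 + (norm (grad \<gamma>1 y))\<^sup>2)" by simp
      then show ?thesis unfolding chart_normal_direction[OF c1] by (simp add: add_pos_nonneg)
    qed
    fix \<phi> :: "'a \<Rightarrow> real"
    assume \<phi>: "C1_function \<phi>" and van: "\<And>x. x \<notin> ball x1 s1 \<inter> ball x2 s2 \<Longrightarrow> \<phi> x = 0"
    obtain g where g: "\<And>x. GDERIV \<phi> x :> g x" "continuous_on UNIV g"
      using \<phi> unfolding C1_function_def by blast
    have gvan: "g x = 0" if "dist x1 x > s1 \<or> dist x2 x > s2" for x
    proof -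
      have "open (- (cball x1 s1 \<inter> cball x2 s2))" by (intro open_Compl closed_Int closed_cball)
      then show ?thesis
        by (rule GDERIV_locally_zero[OF g(1)]) (use that van in auto)
    qed
    obtain C where C: "\<And>x. x \<in> closure \<Omega> \<Longrightarrow> norm (g x) \<le> C"
      using bounded_continuous_closure[OF bd continuous_on_subset[OF g(2)]] by (metis top_greatest)
    have c\<phi>: "continuous_on (closure \<Omega>) \<phi>" using C1_function_continuous[OF \<phi>] .
    have cg: "continuous_on \<Omega> g" using continuous_on_subset[OF g(2)] by blast
    have C': "\<And>x. x \<in> \<Omega> \<Longrightarrow> norm (g x) \<le> C" using C closure_subset by blast
    have div: "(\<integral>y. indicator (frontier \<Omega> \<inter> ball x1 r1) y * (\<phi> y * (chart_normal e1 \<gamma>1 y \<bullet> (- e1))) \<partial>?G1)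
       = (\<integral>y. indicator (frontier \<Omega> \<inter> ball x2 r2) y * (\<phi> y * (chart_normal e2 \<gamma>2 y \<bullet> (- e1))) \<partial>?G2)"
      using chart_divergence[OF c1 op g(1) c\<phi> cg C', where r'="(s1 + r1) / 2" and b="- e1"]
        chart_divergence[OF c2 op g(1) c\<phi> cg C', where r'="(s2 + r2) / 2" and b="- e1"]
        s van gvan by (simp del: inner_minus_right)
    have N: "chart_normal e1 \<gamma>1 y = chart_normal e2 \<gamma>2 y" if "y \<in> ?W" for y
      using chart_outward_normal[OF c1 op, of y] chart_outward_normal[OF c2 op, of y] that s by auto
    have "(\<integral>y. indicator ?W y * (\<phi> y * (chart_normal e1 \<gamma>1 y \<bullet> - e1)) \<partial>?G1)
       = (\<integral>y. indicator (frontier \<Omega> \<inter> ball x1 r1) y * (\<phi> y * (chart_normal e1 \<gamma>1 y \<bullet> (- e1))) \<partial>?G1)"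
      by (intro Bochner_Integration.integral_cong[OF refl]) (use van s in \<open>auto simp: indicator_def\<close>)
    moreover have "(\<integral>y. indicator ?W y * (\<phi> y * (chart_normal e1 \<gamma>1 y \<bullet> - e1)) \<partial>?G2)
       = (\<integral>y. indicator (frontier \<Omega> \<inter> ball x2 r2) y * (\<phi> y * (chart_normal e2 \<gamma>2 y \<bullet> (- e1))) \<partial>?G2)"
    proof (intro Bochner_Integration.integral_cong[OF refl])
      fix y
      show "indicator ?W y * (\<phi> y * (chart_normal e1 \<gamma>1 y \<bullet> - e1))
        = indicator (frontier \<Omega> \<inter> ball x2 r2) y * (\<phi> y * (chart_normal e2 \<gamma>2 y \<bullet> - e1))"
        using van[of y] N[of y] s by (cases "y \<in> ?W") (auto simp: indicator_def)
    qed
    ultimately show "(\<integral>y. indicator ?W y * (\<phi> y * (chart_normal e1 \<gamma>1 y \<bullet> - e1)) \<partial>?G1)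
       = (\<integral>y. indicator ?W y * (\<phi> y * (chart_normal e1 \<gamma>1 y \<bullet> - e1)) \<partial>?G2)"
      using div by simp
  qed (use s A' sets_graph_measure[OF c1] sets_graph_measure[OF c2] in auto)
  \<comment> \<open>The test functions need slightly smaller balls; their radii now increase to the given ones.\<close>
  define s where "s r n = r * (1 - 1 / (real n + 2))" for r :: real and n :: nat
  have s: "0 < s r n" "s r n < r" if "r > 0" for r n
    using that by (auto simp: s_def field_simps intro: add_pos_nonneg)
  have sm: "s r m \<le> s r n" if "r > 0" "m \<le> n" for r m n
    unfolding s_def using that by (intro mult_left_mono diff_left_mono divide_left_mono) auto
  have sl: "\<exists>n. t < s r n" if "t < r" for r t
  proof -
    have "(\<lambda>n. s r n) \<longlonglongrightarrow> r * (1 - 0)" unfolding s_def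
      by (intro tendsto_intros tendsto_divide_0[OF tendsto_const] filterlim_at_top_imp_at_infinity
           filterlim_at_top_add_at_top filterlim_tendsto_add_at_top[OF tendsto_const] filterlim_real_sequentially
           filterlim_at_top_mono[OF filterlim_real_sequentially]) auto
    then have "\<forall>\<^sub>F n in sequentially. t < s r n" using that by (intro order_tendstoD) auto
    then show ?thesis by (meson eventually_False_sequentially eventually_mono)
  qed
  define A' where "A' n = A \<inter> (ball x1 (s r1 n) \<inter> ball x2 (s r2 n))" for n
  have r: "r1 > 0" "r2 > 0" using chart_radius[OF c1] chart_radius[OF c2] by auto
  have mA: "A' n \<in> sets borel" for n unfolding A'_def by (intro sets.Int A borel_open open_ball)
  have inc: "incseq A'"
    unfolding incseq_def A'_def using sm[OF r(1)] sm[OF r(2)] by (fastforce intro: order_less_le_trans)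
  have un: "(\<Union>n. A' n) = A"
  proof
    show "A \<subseteq> (\<Union>n. A' n)"
    proof
      fix y assume y: "y \<in> A"
      then have "dist x1 y < r1" "dist x2 y < r2" using A by auto
      then obtain n m where nm: "dist x1 y < s r1 n" "dist x2 y < s r2 m" using sl by blast
      have "dist x1 y < s r1 (max n m)" "dist x2 y < s r2 (max n m)"
        using nm sm[OF r(1), of n "max n m"] sm[OF r(2), of m "max n m"] by auto
      then show "y \<in> (\<Union>n. A' n)" using y unfolding A'_def by auto
    qed
  qed (auto simp: A'_def)
  have "emeasure ?G1 (A' n) = emeasure ?G2 (A' n)" for n
    by (rule sub[OF mA, of n "s r1 n" "s r2 n"]) (use A s r in \<open>auto simp: A'_def\<close>)
  moreover have "(SUP n. emeasure ?G1 (A' n)) = emeasure ?G1 A" "(SUP n. emeasure ?G2 (A' n)) = emeasure ?G2 A"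
    using SUP_emeasure_incseq[of A' ?G1] SUP_emeasure_incseq[of A' ?G2] inc mA un
    by (auto simp: sets_graph_measure[OF c1] sets_graph_measure[OF c2])
  ultimately show ?thesis by simp
qed

section \<open>The surface measure and the global divergence theorem\<close>

lemma boundary_chart_cover:
  fixes \<Omega> :: "'a::euclidean_space set"
  assumes bd: "bounded \<Omega>" and dom: "C2_domain \<Omega>"
  obtains D r e \<gamma> where "finite D" "\<And>x. x \<in> D \<Longrightarrow> C2_boundary_chart \<Omega> x (r x) (e x) (\<gamma> x)"
    "frontier \<Omega> \<subseteq> (\<Union>x\<in>D. ball x (r x / 2))"
proof -
  have "\<forall>x\<in>frontier \<Omega>. \<exists>c. C2_boundary_chart \<Omega> x (fst c) (fst (snd c)) (snd (snd c))"
    using dom unfolding C2_domain_def by force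
  then obtain c where c: "\<And>x. x \<in> frontier \<Omega> \<Longrightarrow> C2_boundary_chart \<Omega> x (fst (c x)) (fst (snd (c x))) (snd (snd (c x)))"
    by metis
  have "compact (frontier \<Omega>)" using bd by (simp add: compact_frontier_bounded)
  moreover have "frontier \<Omega> \<subseteq> (\<Union>x\<in>frontier \<Omega>. ball x (fst (c x) / 2))"
    using chart_radius[OF c] by force
  ultimately obtain D where "D \<subseteq> frontier \<Omega>" "finite D" "frontier \<Omega> \<subseteq> (\<Union>x\<in>D. ball x (fst (c x) / 2))"
    using compactE_image[of "frontier \<Omega>" "frontier \<Omega>" "\<lambda>x. ball x (fst (c x) / 2)"] by auto
  then show ?thesis using that[of D "\<lambda>x. fst (c x)" "\<lambda>x. fst (snd (c x))" "\<lambda>x. snd (snd (c x))"] c by blast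
qed

text \<open>Finitely many charts cover the boundary. Dividing the indicators of the chart domains by the
  number \<open>m y\<close> of charts around \<open>y\<close> gives weights of sum one, and the weighted sum of the graph
  measures is the surface measure. It agrees with the graph measure of any further chart because all
  graph measures agree where they overlap; uniqueness is the same computation read backwards.\<close>

lemma surface_measure_unique_exists:
  fixes \<Omega> :: "'a::euclidean_space set"
  assumes bd: "bounded \<Omega>" and dom: "C2_domain \<Omega>"
  shows "\<exists>!\<sigma>. is_surface_measure \<Omega> \<sigma>"
proof -
  have op: "open \<Omega>" using dom by (simp add: C2_domain_def)
  obtain D r e \<gamma> where D: "finite D" "\<And>x. x \<in> D \<Longrightarrow> C2_boundary_chart \<Omega> x (r x) (e x) (\<gamma> x)"
    and cov: "frontier \<Omega> \<subseteq> (\<Union>x\<in>D. ball x (r x / 2))"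
    using boundary_chart_cover[OF bd dom] by blast
  have cov': "\<exists>x\<in>D. y \<in> ball x (r x)" if y: "y \<in> frontier \<Omega>" for y
  proof -
    obtain x where x: "x \<in> D" "y \<in> ball x (r x / 2)" using cov y by blast
    moreover have "r x > 0" using chart_radius[OF D(2)] x(1) by blast
    ultimately show ?thesis by (intro bexI[of _ x]) auto
  qed
  define W where "W x = frontier \<Omega> \<inter> ball x (r x)" for x
  have [measurable]: "W x \<in> sets borel" for x
    unfolding W_def by (intro sets.Int borel_closed[OF frontier_closed] borel_open[OF open_ball])
  define m where "m y = (\<Sum>x\<in>D. indicator (W x) y :: real)" for y
  have [measurable]: "m \<in> borel_measurable borel" unfolding m_def[abs_def] by measurable
  define \<theta> where "\<theta> x y = ennreal (1 / m y)" for x y :: 'a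
  have [measurable]: "\<theta> x \<in> borel_measurable borel" for x unfolding \<theta>_def[abs_def] by measurable
  have sum1: "(\<Sum>x\<in>D. \<theta> x y * indicator (W x) y) = indicator (frontier \<Omega>) y" for y
  proof (cases "y \<in> frontier \<Omega>")
    case True
    have "m y > 0"
    proof -
      obtain x where "x \<in> D" "y \<in> W x" using cov'[OF True] True by (auto simp: W_def)
      then show ?thesis unfolding m_def by (intro sum_pos2[OF D(1), of x]) auto
    qed
    have "(\<Sum>x\<in>D. \<theta> x y * indicator (W x) y) = (\<Sum>x\<in>D. ennreal (1 / m y * indicator (W x) y))"
      by (intro sum.cong) (auto simp: \<theta>_def indicator_def)
    also have "\<dots> = ennreal (\<Sum>x\<in>D. 1 / m y * indicator (W x) y)"
      by (rule sum_ennreal) (use \<open>m y > 0\<close> in auto)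
    also have "(\<Sum>x\<in>D. 1 / m y * indicator (W x) y) = 1"
      unfolding sum_distrib_left[symmetric] m_def[symmetric] using \<open>m y > 0\<close> by simp
    finally show ?thesis using True by simp
  qed (auto simp: W_def)
  let ?G = "\<lambda>x. graph_measure (e x) (\<gamma> x)"
  have sG: "sets (?G x) = sets borel" if "x \<in> D" for x using sets_graph_measure[OF D(2)[OF that]] .
  define \<mu> where "\<mu> A = (\<Sum>x\<in>D. \<integral>\<^sup>+y. (\<theta> x y * indicator A y) * indicator (W x) y \<partial>?G x)" for A
  \<comment> \<open>Applied below to the graph measure of a further chart and to a competing surface measure.\<close>
  have formula: "emeasure \<sigma> A = \<mu> A"
    if s: "sets \<sigma> = sets borel" and A: "A \<in> sets borel" "A \<subseteq> frontier \<Omega>"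
      and ag: "\<And>x B. x \<in> D \<Longrightarrow> B \<in> sets borel \<Longrightarrow> B \<subseteq> W x \<Longrightarrow> B \<subseteq> A \<Longrightarrow> emeasure \<sigma> B = emeasure (?G x) B"
    for \<sigma> A
  proof -
    note [measurable_cong] = s
    note [measurable] = A(1)
    have "emeasure \<sigma> A = (\<integral>\<^sup>+y. indicator A y \<partial>\<sigma>)" by simp
    also have "\<dots> = (\<integral>\<^sup>+y. (\<Sum>x\<in>D. \<theta> x y * indicator A y * indicator (W x) y) \<partial>\<sigma>)"
    proof (rule nn_integral_cong)
      fix y
      have "(\<Sum>x\<in>D. \<theta> x y * indicator A y * indicator (W x) y) = indicator A y * (\<Sum>x\<in>D. \<theta> x y * indicator (W x) y)"
        by (simp add: sum_distrib_left mult.commute mult.left_commute)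
      also have "\<dots> = indicator A y" unfolding sum1 using A(2) by (auto simp: indicator_def)
      finally show "indicator A y = (\<Sum>x\<in>D. \<theta> x y * indicator A y * indicator (W x) y)" by simp
    qed
    also have "\<dots> = (\<Sum>x\<in>D. \<integral>\<^sup>+y. \<theta> x y * indicator A y * indicator (W x) y \<partial>\<sigma>)"
      by (rule nn_integral_sum) measurable
    also have "\<dots> = \<mu> A"
      unfolding \<mu>_def
    proof (rule sum.cong[OF refl])
      fix x assume x: "x \<in> D"
      have "(\<integral>\<^sup>+y. \<theta> x y * indicator (A \<inter> W x) y \<partial>\<sigma>) = (\<integral>\<^sup>+y. \<theta> x y * indicator (A \<inter> W x) y \<partial>?G x)"
        by (rule measures_agree_nn_integral[OF s sG[OF x]]) (use ag[OF x] in auto)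
      then show "(\<integral>\<^sup>+y. \<theta> x y * indicator A y * indicator (W x) y \<partial>\<sigma>) = (\<integral>\<^sup>+y. \<theta> x y * indicator A y * indicator (W x) y \<partial>?G x)"
        by (simp add: indicator_inter_arith mult.assoc)
    qed
    finally show ?thesis .
  qed
  have pos: "positive (sets borel) \<mu>" by (simp add: positive_def \<mu>_def)
  have ca: "countably_additive (sets borel) \<mu>"
  proof (rule countably_additiveI)
    fix A :: "nat \<Rightarrow> 'a set"
    assume A: "range A \<subseteq> sets borel" "disjoint_family A" "(\<Union> (range A)) \<in> sets borel"
    have [measurable]: "A i \<in> sets borel" for i using A by auto
    have "(\<Sum>i. \<mu> (A i)) = (\<Sum>x\<in>D. \<Sum>i. \<integral>\<^sup>+y. (\<theta> x y * indicator (A i) y) * indicator (W x) y \<partial>?G x)"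
      unfolding \<mu>_def by (rule suminf_sum) auto
    also have "\<dots> = (\<Sum>x\<in>D. \<integral>\<^sup>+y. (\<theta> x y * indicator (\<Union> (range A)) y) * indicator (W x) y \<partial>?G x)"
    proof (rule sum.cong[OF refl])
      fix x assume x: "x \<in> D"
      note [measurable_cong] = sG[OF x]
      have "(\<Sum>i. \<integral>\<^sup>+y. (\<theta> x y * indicator (A i) y) * indicator (W x) y \<partial>?G x)
        = (\<integral>\<^sup>+y. (\<Sum>i. (\<theta> x y * indicator (A i) y) * indicator (W x) y) \<partial>?G x)"
        by (rule nn_integral_suminf[symmetric]) measurable
      also have "\<dots> = (\<integral>\<^sup>+y. (\<theta> x y * indicator (\<Union> (range A)) y) * indicator (W x) y \<partial>?G x)"
        using suminf_indicator[OF A(2)] by (intro nn_integral_cong) (simp add: ennreal_suminf_multc ennreal_suminf_cmult)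
      finally show "(\<Sum>i. \<integral>\<^sup>+y. (\<theta> x y * indicator (A i) y) * indicator (W x) y \<partial>?G x)
        = (\<integral>\<^sup>+y. (\<theta> x y * indicator (\<Union> (range A)) y) * indicator (W x) y \<partial>?G x)" .
    qed
    finally show "(\<Sum>i. \<mu> (A i)) = \<mu> (\<Union> (range A))" by (simp add: \<mu>_def)
  qed
  define \<sigma> where "\<sigma> = measure_of UNIV (sets borel) \<mu>"
  have sa: "sigma_algebra UNIV (sets (borel :: 'a measure))"
    using sets.sigma_algebra_axioms[of "borel :: 'a measure"] by simp
  have s\<sigma>: "sets \<sigma> = sets borel" unfolding \<sigma>_def
    using sigma_algebra.sets_measure_of_eq[OF sa] by blast
  have e\<sigma>: "emeasure \<sigma> A = \<mu> A" if "A \<in> sets borel" for A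
    unfolding \<sigma>_def by (rule emeasure_measure_of_sigma[OF sa pos ca that])
  have ex: "is_surface_measure \<Omega> \<sigma>"
    unfolding is_surface_measure_def
  proof (intro conjI allI impI)
    show "sets \<sigma> = sets borel" by (rule s\<sigma>)
    have "- frontier \<Omega> \<in> sets borel" by (intro borel_open open_Compl frontier_closed)
    then have "emeasure \<sigma> (- frontier \<Omega>) = \<mu> (- frontier \<Omega>)" by (rule e\<sigma>)
    also have "\<dots> = 0"
      unfolding \<mu>_def
    proof (rule sum.neutral, rule ballI)
      fix x assume "x \<in> D"
      have "(\<theta> x y * indicator (- frontier \<Omega>) y) * indicator (W x) y = 0" for y
        by (auto simp: W_def indicator_def)
      then show "(\<integral>\<^sup>+y. (\<theta> x y * indicator (- frontier \<Omega>) y) * indicator (W x) y \<partial>?G x) = 0"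
        by (simp only: nn_integral_const mult_zero_left)
    qed
    finally show "emeasure \<sigma> (- frontier \<Omega>) = 0" .
  next
    fix x0 r0 e0 \<gamma>0 A
    assume "C2_boundary_chart \<Omega> x0 r0 e0 \<gamma>0 \<and> A \<in> sets borel \<and> A \<subseteq> frontier \<Omega> \<inter> ball x0 r0"
    then have c0: "C2_boundary_chart \<Omega> x0 r0 e0 \<gamma>0" and A: "A \<in> sets borel" "A \<subseteq> frontier \<Omega> \<inter> ball x0 r0" by auto
    have "emeasure (graph_measure e0 \<gamma>0) A = \<mu> A"
    proof (rule formula[OF sets_graph_measure[OF c0] A(1)])
      fix x B assume "x \<in> D" "B \<in> sets borel" "B \<subseteq> W x" "B \<subseteq> A"
      then show "emeasure (graph_measure e0 \<gamma>0) B = emeasure (?G x) B"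
        by (intro graph_measures_agree[OF bd op c0 D(2)]) (use A in \<open>auto simp: W_def\<close>)
    qed (use A in auto)
    then show "emeasure \<sigma> A = emeasure (graph_measure e0 \<gamma>0) A" using e\<sigma>[OF A(1)] by simp
  qed
  moreover have "\<sigma>' = \<sigma>" if s': "is_surface_measure \<Omega> \<sigma>'" for \<sigma>'
  proof (rule measure_eqI)
    have s: "sets \<sigma>' = sets borel" "emeasure \<sigma>' (- frontier \<Omega>) = 0"
      and ag: "\<And>x0 r e \<gamma> A. C2_boundary_chart \<Omega> x0 r e \<gamma> \<Longrightarrow> A \<in> sets borel \<Longrightarrow> A \<subseteq> frontier \<Omega> \<inter> ball x0 r
        \<Longrightarrow> emeasure \<sigma>' A = emeasure (graph_measure e \<gamma>) A"
      using s' unfolding is_surface_measure_def by blast+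
    show "sets \<sigma>' = sets \<sigma>" using s s\<sigma> by simp
    fix A assume "A \<in> sets \<sigma>'"
    then have A: "A \<in> sets borel" using s by simp
    have F: "frontier \<Omega> \<in> sets borel" by (rule borel_closed[OF frontier_closed])
    have split: "emeasure \<tau> A = emeasure \<tau> (A \<inter> frontier \<Omega>)"
      if \<tau>: "sets \<tau> = sets borel" "emeasure \<tau> (- frontier \<Omega>) = 0" for \<tau>
    proof -
      have "- frontier \<Omega> \<in> sets \<tau>" unfolding \<tau>(1) by (intro borel_open open_Compl frontier_closed)
      with \<tau>(2) have n: "- frontier \<Omega> \<in> null_sets \<tau>" by (rule null_setsI)
      have "A \<in> sets \<tau>" using A \<tau>(1) by metis
      with n have "emeasure \<tau> (A - (- frontier \<Omega>)) = emeasure \<tau> A"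
        by (rule emeasure_Diff_null_set)
      moreover have "A - (- frontier \<Omega>) = A \<inter> frontier \<Omega>" by auto
      ultimately show ?thesis by simp
    qed
    have "emeasure \<sigma>' (A \<inter> frontier \<Omega>) = \<mu> (A \<inter> frontier \<Omega>)"
      by (rule formula[OF s(1)]) (use A F ag[OF D(2)] in \<open>auto simp: W_def\<close>)
    also have "\<dots> = emeasure \<sigma> (A \<inter> frontier \<Omega>)" using e\<sigma> A F by simp
    finally show "emeasure \<sigma>' A = emeasure \<sigma> A"
      using split[OF s] split[OF s\<sigma>] ex by (simp add: is_surface_measure_def)
  qed
  ultimately show ?thesis by blast
qed

lemma is_surface_measure_surface_measure:
  assumes "bounded \<Omega>" "C2_domain \<Omega>"
  shows "is_surface_measure \<Omega> (surface_measure \<Omega>)"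
  unfolding surface_measure_def by (rule theI'[OF surface_measure_unique_exists[OF assms]])

text \<open>A piece of the partition of unity is supported either inside \<open>\<Omega>\<close>, where both sides vanish, or in
  a chart, where the surface measure is the graph measure.\<close>

lemma divergence_piece:
  fixes \<Omega> :: "'a::euclidean_space set"
  assumes bd: "bounded \<Omega>" and dom: "C2_domain \<Omega>"
    and f: "\<And>x. x \<in> \<Omega> \<Longrightarrow> GDERIV f x :> g x"
    and cf: "continuous_on (closure \<Omega>) f" and cg: "continuous_on (closure \<Omega>) g"
    and piece: "cball c s \<subseteq> \<Omega> \<or> (\<exists>r e \<gamma>. C2_boundary_chart \<Omega> c r e \<gamma> \<and> s < r)"
    and van: "\<And>x. x \<in> closure \<Omega> \<Longrightarrow> dist c x > s \<Longrightarrow> f x = 0"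
  shows "(\<integral>x. indicator \<Omega> x * (g x \<bullet> b) \<partial>lborel)
      = (\<integral>y. indicator (frontier \<Omega>) y * (f y * (outward_normal \<Omega> y \<bullet> b)) \<partial>surface_measure \<Omega>)"
      (is "?L = ?R")
    and "integrable (surface_measure \<Omega>) (\<lambda>y. indicator (frontier \<Omega>) y * (f y * (outward_normal \<Omega> y \<bullet> b)))" (is ?I)
proof -
  have op: "open \<Omega>" using dom by (simp add: C2_domain_def)
  have sub: "\<Omega> \<subseteq> closure \<Omega>" by (rule closure_subset)
  have gvan: "g x = 0" if "x \<in> \<Omega>" "dist c x > s" for x
    by (rule GDERIV_locally_zero[OF f[OF that(1)], of "\<Omega> - cball c s"]) (use op that van sub in auto)
  obtain C where C: "C > 0" "\<And>x. x \<in> closure \<Omega> \<Longrightarrow> norm (g x) \<le> C"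
    using bounded_continuous_closure[OF bd cg] by blast
  note \<sigma> = is_surface_measure_surface_measure[OF bd dom]
  have s\<sigma>: "sets (surface_measure \<Omega>) = sets borel" using \<sigma> by (simp add: is_surface_measure_def)
  have cg\<Omega>: "continuous_on \<Omega> g" using continuous_on_subset[OF cg sub] .
  have "?L = ?R \<and> ?I"
    using piece
  proof
    assume cb: "cball c s \<subseteq> \<Omega>"
    define F where "F x = (if x \<in> \<Omega> then f x else 0)" for x
    define g' where "g' x = indicator \<Omega> x *\<^sub>R g x" for x
    obtain R where R: "\<And>x. x \<in> \<Omega> \<Longrightarrow> norm x < R"
      using bd unfolding bounded_pos_less by blast
    have "(\<integral>x. indicator UNIV x * (g' x \<bullet> b) \<partial>lborel) = 0"
    proof (rule integral_derivative_invariant_set[where b=b and F=F and C="C * norm b" and R=R])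
      fix x :: 'a
      have "GDERIV F x :> g' x"
      proof (cases "x \<in> \<Omega>")
        case True
        then have "GDERIV f x :> g' x" using f by (simp add: g'_def)
        then show ?thesis unfolding gderiv_def
          by (rule has_derivative_transform_within_open[where s=\<Omega>]) (use True op in \<open>auto simp: F_def\<close>)
      next
        case False
        have "GDERIV (\<lambda>x. 0) x :> g' x" using False by (simp add: g'_def GDERIV_const)
        then show ?thesis unfolding gderiv_def
          by (rule has_derivative_transform_within_open[where s="- cball c s"])
             (use False cb van sub in \<open>auto simp: F_def\<close>)
      qed
      from GDERIV_direction[OF this, of b]
      show "((\<lambda>t. F (x + t *\<^sub>R b)) has_real_derivative g' x \<bullet> b) (at 0)" by (simp add: inner_commute)
      have "norm (g' x) \<le> C" using C sub by (auto simp: g'_def indicator_def)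
      then show "\<bar>g' x \<bullet> b\<bar> \<le> C * norm b"
        using Cauchy_Schwarz_ineq2[of "g' x" b] by (meson mult_right_mono norm_ge_zero order_trans)
      show "R \<le> norm x \<Longrightarrow> F x = 0 \<and> g' x \<bullet> b = 0" using R[of x] by (auto simp: F_def g'_def)
    next
      have "g' \<in> borel_measurable borel" unfolding g'_def[abs_def]
        by (rule borel_measurable_continuous_on_indicator) (use op cg\<Omega> in auto)
      then show "(\<lambda>x. g' x \<bullet> b) \<in> borel_measurable borel" by measurable
    qed auto
    moreover have "(\<integral>x. indicator UNIV x * (g' x \<bullet> b) \<partial>lborel) = ?L"
      by (intro Bochner_Integration.integral_cong[OF refl]) (auto simp: g'_def indicator_def)
    moreover have "(\<lambda>y. indicator (frontier \<Omega>) y * (f y * (outward_normal \<Omega> y \<bullet> b))) = (\<lambda>y. 0)"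
    proof (rule ext)
      fix y show "indicator (frontier \<Omega>) y * (f y * (outward_normal \<Omega> y \<bullet> b)) = 0"
    proof (cases "y \<in> frontier \<Omega>")
      case True
      then have "y \<in> closure \<Omega>" "y \<notin> \<Omega>" using op by (auto simp: frontier_def interior_open)
      moreover have "y \<notin> cball c s" using cb \<open>y \<notin> \<Omega>\<close> by blast
      ultimately have "f y = 0" by (intro van) auto
      then show ?thesis by simp
    qed simp
    qed
    ultimately show "?L = ?R \<and> ?I" by simp
  next
    assume "\<exists>r e \<gamma>. C2_boundary_chart \<Omega> c r e \<gamma> \<and> s < r"
    then obtain r e \<gamma> where ch: "C2_boundary_chart \<Omega> c r e \<gamma>" and sr: "s < r" by blast
    let ?G = "graph_measure e \<gamma>" and ?W = "frontier \<Omega> \<inter> ball c r"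
    note sG = sets_graph_measure[OF ch]
    have W: "?W \<in> sets borel" by (intro sets.Int borel_closed[OF frontier_closed] borel_open[OF open_ball])
    define k where "k y = f y * (chart_normal e \<gamma> y \<bullet> b)" for y
    have agree: "\<And>A. A \<in> sets borel \<Longrightarrow> A \<subseteq> ?W \<Longrightarrow> emeasure (surface_measure \<Omega>) A = emeasure ?G A"
      using \<sigma> ch unfolding is_surface_measure_def by blast
    have Req: "indicator (frontier \<Omega>) y * (f y * (outward_normal \<Omega> y \<bullet> b)) = indicator ?W y * k y" for y
      using van[of y] sr chart_outward_normal[OF ch op, of y]
      by (auto simp: indicator_def k_def frontier_def)
    have "?L = (\<integral>y. indicator ?W y * k y \<partial>?G)"
      unfolding k_def
      by (rule chart_divergence[OF ch op f cf cg\<Omega>, where r'="(s + r) / 2" and C=C])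
         (use C sub van gvan sr in auto)
    also have "\<dots> = ?R"
      unfolding Req by (rule measures_agree_integral[OF sG s\<sigma> W]) (use agree in simp)
    finally have 1: "?L = ?R" .
    have "integrable ?G (\<lambda>y. indicator ?W y * k y)"
    proof -
      obtain B where B: "\<And>x. x \<in> closure \<Omega> \<Longrightarrow> norm (f x) \<le> B"
        using bounded_continuous_closure[OF bd cf] by blast
      note [measurable] = chart_normal_measurable[OF ch] W
      note [measurable_cong] = sG
      have [measurable]: "(\<lambda>y. indicator (closure \<Omega>) y *\<^sub>R f y) \<in> borel_measurable borel"
        by (rule borel_measurable_continuous_on_indicator) (use cf in auto)
      have "integrable ?G (\<lambda>y. indicator ?W y *\<^sub>R ((indicator (closure \<Omega>) y *\<^sub>R f y) * (chart_normal e \<gamma> y \<bullet> b)))"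
      proof (rule integrableI_bounded_set_indicator[where B="\<bar>B\<bar> * norm b"])
        show "emeasure ?G ?W < \<infinity>"
          using emeasure_mono[of ?W "ball c r" ?G] graph_measure_ball_finite[OF ch, of c r]
          by (auto simp: sG intro: le_less_trans)
        show "AE y in ?G. y \<in> ?W \<longrightarrow> norm ((indicator (closure \<Omega>) y *\<^sub>R f y) * (chart_normal e \<gamma> y \<bullet> b)) \<le> \<bar>B\<bar> * norm b"
        proof (intro AE_I2 impI)
          fix y
          have "\<bar>indicator (closure \<Omega>) y *\<^sub>R f y\<bar> \<le> \<bar>B\<bar>" using B[of y] by (auto simp: indicator_def)
          moreover have "\<bar>chart_normal e \<gamma> y \<bullet> b\<bar> \<le> norm b"
            using Cauchy_Schwarz_ineq2[of "chart_normal e \<gamma> y" b] by (simp add: norm_chart_normal[OF ch])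
          ultimately show "norm ((indicator (closure \<Omega>) y *\<^sub>R f y) * (chart_normal e \<gamma> y \<bullet> b)) \<le> \<bar>B\<bar> * norm b"
            unfolding real_norm_def abs_mult by (intro mult_mono) auto
        qed
        show "(\<lambda>y. (indicator (closure \<Omega>) y *\<^sub>R f y) * (chart_normal e \<gamma> y \<bullet> b)) \<in> borel_measurable ?G"
          by measurable
      qed (use W sG in auto)
      moreover have "(\<lambda>y. indicator ?W y *\<^sub>R ((indicator (closure \<Omega>) y *\<^sub>R f y) * (chart_normal e \<gamma> y \<bullet> b))) = (\<lambda>y. indicator ?W y * k y)"
        by (auto simp: k_def indicator_def frontier_def fun_eq_iff)
      ultimately show ?thesis by (simp only:)
    qed
    then have ?I
      unfolding Req by (subst measures_agree_integrable[OF s\<sigma> sG W]) (use agree in simp_all)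
    with 1 show "?L = ?R \<and> ?I" by blast
  qed
  then show "?L = ?R" ?I by blast+
qed

text \<open>Scalar form of the divergence theorem, one direction \<open>b\<close> at a time, for functions that are known
  only in \<open>\<Omega>\<close> and up to its boundary. The partition of unity is \<open>\<theta>\<^sub>p / \<Theta>\<close> with \<open>\<Theta> = \<Sum> \<theta>\<^sub>p\<close>,
  which is positive on the closure of \<open>\<Omega>\<close>; that the gradients of the pieces add up to \<open>g\<close> follows from the
  uniqueness of the gradient.\<close>

theorem C2_domain_divergence:
  fixes \<Omega> :: "'a::euclidean_space set"
  assumes bd: "bounded \<Omega>" and dom: "C2_domain \<Omega>"
    and f: "\<And>x. x \<in> \<Omega> \<Longrightarrow> GDERIV f x :> g x"
    and cf: "continuous_on (closure \<Omega>) f" and cg: "continuous_on (closure \<Omega>) g"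
  shows "(\<integral>x. indicator \<Omega> x * (g x \<bullet> b) \<partial>lborel)
      = (\<integral>y. indicator (frontier \<Omega>) y * (f y * (outward_normal \<Omega> y \<bullet> b)) \<partial>surface_measure \<Omega>)"
    and "integrable (surface_measure \<Omega>) (\<lambda>y. indicator (frontier \<Omega>) y * (f y * (outward_normal \<Omega> y \<bullet> b)))"
proof -
  have op: "open \<Omega>" using dom by (simp add: C2_domain_def)
  have sub: "\<Omega> \<subseteq> closure \<Omega>" by (rule closure_subset)
  define P where "P = {(c, s). s > 0 \<and> (cball c s \<subseteq> \<Omega> \<or> (\<exists>r e \<gamma>. C2_boundary_chart \<Omega> c r e \<gamma> \<and> s < r))}"
  have "closure \<Omega> \<subseteq> (\<Union>p\<in>P. ball (fst p) (snd p))"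
  proof
    fix x assume x: "x \<in> closure \<Omega>"
    have "\<exists>s. (x, s) \<in> P"
    proof (cases "x \<in> \<Omega>")
      case True
      then show ?thesis using op unfolding P_def open_contains_cball by auto
    next
      case False
      then have "x \<in> frontier \<Omega>" using x op by (simp add: frontier_def interior_open)
      then obtain r e \<gamma> where ch: "C2_boundary_chart \<Omega> x r e \<gamma>" using dom unfolding C2_domain_def by blast
      have "0 < r / 2" "r / 2 < r" using chart_radius[OF ch] by auto
      then have "(x, r / 2) \<in> P" unfolding P_def using ch by blast
      then show ?thesis by blast
    qed
    then show "x \<in> (\<Union>p\<in>P. ball (fst p) (snd p))" unfolding P_def by force
  qed
  then obtain J where J: "J \<subseteq> P" "finite J" "closure \<Omega> \<subseteq> (\<Union>p\<in>J. ball (fst p) (snd p))"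
    using compactE_image[of "closure \<Omega>" P "\<lambda>p. ball (fst p) (snd p)"] bd by auto
  define \<theta> where "\<theta> p = ball_bump (fst p) (snd p)" for p :: "'a \<times> real"
  define \<Theta> where "\<Theta> x = (\<Sum>p\<in>J. \<theta> p x)" for x
  have \<theta>C: "C1_function (\<theta> p)" for p unfolding \<theta>_def by (rule C1_function_ball_bump)
  obtain \<theta>' where \<theta>': "\<And>p x. GDERIV (\<theta> p) x :> \<theta>' p x" "\<And>p. continuous_on UNIV (\<theta>' p)"
    using \<theta>C unfolding C1_function_def by metis
  have "C1_function \<Theta>" unfolding \<Theta>_def[abs_def] by (rule C1_function_sum[OF J(2) \<theta>C])
  then obtain \<Theta>' where \<Theta>': "\<And>x. GDERIV \<Theta> x :> \<Theta>' x" "continuous_on UNIV \<Theta>'"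
    unfolding C1_function_def by blast
  have c\<theta>: "continuous_on S (\<theta> p)" and c\<Theta>: "continuous_on S \<Theta>" for S p
    using GDERIV_imp_continuous_on \<theta>'(1) \<Theta>'(1) by blast+
  have s0: "snd p > 0" if "p \<in> J" for p using that J(1) unfolding P_def by auto
  have \<Theta>pos: "\<Theta> x > 0" if x: "x \<in> closure \<Omega>" for x
  proof -
    obtain p where p: "p \<in> J" "x \<in> ball (fst p) (snd p)" using J(3) x by blast
    then have "\<theta> p x > 0" unfolding \<theta>_def using ball_bump_pos[of "snd p" "fst p" x] s0[of p] by simp
    then show ?thesis unfolding \<Theta>_def by (intro sum_pos2[OF J(2) p(1)]) (auto simp: \<theta>_def)
  qed
  define fp where "fp p x = \<theta> p x * inverse (\<Theta> x) * f x" for p x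
  define gp where "gp p x = (\<theta> p x * inverse (\<Theta> x)) *\<^sub>R g x
     + f x *\<^sub>R (\<theta> p x *\<^sub>R (- (inverse (\<Theta> x))\<^sup>2 *\<^sub>R \<Theta>' x) + inverse (\<Theta> x) *\<^sub>R \<theta>' p x)" for p x
  have Gp: "GDERIV (fp p) x :> gp p x" if x: "x \<in> \<Omega>" for p x
  proof -
    have "\<Theta> x \<noteq> 0" using \<Theta>pos[of x] x sub by auto
    from GDERIV_mult[OF GDERIV_mult[OF \<theta>'(1)[of p x] GDERIV_inverse[OF \<Theta>'(1)[of x] this]] f[OF x]]
    show ?thesis unfolding fp_def[abs_def] gp_def .
  qed
  have nz: "\<And>x. x \<in> closure \<Omega> \<Longrightarrow> \<Theta> x \<noteq> 0" using \<Theta>pos by force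
  have cfp: "continuous_on (closure \<Omega>) (fp p)" for p
    unfolding fp_def[abs_def] by (intro continuous_intros cf c\<theta> c\<Theta>) (use nz in auto)
  have cgp: "continuous_on (closure \<Omega>) (gp p)" for p
    unfolding gp_def[abs_def]
    by (intro continuous_intros cf cg c\<theta> c\<Theta> continuous_on_subset[OF \<Theta>'(2)] continuous_on_subset[OF \<theta>'(2)])
       (use nz in auto)
  have sumf: "(\<Sum>p\<in>J. fp p x) = f x" if "x \<in> closure \<Omega>" for x
    using nz[OF that] by (simp add: fp_def sum_distrib_right[symmetric] \<Theta>_def[symmetric])
  have sumg: "(\<Sum>p\<in>J. gp p x) = g x" if x: "x \<in> \<Omega>" for x
  proof -
    have "GDERIV (\<lambda>x. \<Sum>p\<in>J. fp p x) x :> (\<Sum>p\<in>J. gp p x)"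
      unfolding gderiv_def inner_sum_right
      by (intro has_derivative_sum) (use Gp[OF x] in \<open>simp add: gderiv_def\<close>)
    then have "GDERIV f x :> (\<Sum>p\<in>J. gp p x)"
      unfolding gderiv_def
      by (rule has_derivative_transform_within_open[where s=\<Omega>]) (use x op sumf sub in auto)
    then show ?thesis using GDERIV_unique f[OF x] by blast
  qed
  let ?r = "\<lambda>p y. indicator (frontier \<Omega>) y * (fp p y * (outward_normal \<Omega> y \<bullet> b))"
  have piece: "(\<integral>x. indicator \<Omega> x * (gp p x \<bullet> b) \<partial>lborel) = (\<integral>y. ?r p y \<partial>surface_measure \<Omega>)"
    "integrable (surface_measure \<Omega>) (?r p)" if p: "p \<in> J" for p
  proof -
    have pc: "cball (fst p) (snd p) \<subseteq> \<Omega> \<or> (\<exists>r e \<gamma>. C2_boundary_chart \<Omega> (fst p) r e \<gamma> \<and> snd p < r)"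
    proof -
      have "(fst p, snd p) \<in> P" using p J(1) by auto
      then show ?thesis unfolding P_def by blast
    qed
    have van: "fp p x = 0" if "x \<in> closure \<Omega>" "snd p < dist (fst p) x" for x
    proof -
      have "\<not> ball_bump (fst p) (snd p) x > 0"
        using ball_bump_pos[of "snd p" "fst p" x] s0[OF p] that by simp
      then have "\<theta> p x = 0" unfolding \<theta>_def using ball_bump_nonneg[of "fst p" "snd p" x] by linarith
      then show ?thesis by (simp add: fp_def)
    qed
    show "(\<integral>x. indicator \<Omega> x * (gp p x \<bullet> b) \<partial>lborel) = (\<integral>y. ?r p y \<partial>surface_measure \<Omega>)"
      by (rule divergence_piece(1)[OF bd dom Gp cfp cgp pc van])
    show "integrable (surface_measure \<Omega>) (?r p)"
      by (rule divergence_piece(2)[OF bd dom Gp cfp cgp pc van])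
  qed
  have sumr: "(\<Sum>p\<in>J. ?r p y) = indicator (frontier \<Omega>) y * (f y * (outward_normal \<Omega> y \<bullet> b))" for y
  proof (cases "y \<in> frontier \<Omega>")
    case True
    then have "y \<in> closure \<Omega>" by (simp add: frontier_def)
    then show ?thesis
      by (simp add: sum_distrib_left[symmetric] sum_distrib_right[symmetric] sumf)
  qed simp
  have int: "integrable lborel (\<lambda>x. indicator \<Omega> x * (gp p x \<bullet> b))" for p
  proof -
    obtain C where C: "C > 0" "\<And>x. x \<in> closure \<Omega> \<Longrightarrow> norm (gp p x) \<le> C"
      using bounded_continuous_closure[OF bd cgp] by blast
    obtain R where R: "\<And>x. x \<in> \<Omega> \<Longrightarrow> norm x < R" using bd unfolding bounded_pos_less by blast
    have m: "(\<lambda>x. indicator \<Omega> x *\<^sub>R (gp p x \<bullet> b)) \<in> borel_measurable borel"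
      by (rule borel_measurable_continuous_on_indicator)
         (use op in \<open>auto intro!: continuous_intros continuous_on_subset[OF cgp sub]\<close>)
    show ?thesis
    proof (rule integrable_bounded_support[where C="C * norm b" and R=R])
      fix x
      have "\<bar>gp p x \<bullet> b\<bar> \<le> C * norm b" if "x \<in> \<Omega>"
        using Cauchy_Schwarz_ineq2[of "gp p x" b] C(2)[of x] that sub
        by (meson mult_right_mono norm_ge_zero order_trans subsetD)
      then show "\<bar>indicator \<Omega> x * (gp p x \<bullet> b)\<bar> \<le> C * norm b" using C(1) by (auto simp: indicator_def)
      show "R < norm x \<Longrightarrow> indicator \<Omega> x * (gp p x \<bullet> b) = 0" using R[of x] by (auto simp: indicator_def)
    qed (use m in simp)
  qed
  have "(\<integral>x. indicator \<Omega> x * (g x \<bullet> b) \<partial>lborel) = (\<integral>x. (\<Sum>p\<in>J. indicator \<Omega> x * (gp p x \<bullet> b)) \<partial>lborel)"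
  proof (rule Bochner_Integration.integral_cong[OF refl])
    fix x show "indicator \<Omega> x * (g x \<bullet> b) = (\<Sum>p\<in>J. indicator \<Omega> x * (gp p x \<bullet> b))"
      by (cases "x \<in> \<Omega>") (simp_all add: sumg[symmetric] inner_sum_left)
  qed
  also have "\<dots> = (\<Sum>p\<in>J. \<integral>x. indicator \<Omega> x * (gp p x \<bullet> b) \<partial>lborel)"
    by (rule Bochner_Integration.integral_sum) (rule int)
  also have "\<dots> = (\<Sum>p\<in>J. \<integral>y. ?r p y \<partial>surface_measure \<Omega>)" using piece(1) by simp
  also have "\<dots> = (\<integral>y. (\<Sum>p\<in>J. ?r p y) \<partial>surface_measure \<Omega>)"
    by (rule Bochner_Integration.integral_sum[symmetric]) (rule piece(2))
  finally show "(\<integral>x. indicator \<Omega> x * (g x \<bullet> b) \<partial>lborel)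
      = (\<integral>y. indicator (frontier \<Omega>) y * (f y * (outward_normal \<Omega> y \<bullet> b)) \<partial>surface_measure \<Omega>)"
    unfolding sumr .
  have "integrable (surface_measure \<Omega>) (\<lambda>y. \<Sum>p\<in>J. ?r p y)"
    by (rule Bochner_Integration.integrable_sum) (rule piece(2))
  then show "integrable (surface_measure \<Omega>) (\<lambda>y. indicator (frontier \<Omega>) y * (f y * (outward_normal \<Omega> y \<bullet> b)))"
    unfolding sumr .
qed

lemma normal_derivative_eq:
  assumes op: "open \<Omega>" and u: "\<And>x. x \<in> \<Omega> \<Longrightarrow> GDERIV u x :> G x"
    and cG: "continuous_on (closure \<Omega>) G" and x: "x \<in> frontier \<Omega>"
  shows "normal_derivative \<Omega> u x = G x \<bullet> outward_normal \<Omega> x"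
proof -
  have xc: "x \<in> closure \<Omega>" "x \<notin> \<Omega>" using x op by (auto simp: frontier_def interior_open)
  have nb: "\<not> trivial_limit (at x within \<Omega>)"
    using xc by (simp add: trivial_limit_within closure_def)
  have "(G \<longlongrightarrow> G x) (at x within closure \<Omega>)" using cG xc by (simp add: continuous_on_def)
  then have "(G \<longlongrightarrow> G x) (at x within \<Omega>)" by (rule tendsto_within_subset) (rule closure_subset)
  moreover have "\<forall>\<^sub>F y in at x within \<Omega>. G y = grad u y"
    unfolding eventually_at_filter by (rule eventuallyI) (use grad_eqI[OF u] in auto)
  ultimately have "(grad u \<longlongrightarrow> G x) (at x within \<Omega>)"
    by (rule Lim_transform_eventually)
  then have "Lim (at x within \<Omega>) (grad u) = G x" by (rule tendsto_Lim[OF nb])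
  then show ?thesis by (simp add: normal_derivative_def)
qed

section \<open>Second order Taylor bounds on segments\<close>

text \<open>The values outside \<open>\<Omega>\<close> are set to zero in order to have functions that are measurable on the
  whole space; smoothness and the bounds by \<open>C\<close> concern \<open>\<Omega>\<close> only.\<close>

definition C2_zero_ext ::
    "'a::euclidean_space set \<Rightarrow> ('a \<Rightarrow> real) \<Rightarrow> ('a \<Rightarrow> 'a) \<Rightarrow> ('a \<Rightarrow> 'a \<Rightarrow>\<^sub>L 'a) \<Rightarrow> real \<Rightarrow> bool" where
  "C2_zero_ext \<Omega> u G H C \<longleftrightarrow> C > 0 \<and>
     (\<forall>x\<in>\<Omega>. GDERIV u x :> G x \<and> (G has_derivative blinfun_apply (H x)) (at x) \<and>
        \<bar>u x\<bar> \<le> C \<and> norm (G x) \<le> C \<and> norm (H x) \<le> C) \<and>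
     (\<forall>x. x \<notin> \<Omega> \<longrightarrow> u x = 0 \<and> G x = 0 \<and> H x = 0) \<and>
     u \<in> borel_measurable borel \<and> G \<in> borel_measurable borel \<and> (\<forall>z. (\<lambda>x. H x z) \<in> borel_measurable borel)"

lemma C2_zero_ext_mono:
  assumes "C2_zero_ext \<Omega> u G H C" "C \<le> C'" shows "C2_zero_ext \<Omega> u G H C'"
  using assms unfolding C2_zero_ext_def by (meson order_less_le_trans order_trans)

lemma C2_closure_zero_ext:
  fixes \<Omega> :: "'a::euclidean_space set"
  assumes bd: "bounded \<Omega>" and op: "open \<Omega>" and u: "C2_closure \<Omega> u"
  obtains G H C where "continuous_on (closure \<Omega>) u" "continuous_on (closure \<Omega>) G" "continuous_on (closure \<Omega>) H"
    "\<And>x. x \<in> \<Omega> \<Longrightarrow> GDERIV u x :> G x" "\<And>x. x \<in> \<Omega> \<Longrightarrow> (G has_derivative blinfun_apply (H x)) (at x)"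
    "C2_zero_ext \<Omega> (\<lambda>x. if x \<in> \<Omega> then u x else 0) (\<lambda>x. if x \<in> \<Omega> then G x else 0) (\<lambda>x. if x \<in> \<Omega> then H x else 0) C"
proof -
  obtain G H where cu: "continuous_on (closure \<Omega>) u" and cG: "continuous_on (closure \<Omega>) G" and cH: "continuous_on (closure \<Omega>) H"
    and d: "\<And>x. x \<in> \<Omega> \<Longrightarrow> GDERIV u x :> G x" "\<And>x. x \<in> \<Omega> \<Longrightarrow> (G has_derivative blinfun_apply (H x)) (at x)"
    using u unfolding C2_closure_def by blast
  obtain C1 where C1: "C1 > 0" "\<And>x. x \<in> closure \<Omega> \<Longrightarrow> norm (u x) \<le> C1" using bounded_continuous_closure[OF bd cu] by blast
  obtain C2 where C2: "C2 > 0" "\<And>x. x \<in> closure \<Omega> \<Longrightarrow> norm (G x) \<le> C2" using bounded_continuous_closure[OF bd cG] by blast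
  obtain C3 where C3: "C3 > 0" "\<And>x. x \<in> closure \<Omega> \<Longrightarrow> norm (H x) \<le> C3" using bounded_continuous_closure[OF bd cH] by blast
  define C where "C = C1 + C2 + C3"
  have sub: "\<Omega> \<subseteq> closure \<Omega>" by (rule closure_subset)
  have m: "(\<lambda>x. if x \<in> \<Omega> then f x else 0) \<in> borel_measurable borel" if "continuous_on (closure \<Omega>) f" for f :: "'a \<Rightarrow> 'b::{banach,second_countable_topology}"
  proof -
    have "(\<lambda>x. indicator \<Omega> x *\<^sub>R f x) \<in> borel_measurable borel"
      by (rule borel_measurable_continuous_on_indicator) (use op continuous_on_subset[OF that sub] in auto)
    moreover have "(\<lambda>x. if x \<in> \<Omega> then f x else 0) = (\<lambda>x. indicator \<Omega> x *\<^sub>R f x)" by (auto simp: indicator_def)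
    ultimately show ?thesis by simp
  qed
  have g: "GDERIV (\<lambda>x. if x \<in> \<Omega> then u x else 0) x :> G x" if x: "x \<in> \<Omega>" for x
    using d(1)[OF x] unfolding gderiv_def
    by (rule has_derivative_transform_within_open[where s=\<Omega>]) (use x op in auto)
  have h: "((\<lambda>x. if x \<in> \<Omega> then G x else 0) has_derivative blinfun_apply (H x)) (at x)" if x: "x \<in> \<Omega>" for x
    using d(2)[OF x] by (rule has_derivative_transform_within_open[where s=\<Omega>]) (use x op in auto)
  have mH: "(\<lambda>x. blinfun_apply (if x \<in> \<Omega> then H x else 0) z) \<in> borel_measurable borel" for z
  proof -
    have "(\<lambda>x. if x \<in> \<Omega> then blinfun_apply (H x) z else 0) \<in> borel_measurable borel"
      by (rule m) (intro continuous_intros cH)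
    moreover have "(\<lambda>x. if x \<in> \<Omega> then blinfun_apply (H x) z else 0) = (\<lambda>x. blinfun_apply (if x \<in> \<Omega> then H x else 0) z)"
      by auto
    ultimately show ?thesis by simp
  qed
  have b: "\<bar>u x\<bar> \<le> C" "norm (G x) \<le> C" "norm (H x) \<le> C" if "x \<in> \<Omega>" for x
  proof -
    have "x \<in> closure \<Omega>" using that sub by blast
    from C1(2)[OF this] C2(2)[OF this] C3(2)[OF this]
    show "\<bar>u x\<bar> \<le> C" "norm (G x) \<le> C" "norm (H x) \<le> C" using C1(1) C2(1) C3(1) by (auto simp: C_def)
  qed
  have "C2_zero_ext \<Omega> (\<lambda>x. if x \<in> \<Omega> then u x else 0) (\<lambda>x. if x \<in> \<Omega> then G x else 0) (\<lambda>x. if x \<in> \<Omega> then H x else 0) C"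
    unfolding C2_zero_ext_def
    using C1(1) C2(1) C3(1) b g h m[OF cu] m[OF cG] mH by (auto simp: C_def)
  then show ?thesis using that cu cG cH d by blast
qed

text \<open>The domain need not be convex, so the mean value theorem applies only along segments known
  to stay in it.\<close>

definition segment_inside :: "'a::real_vector set \<Rightarrow> 'a \<Rightarrow> 'a \<Rightarrow> bool" where
  "segment_inside \<Omega> x w \<longleftrightarrow> (\<forall>t\<in>{0..1}. x + t *\<^sub>R w \<in> \<Omega>)"

lemma segment_inside_ball: "cball x r \<subseteq> \<Omega> \<Longrightarrow> norm w \<le> r \<Longrightarrow> segment_inside \<Omega> x w"
  for x w :: "'a::euclidean_space"
proof -
  assume a: "cball x r \<subseteq> \<Omega>" "norm w \<le> r"
  have "norm (t *\<^sub>R w) \<le> r" if "t \<in> {0..1}" for t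
    using that a(2) mult_left_le_one_le[of "norm w" t] by simp
  then show ?thesis unfolding segment_inside_def using a(1) by (auto simp: dist_norm subset_iff)
qed

lemma segment_lipschitz:
  fixes u :: "'a::euclidean_space \<Rightarrow> real"
  assumes u: "\<And>x. x \<in> \<Omega> \<Longrightarrow> GDERIV u x :> G x" and L: "\<And>x. x \<in> \<Omega> \<Longrightarrow> norm (G x) \<le> L"
    and s: "segment_inside \<Omega> x w"
  obtains t where "t \<in> {0..1}" "u (x + w) - u x = w \<bullet> G (x + t *\<^sub>R w)"
    "\<bar>u (x + w) - u x\<bar> \<le> L * norm w"
proof -
  have "\<exists>t::real. t > 0 \<and> t < 1 \<and> u (x + 1 *\<^sub>R w) - u (x + 0 *\<^sub>R w) = (1 - 0) * (w \<bullet> G (x + t *\<^sub>R w))"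
  proof (rule MVT2)
    fix t :: real assume "0 \<le> t" "t \<le> 1"
    then have "x + t *\<^sub>R w \<in> \<Omega>" using s by (auto simp: segment_inside_def)
    from u[OF this] show "((\<lambda>t. u (x + t *\<^sub>R w)) has_real_derivative w \<bullet> G (x + t *\<^sub>R w)) (at t)"
      by (rule GDERIV_along_curve) (auto intro!: derivative_eq_intros)
  qed simp
  then obtain t where t: "t > 0" "t < 1" "u (x + w) - u x = w \<bullet> G (x + t *\<^sub>R w)" by auto
  then have "x + t *\<^sub>R w \<in> \<Omega>" using s by (auto simp: segment_inside_def)
  then have "\<bar>w \<bullet> G (x + t *\<^sub>R w)\<bar> \<le> norm w * L"
    using Cauchy_Schwarz_ineq2[of w "G (x + t *\<^sub>R w)"] L by (meson mult_left_mono norm_ge_zero order_trans)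
  then show ?thesis using that[of t] t by (simp add: mult.commute)
qed

lemma C2_zero_ext_segment:
  fixes u :: "'a::euclidean_space \<Rightarrow> real"
  assumes u: "C2_zero_ext \<Omega> u G H C" and s: "segment_inside \<Omega> x w"
  shows "\<bar>u (x + w) - u x\<bar> \<le> C * norm w"
    and "norm (G (x + w) - G x) \<le> C * norm w"
    and "\<bar>u (x + w) - u x - w \<bullet> G x\<bar> \<le> C * (norm w)\<^sup>2"
proof -
  have d: "\<And>x. x \<in> \<Omega> \<Longrightarrow> GDERIV u x :> G x" "\<And>x. x \<in> \<Omega> \<Longrightarrow> (G has_derivative blinfun_apply (H x)) (at x)"
    "\<And>x. x \<in> \<Omega> \<Longrightarrow> norm (G x) \<le> C" "\<And>x. x \<in> \<Omega> \<Longrightarrow> norm (H x) \<le> C" and C0: "C > 0"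
    using u by (auto simp: C2_zero_ext_def)
  have G: "norm (G (x + t *\<^sub>R w) - G x) \<le> C * norm w" if t: "t \<in> {0..1}" for t
  proof -
    have "norm (G (x + t *\<^sub>R w) - G x) \<le> C * norm ((x + t *\<^sub>R w) - x)"
    proof (rule differentiable_bound[where S="closed_segment x (x + t *\<^sub>R w)" and f'="\<lambda>x. blinfun_apply (H x)"])
      fix y assume "y \<in> closed_segment x (x + t *\<^sub>R w)"
      then obtain r where r: "0 \<le> r" "r \<le> 1" "y = (1 - r) *\<^sub>R x + r *\<^sub>R (x + t *\<^sub>R w)"
        by (auto simp: in_segment)
      then have "y = x + (r * t) *\<^sub>R w" by (simp add: algebra_simps)
      moreover have "r * t \<in> {0..1}" using r t by (auto intro: mult_le_one)
      ultimately have "y \<in> \<Omega>" using s by (auto simp: segment_inside_def)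
      then show "(G has_derivative blinfun_apply (H y)) (at y within closed_segment x (x + t *\<^sub>R w))"
        "onorm (blinfun_apply (H y)) \<le> C"
        using d(2,4)[of y] by (auto simp: norm_blinfun.rep_eq intro: has_derivative_at_withinI)
    qed auto
    also have "\<dots> \<le> C * norm w" using t C0 mult_left_le_one_le[of "norm w" t] by (simp add: mult_left_mono)
    finally show ?thesis .
  qed
  show "norm (G (x + w) - G x) \<le> C * norm w" using G[of 1] by simp
  obtain t where t: "t \<in> {0..1}" "u (x + w) - u x = w \<bullet> G (x + t *\<^sub>R w)" "\<bar>u (x + w) - u x\<bar> \<le> C * norm w"
    by (rule segment_lipschitz[OF d(1) d(3) s]) 
  show "\<bar>u (x + w) - u x\<bar> \<le> C * norm w" by (rule t(3))
  have "u (x + w) - u x - w \<bullet> G x = w \<bullet> (G (x + t *\<^sub>R w) - G x)" using t(2) by (simp add: inner_diff_right)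
  then have "\<bar>u (x + w) - u x - w \<bullet> G x\<bar> \<le> norm w * norm (G (x + t *\<^sub>R w) - G x)"
    using Cauchy_Schwarz_ineq2 by metis
  also have "\<dots> \<le> norm w * (C * norm w)" using G[OF t(1)] by (intro mult_left_mono) auto
  finally show "\<bar>u (x + w) - u x - w \<bullet> G x\<bar> \<le> C * (norm w)\<^sup>2" by (simp add: power2_eq_square mult_ac)
qed

section \<open>Transport by the localization function\<close>

lemma infdist_frontier_le:
  fixes \<Omega> :: "'a::euclidean_space set"
  assumes "x \<in> \<Omega>" "y \<notin> \<Omega>" shows "infdist x (frontier \<Omega>) \<le> dist x y"
proof -
  have "closed_segment x y \<inter> frontier \<Omega> \<noteq> {}"
    by (rule connected_Int_frontier) (use assms in auto)
  then obtain p where p: "p \<in> closed_segment x y" "p \<in> frontier \<Omega>" by blast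
  have "dist x p \<le> dist x y"
    using segment_bound(1)[OF p(1)] by (simp add: dist_norm norm_minus_commute)
  then show ?thesis using infdist_le[OF p(2), of x] by simp
qed

text \<open>Here \<open>h\<close> is the localization function at a fixed parameter, extended by zero, with gradient \<open>gh\<close>
  and Hessian \<open>hh\<close>. The quadratic bound \<open>h\<kappa>\<close> near the boundary makes the zero extension of class C1.\<close>

locale nonlocal_setting =
  fixes \<Omega> :: "'a::euclidean_space set" and h :: "'a \<Rightarrow> real" and gh :: "'a \<Rightarrow> 'a"
    and hh :: "'a \<Rightarrow> 'a \<Rightarrow>\<^sub>L 'a" and C \<kappa> :: real
  assumes op: "open \<Omega>" and bd: "bounded \<Omega>" and h: "C2_zero_ext \<Omega> h gh hh C"
    and hpos: "x \<in> \<Omega> \<Longrightarrow> 0 < h x" and gh3: "x \<in> \<Omega> \<Longrightarrow> norm (gh x) \<le> 1/3"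
    and \<kappa>: "\<kappa> > 0" and h\<kappa>: "x \<in> \<Omega> \<Longrightarrow> h x \<le> \<kappa> * (infdist x (frontier \<Omega>))\<^sup>2"
    and hdist: "x \<in> \<Omega> \<Longrightarrow> h x < infdist x (frontier \<Omega>)"
begin

lemma scale_facts: "C > 0" "x \<in> \<Omega> \<Longrightarrow> GDERIV h x :> gh x" "x \<notin> \<Omega> \<Longrightarrow> h x = 0" "x \<notin> \<Omega> \<Longrightarrow> gh x = 0"
  "x \<in> \<Omega> \<Longrightarrow> norm (gh x) \<le> C" "x \<in> \<Omega> \<Longrightarrow> (gh has_derivative blinfun_apply (hh x)) (at x)"
  using h unfolding C2_zero_ext_def by blast+

lemma h_measurable [measurable]: "h \<in> borel_measurable borel" "gh \<in> borel_measurable borel"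
  using h unfolding C2_zero_ext_def by blast+

lemma scale_nonneg: "h x \<ge> 0"
  using hpos[of x] scale_facts(3)[of x] by (cases "x \<in> \<Omega>") auto

lemma cball_inside: "x \<in> \<Omega> \<Longrightarrow> r < infdist x (frontier \<Omega>) \<Longrightarrow> cball x r \<subseteq> \<Omega>"
  using infdist_frontier_le[of x \<Omega>] by force

lemma transport_inside: assumes "x \<in> \<Omega>" "norm z \<le> 1"
  shows "segment_inside \<Omega> x (h x *\<^sub>R z)" "x + h x *\<^sub>R z \<in> \<Omega>"
proof -
  have "norm (h x *\<^sub>R z) \<le> h x"
    using assms scale_nonneg[of x] by (simp add: mult_left_le)
  then show 1: "segment_inside \<Omega> x (h x *\<^sub>R z)"
    using segment_inside_ball[OF cball_inside[OF assms(1) hdist[OF assms(1)]]] by blast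
  show "x + h x *\<^sub>R z \<in> \<Omega>" using 1 unfolding segment_inside_def by (metis atLeastAtMost_iff order_refl scaleR_one zero_le_one)
qed

lemma scale_comparable: assumes "x \<in> \<Omega>" "norm z \<le> 1"
  shows "2/3 * h x \<le> h (x + h x *\<^sub>R z)" "h (x + h x *\<^sub>R z) \<le> 4/3 * h x"
proof -
  have "\<bar>h (x + h x *\<^sub>R z) - h x\<bar> \<le> 1/3 * norm (h x *\<^sub>R z)"
    by (rule segment_lipschitz[OF scale_facts(2) gh3 transport_inside(1)[OF assms]])
  also have "\<dots> \<le> 1/3 * h x" using assms(2) scale_nonneg[of x] by (simp add: mult_left_le)
  finally have "h (x + h x *\<^sub>R z) - h x \<le> 1/3 * h x" "- (h (x + h x *\<^sub>R z) - h x) \<le> 1/3 * h x"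
    by (simp_all only: abs_le_iff)
  then show "2/3 * h x \<le> h (x + h x *\<^sub>R z)" "h (x + h x *\<^sub>R z) \<le> 4/3 * h x" by linarith+
qed

text \<open>A nonnegative function with bounded second derivatives satisfies such an inequality: a step of
  length \<open>t\<close> against the gradient lowers it by \<open>t |\<nabla>h| - C t\<^sup>2\<close>, which cannot exceed \<open>h x\<close>. The step
  \<open>t = a \<surd>h\<close> has the optimal order, and the quadratic bound on \<open>h\<close> keeps it within half the distance to the boundary.\<close>

lemma grad_scale_le_sqrt: "\<exists>C1>0. \<forall>x. norm (gh x) \<le> C1 * sqrt (h x)"
proof -
  define a where "a = 1 / (2 * sqrt \<kappa>)"
  have a: "a > 0" using \<kappa> by (simp add: a_def)
  define C1 where "C1 = 1 / a + C * a"
  have C1: "C1 > 0" using a scale_facts(1) by (simp add: C1_def add_pos_pos)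
  have "norm (gh x) \<le> C1 * sqrt (h x)" for x
  proof (cases "x \<in> \<Omega> \<and> gh x \<noteq> 0")
    case True
    then have x: "x \<in> \<Omega>" and g: "norm (gh x) > 0" by auto
    let ?d = "infdist x (frontier \<Omega>)"
    define t where "t = a * sqrt (h x)"
    have hp: "sqrt (h x) > 0" using hpos[OF x] by simp
    have t0: "t > 0" using a hp by (simp add: t_def)
    have d0: "?d > 0" using hdist[OF x] hpos[OF x] by linarith
    have "sqrt (h x) \<le> sqrt (\<kappa> * ?d\<^sup>2)" using h\<kappa>[OF x] by simp
    also have "\<dots> = sqrt \<kappa> * ?d" using d0 by (simp add: real_sqrt_mult)
    finally have "t \<le> a * (sqrt \<kappa> * ?d)" unfolding t_def using a by simp
    also have "\<dots> = ?d / 2" using \<kappa> by (simp add: a_def)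
    finally have td: "t < ?d" using d0 by linarith
    define w where "w = (- t / norm (gh x)) *\<^sub>R gh x"
    have nw: "norm w = t" using t0 g by (simp add: w_def)
    have seg: "segment_inside \<Omega> x w"
      by (rule segment_inside_ball[OF cball_inside[OF x td]]) (simp add: nw)
    have "\<bar>h (x + w) - h x - w \<bullet> gh x\<bar> \<le> C * t\<^sup>2"
      using C2_zero_ext_segment(3)[OF h seg] nw by simp
    moreover have "w \<bullet> gh x = - t * norm (gh x)"
      using g by (simp add: w_def power2_norm_eq_inner[symmetric] power2_eq_square)
    ultimately have "t * norm (gh x) \<le> h x + C * t\<^sup>2" using scale_nonneg[of "x + w"] by (simp add: abs_le_iff)
    moreover have "t * (h x / t + C * t) = h x + C * t\<^sup>2" using t0 by (simp add: distrib_left power2_eq_square)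
    ultimately have "t * norm (gh x) \<le> t * (h x / t + C * t)" by simp
    then have "norm (gh x) \<le> h x / t + C * t" using t0 by simp
    also have "h x / t = sqrt (h x) / a"
      using hp a scale_nonneg[of x] by (simp add: t_def field_simps)
    finally show ?thesis by (simp add: t_def C1_def algebra_simps)
  next
    case False
    then have "gh x = 0" using scale_facts(4) by blast
    then show ?thesis using C1 scale_nonneg[of x] by simp
  qed
  then show ?thesis using C1 by blast
qed

lemma scale_directional_derivative: "((\<lambda>t. h (x + t *\<^sub>R z)) has_real_derivative z \<bullet> gh x) (at 0)"
proof (cases "x \<in> \<Omega>")
  case True
  then show ?thesis by (intro GDERIV_direction scale_facts)
next
  case False
  have b: "\<bar>h (x + t *\<^sub>R z)\<bar> \<le> \<kappa> * t\<^sup>2 * (norm z)\<^sup>2" for t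
  proof (cases "x + t *\<^sub>R z \<in> \<Omega>")
    case True
    have "infdist (x + t *\<^sub>R z) (frontier \<Omega>) \<le> \<bar>t\<bar> * norm z"
      using infdist_frontier_le[OF True False] by (simp add: dist_norm)
    then have "(infdist (x + t *\<^sub>R z) (frontier \<Omega>))\<^sup>2 \<le> (\<bar>t\<bar> * norm z)\<^sup>2"
      by (intro power_mono infdist_nonneg)
    then have "\<kappa> * (infdist (x + t *\<^sub>R z) (frontier \<Omega>))\<^sup>2 \<le> \<kappa> * (\<bar>t\<bar> * norm z)\<^sup>2" using \<kappa> by simp
    then show ?thesis using h\<kappa>[OF True] scale_nonneg[of "x + t *\<^sub>R z"] by (simp add: power_mult_distrib mult.assoc)
  qed (use scale_facts(3) \<kappa> in simp)
  have "((\<lambda>t. (h (x + t *\<^sub>R z) - h x) / t) \<longlongrightarrow> 0) (at 0)"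
  proof (rule Lim_null_comparison)
    show "\<forall>\<^sub>F t in at 0. norm ((h (x + t *\<^sub>R z) - h x) / t) \<le> \<kappa> * \<bar>t\<bar> * (norm z)\<^sup>2"
    proof (rule eventuallyI)
      fix t
      have "\<bar>h (x + t *\<^sub>R z)\<bar> / \<bar>t\<bar> \<le> \<kappa> * \<bar>t\<bar> * (norm z)\<^sup>2"
      proof (cases "t = 0")
        case False
        then show ?thesis using b[of t] by (simp add: pos_divide_le_eq power2_eq_square mult_ac)
      qed (use \<kappa> in simp)
      then show "norm ((h (x + t *\<^sub>R z) - h x) / t) \<le> \<kappa> * \<bar>t\<bar> * (norm z)\<^sup>2"
        using scale_facts(3)[OF False] by simp
    qed
    have "((\<lambda>t. \<kappa> * \<bar>t\<bar> * (norm z)\<^sup>2) \<longlongrightarrow> \<kappa> * \<bar>0\<bar> * (norm z)\<^sup>2) (at 0)" by (intro tendsto_intros)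
    then show "((\<lambda>t. \<kappa> * \<bar>t\<bar> * (norm z)\<^sup>2) \<longlongrightarrow> 0) (at 0)" by simp
  qed
  then show ?thesis using False scale_facts(4) by (simp add: DERIV_def)
qed

lemma grad_scale_continuous: "continuous_on UNIV gh"
proof -
  obtain C1 where C1: "C1 > 0" "\<And>x. norm (gh x) \<le> C1 * sqrt (h x)" using grad_scale_le_sqrt by blast
  have "isCont gh x" for x
  proof (cases "x \<in> \<Omega>")
    case True
    then show ?thesis using scale_facts(6) has_derivative_continuous by blast
  next
    case False
    have b: "norm (gh y) \<le> C1 * sqrt \<kappa> * dist y x" for y
    proof (cases "y \<in> \<Omega>")
      case True
      have "h y \<le> \<kappa> * (dist y x)\<^sup>2"
        using h\<kappa>[OF True] power_mono[OF infdist_frontier_le[OF True False] infdist_nonneg, of 2] \<kappa>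
        by (meson mult_left_mono less_imp_le order_trans)
      then have "sqrt (h y) \<le> sqrt (\<kappa> * (dist y x)\<^sup>2)" by simp
      also have "\<dots> = sqrt \<kappa> * dist y x" by (simp add: real_sqrt_mult)
      finally have "C1 * sqrt (h y) \<le> C1 * (sqrt \<kappa> * dist y x)" using C1(1) by simp
      then show ?thesis using C1(2)[of y] by (simp add: mult.assoc)
    qed (use scale_facts(4) C1 \<kappa> in simp)
    have "(gh \<longlongrightarrow> 0) (at x)"
    proof (rule Lim_null_comparison[where g="\<lambda>y. C1 * sqrt \<kappa> * dist y x"])
      have "((\<lambda>y. C1 * sqrt \<kappa> * dist y x) \<longlongrightarrow> C1 * sqrt \<kappa> * dist x x) (at x)" by (intro tendsto_intros)
      then show "((\<lambda>y. C1 * sqrt \<kappa> * dist y x) \<longlongrightarrow> 0) (at x)" by simp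
    qed (use b in auto)
    then show ?thesis using scale_facts(4)[OF False] by (simp add: isCont_def)
  qed
  then show ?thesis by (simp add: continuous_on_eq_continuous_at)
qed

lemma scale_continuous: "continuous_on UNIV h"
proof -
  have "isCont h x" for x
  proof (cases "x \<in> \<Omega>")
    case True
    then show ?thesis using scale_facts(2) has_derivative_continuous unfolding gderiv_def by blast
  next
    case False
    have b: "norm (h y) \<le> \<kappa> * (dist y x)\<^sup>2" for y
    proof (cases "y \<in> \<Omega>")
      case True
      then show ?thesis
        using h\<kappa>[OF True] power_mono[OF infdist_frontier_le[OF True False] infdist_nonneg, of 2] \<kappa> scale_nonneg[of y]
        by (simp, meson mult_left_mono less_imp_le order_trans)
    qed (use scale_facts(3) \<kappa> in simp)
    have "(h \<longlongrightarrow> 0) (at x)"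
    proof (rule Lim_null_comparison[where g="\<lambda>y. \<kappa> * (dist y x)\<^sup>2"])
      have "((\<lambda>y. \<kappa> * (dist y x)\<^sup>2) \<longlongrightarrow> \<kappa> * (dist x x)\<^sup>2) (at x)" by (intro tendsto_intros)
      then show "((\<lambda>y. \<kappa> * (dist y x)\<^sup>2) \<longlongrightarrow> 0) (at x)" by simp
    qed (use b in auto)
    then show ?thesis using scale_facts(3)[OF False] by (simp add: isCont_def)
  qed
  then show ?thesis by (simp add: continuous_on_eq_continuous_at)
qed

lemma jacobian_bound: assumes "norm z \<le> 1" shows "\<bar>z \<bullet> gh x\<bar> \<le> 1/3"
proof -
  have "norm (gh x) \<le> 1/3" using gh3[of x] scale_facts(4)[of x] by (cases "x \<in> \<Omega>") auto
  then have "norm z * norm (gh x) \<le> 1 * (1/3)" using assms by (intro mult_mono) auto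
  then show ?thesis using Cauchy_Schwarz_ineq2[of z "gh x"] by simp
qed

text \<open>The transport permutes the points of every line in direction \<open>z\<close>, also where the line crosses
  the boundary of \<open>\<Omega>\<close>, because \<open>h\<close> vanishes outside.\<close>

lemma nn_integral_transport:
  assumes z: "norm z \<le> 1" and [measurable]: "f \<in> borel_measurable borel"
  shows "(\<integral>\<^sup>+x. f (x + h x *\<^sub>R z) * ennreal (1 + z \<bullet> gh x) \<partial>lborel) = (\<integral>\<^sup>+x. f x \<partial>lborel)"
proof (rule nn_integral_line_substitution)
  show "continuous_on UNIV (\<lambda>t. z \<bullet> gh (x + t *\<^sub>R z))" for x
    by (intro continuous_intros continuous_on_compose2[OF grad_scale_continuous]) auto
  show "\<bar>z \<bullet> gh x\<bar> \<le> 1/2" for x using jacobian_bound[OF z, of x] by linarith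
qed (use scale_directional_derivative in measurable)

lemma integral_transport:
  fixes f :: "'a \<Rightarrow> real"
  assumes z: "norm z \<le> 1" and [measurable]: "f \<in> borel_measurable borel"
  shows "(\<integral>x. f (x + h x *\<^sub>R z) * (1 + z \<bullet> gh x) \<partial>lborel) = (\<integral>x. f x \<partial>lborel)"
proof -
  have "lborel = distr (density lborel (\<lambda>x. ennreal (1 + z \<bullet> gh x))) borel (\<lambda>x. x + h x *\<^sub>R z)"
    (is "_ = distr ?D borel ?T")
  proof (rule measure_eqI)
    fix A :: "'a set" assume "A \<in> sets lborel"
    then have [measurable]: "A \<in> sets borel" by simp
    have "emeasure lborel A = (\<integral>\<^sup>+x. indicator A (x + h x *\<^sub>R z) * ennreal (1 + z \<bullet> gh x) \<partial>lborel)"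
      by (subst nn_integral_transport[OF z]) auto
    also have "\<dots> = (\<integral>\<^sup>+x. indicator A (?T x) \<partial>?D)"
      by (subst nn_integral_density) (auto simp: mult.commute)
    also have "\<dots> = (\<integral>\<^sup>+x. indicator A x \<partial>(distr ?D borel ?T))"
      by (subst nn_integral_distr) auto
    finally show "emeasure lborel A = emeasure (distr ?D borel ?T) A" by simp
  qed simp
  then have "(\<integral>x. f x \<partial>lborel) = (\<integral>x. f x \<partial>(distr ?D borel ?T))" by simp
  also have "\<dots> = (\<integral>x. f (?T x) \<partial>?D)" by (subst integral_distr) auto
  also have "\<dots> = (\<integral>x. (1 + z \<bullet> gh x) *\<^sub>R f (?T x) \<partial>lborel)"
  proof (rule integral_density)
    have "0 \<le> 1 + z \<bullet> gh x" for x using jacobian_bound[OF z, of x] by (simp add: abs_le_iff)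
    then show "AE x in lborel. 0 \<le> 1 + z \<bullet> gh x" by simp
  qed auto
  finally show ?thesis by (simp add: mult.commute)
qed

definition diff_quot :: "('a \<Rightarrow> real) \<Rightarrow> 'a \<Rightarrow> 'a \<Rightarrow> real" where
  "diff_quot f z x = (f (x + h x *\<^sub>R z) - f x) / h x"

definition form_at :: "('a \<Rightarrow> real) \<Rightarrow> ('a \<Rightarrow> real) \<Rightarrow> 'a \<Rightarrow> real" where
  "form_at f k z = (\<integral>x. indicator \<Omega> x * (diff_quot f z x * diff_quot k z x) \<partial>lborel)"

lemma diff_quot_measurable [measurable]:
  assumes [measurable]: "f \<in> borel_measurable borel"
  shows "(\<lambda>x. diff_quot f z x) \<in> borel_measurable borel"
    "(\<lambda>p. diff_quot f (snd p) (fst p)) \<in> borel_measurable (borel \<Otimes>\<^sub>M borel)"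
  unfolding diff_quot_def by measurable

lemma \<Omega>_measurable [measurable]: "\<Omega> \<in> sets borel"
  using op by (rule borel_open)

lemma integrable_\<Omega>:
  assumes [measurable]: "f \<in> borel_measurable borel" and b: "\<And>x. x \<in> \<Omega> \<Longrightarrow> \<bar>f x\<bar> \<le> B"
  shows "integrable lborel (\<lambda>x. indicator \<Omega> x * f x)"
    and "\<bar>\<integral>x. indicator \<Omega> x * f x \<partial>lborel\<bar> \<le> B * measure lborel \<Omega>"
proof -
  have fin: "emeasure lborel \<Omega> < top" using emeasure_bounded_finite[OF bd] by simp
  have "integrable lborel (\<lambda>x. indicator \<Omega> x *\<^sub>R f x)"
    by (rule integrableI_bounded_set_indicator[where B=B]) (use b fin in auto)
  then show i: "integrable lborel (\<lambda>x. indicator \<Omega> x * f x)" by simp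
  have "\<bar>\<integral>x. indicator \<Omega> x * f x \<partial>lborel\<bar> \<le> (\<integral>x. indicator \<Omega> x * B \<partial>lborel)"
  proof (rule Bochner_Integration.integral_abs_bound_integral[OF i])
    show "integrable lborel (\<lambda>x. indicator \<Omega> x * B)" using fin by (simp add: integrable_indicator_iff)
  qed (use b in \<open>auto simp: indicator_def\<close>)
  then show "\<bar>\<integral>x. indicator \<Omega> x * f x \<partial>lborel\<bar> \<le> B * measure lborel \<Omega>" using fin by (simp add: mult.commute)
qed

context
  fixes u G H
  assumes u: "C2_zero_ext \<Omega> u G H C"
begin

lemma zero_ext_facts: "x \<in> \<Omega> \<Longrightarrow> GDERIV u x :> G x" "x \<in> \<Omega> \<Longrightarrow> norm (G x) \<le> C" "x \<in> \<Omega> \<Longrightarrow> \<bar>u x\<bar> \<le> C"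
  "x \<in> \<Omega> \<Longrightarrow> norm (H x) \<le> C" "x \<in> \<Omega> \<Longrightarrow> (G has_derivative blinfun_apply (H x)) (at x)"
  "x \<notin> \<Omega> \<Longrightarrow> u x = 0" "x \<notin> \<Omega> \<Longrightarrow> G x = 0" "x \<notin> \<Omega> \<Longrightarrow> H x = 0"
  using u unfolding C2_zero_ext_def by blast+

lemma zero_ext_measurable [measurable]: "u \<in> borel_measurable borel" "G \<in> borel_measurable borel"
  "(\<lambda>x. H x z) \<in> borel_measurable borel"
  using u unfolding C2_zero_ext_def by blast+

lemma diff_quot_bound: assumes "x \<in> \<Omega>" "norm z \<le> 1" shows "\<bar>diff_quot u z x\<bar> \<le> C"
proof -
  have hp: "h x > 0" using hpos assms by simp
  have "\<bar>u (x + h x *\<^sub>R z) - u x\<bar> \<le> C * norm (h x *\<^sub>R z)"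
    by (rule C2_zero_ext_segment(1)[OF u transport_inside(1)[OF assms]])
  also have "\<dots> \<le> C * h x" using hp assms(2) scale_facts(1) by simp
  finally show ?thesis using hp by (simp add: diff_quot_def field_simps)
qed

lemma diff_quot_derivative: assumes "x \<in> \<Omega>" "norm z \<le> 1"
  shows "\<bar>diff_quot u z x - z \<bullet> G x\<bar> \<le> C * h x"
proof -
  have hp: "h x > 0" using hpos assms by simp
  have "\<bar>u (x + h x *\<^sub>R z) - u x - (h x *\<^sub>R z) \<bullet> G x\<bar> \<le> C * (norm (h x *\<^sub>R z))\<^sup>2"
    by (rule C2_zero_ext_segment(3)[OF u transport_inside(1)[OF assms]])
  also have "\<dots> \<le> C * (h x)\<^sup>2" using hp assms(2) scale_facts(1) by (simp add: power_mult_distrib power_le_one)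
  finally have "\<bar>u (x + h x *\<^sub>R z) - u x - h x * (z \<bullet> G x)\<bar> / h x \<le> C * h x"
    using hp by (simp add: field_simps power2_eq_square)
  moreover have "diff_quot u z x - z \<bullet> G x = (u (x + h x *\<^sub>R z) - u x - h x * (z \<bullet> G x)) / h x"
    using hp by (simp add: diff_quot_def field_simps)
  ultimately show ?thesis using hp by simp
qed

lemma inner_bound: assumes "x \<in> \<Omega>" "norm z \<le> 1" shows "\<bar>z \<bullet> G x\<bar> \<le> C"
proof -
  have "norm z * norm (G x) \<le> 1 * C" using assms zero_ext_facts(2)[of x] scale_facts(1) by (intro mult_mono) auto
  then show ?thesis using Cauchy_Schwarz_ineq2[of z "G x"] by simp
qed

text \<open>The two terms are the transported and the original version of \<open>\<partial>\<^sub>zu / h\<close>, each of order \<open>1 / h\<close>.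
  They agree up to a bounded error because \<open>h (T x) = h x (1 + \<partial>\<^sub>zh x) + O(h x\<^sup>2)\<close>: the Jacobian of the
  transport compensates the variation of \<open>h\<close>.\<close>

lemma commutator_bound: assumes x: "x \<in> \<Omega>" and z: "norm z \<le> 1"
  shows "\<bar>diff_quot u z x / h x - (z \<bullet> G (x + h x *\<^sub>R z)) * (1 + z \<bullet> gh x) / h (x + h x *\<^sub>R z)\<bar>
    \<le> 2 * C + 3/2 * C\<^sup>2"
proof -
  let ?y = "x + h x *\<^sub>R z"
  define h0 h1 q g1 j where "h0 = h x" and "h1 = h ?y" and "q = diff_quot u z x" and "g1 = z \<bullet> G ?y" and "j = 1 + z \<bullet> gh x"
  have y: "?y \<in> \<Omega>" by (rule transport_inside(2)[OF x z])
  have h0: "h0 > 0" "h1 > 0" "2/3 * h0 \<le> h1" using hpos[OF x] hpos[OF y] scale_comparable[OF x z] by (auto simp: h0_def h1_def)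
  have nh: "norm (h x *\<^sub>R z) \<le> h0" using z hpos[OF x] by (simp add: h0_def)
  have q1: "\<bar>q - z \<bullet> G x\<bar> \<le> C * h0" unfolding q_def h0_def by (rule diff_quot_derivative[OF x z])
  have "norm (G ?y - G x) \<le> C * norm (h x *\<^sub>R z)" by (rule C2_zero_ext_segment(2)[OF u transport_inside(1)[OF x z]])
  then have "norm (G ?y - G x) \<le> C * h0" using nh scale_facts(1) by (meson mult_left_mono less_imp_le order_trans)
  then have "norm z * norm (G ?y - G x) \<le> 1 * (C * h0)" using z by (intro mult_mono) auto
  then have q2: "\<bar>g1 - z \<bullet> G x\<bar> \<le> C * h0"
    using Cauchy_Schwarz_ineq2[of z "G ?y - G x"] by (simp add: g1_def inner_diff_right)
  have "\<bar>h ?y - h x - (h x *\<^sub>R z) \<bullet> gh x\<bar> \<le> C * (norm (h x *\<^sub>R z))\<^sup>2"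
    by (rule C2_zero_ext_segment(3)[OF h transport_inside(1)[OF x z]])
  also have "\<dots> \<le> C * h0\<^sup>2" using nh scale_facts(1) by (intro mult_left_mono power_mono) auto
  finally have hh: "\<bar>h1 - h0 * j\<bar> \<le> C * h0\<^sup>2" by (simp add: h0_def h1_def j_def algebra_simps)
  have g1: "\<bar>g1\<bar> \<le> C" unfolding g1_def by (rule inner_bound[OF y z])
  have "q / h0 - g1 * j / h1 = ((q - g1) + g1 * (h1 - h0 * j) / h1) / h0"
    using h0 by (simp add: field_simps)
  also have "\<bar>\<dots>\<bar> = \<bar>(q - g1) + g1 * (h1 - h0 * j) / h1\<bar> / h0" using h0 by simp
  also have "\<dots> \<le> (2 * C * h0 + C * (C * h0\<^sup>2) / (2/3 * h0)) / h0"
  proof (rule divide_right_mono)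
    have "\<bar>q - g1\<bar> \<le> 2 * C * h0" using q1 q2 by (simp add: abs_le_iff algebra_simps)
    moreover have "\<bar>g1 * (h1 - h0 * j) / h1\<bar> \<le> C * (C * h0\<^sup>2) / (2/3 * h0)"
      unfolding abs_divide abs_mult using g1 hh h0 scale_facts(1)
      by (intro frac_le mult_mono) auto
    ultimately show "\<bar>(q - g1) + g1 * (h1 - h0 * j) / h1\<bar> \<le> 2 * C * h0 + C * (C * h0\<^sup>2) / (2/3 * h0)"
      by (rule order_trans[OF abs_triangle_ineq add_mono])
  qed (use h0 in simp)
  also have "\<dots> = 2 * C + 3/2 * C\<^sup>2" using h0 by (simp add: field_simps power2_eq_square)
  finally show ?thesis unfolding q_def h0_def g1_def j_def h1_def .
qed

text \<open>Writing the form as \<open>\<integral> (q\<^sub>u / h) (\<phi> \<circ> T - \<phi>)\<close>, one would like to move \<open>T\<close> from \<open>\<phi>\<close> to \<open>q\<^sub>u / h\<close>.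
  Replacing \<open>q\<^sub>u / h\<close> by \<open>\<partial>\<^sub>zu / h\<close>, suitably transported, costs a bounded error in both terms, and for
  \<open>a = \<phi> \<partial>\<^sub>zu / h\<close> the transport of measure gives exactly \<open>\<integral> (a \<circ> T) (1 + \<partial>\<^sub>zh) = \<integral> a\<close>, so the singular
  parts cancel.\<close>

lemma form_at_bound:
  assumes z: "norm z \<le> 1" and [measurable]: "\<phi> \<in> borel_measurable borel"
    and \<phi>M: "\<And>x. \<bar>\<phi> x\<bar> \<le> M" and \<epsilon>: "\<epsilon> > 0" and van: "\<And>x. h x < \<epsilon> \<Longrightarrow> \<phi> x = 0"
  shows "\<bar>form_at u \<phi> z\<bar> \<le> M * (3 * C + 3/2 * C\<^sup>2) * measure lborel \<Omega>"
proof -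
  have M0: "M \<ge> 0" using \<phi>M[of 0] by linarith
  define a where "a x = \<phi> x * (z \<bullet> G x) / h x" for x
  have [measurable]: "a \<in> borel_measurable borel" unfolding a_def by measurable
  let ?T = "\<lambda>x. x + h x *\<^sub>R z"
  have \<phi>\<Omega>: "\<phi> x = 0" if "x \<notin> \<Omega>" for x using van[of x] scale_facts(3)[OF that] \<epsilon> by simp
  have a\<Omega>: "a x = 0" if "x \<notin> \<Omega>" for x using \<phi>\<Omega>[OF that] by (simp add: a_def)
  have aB: "\<bar>a x\<bar> \<le> M * C / \<epsilon>" for x
  proof (cases "x \<in> \<Omega> \<and> h x \<ge> \<epsilon>")
    case True
    then have "\<bar>\<phi> x\<bar> * \<bar>z \<bullet> G x\<bar> / \<bar>h x\<bar> \<le> M * C / \<epsilon>"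
      using \<phi>M[of x] inner_bound[OF _ z, of x] M0 scale_facts(1) \<epsilon> by (intro frac_le mult_mono) auto
    then show ?thesis by (simp add: a_def abs_mult)
  next
    case False
    then have "\<phi> x = 0" using \<phi>\<Omega> van by force
    then show ?thesis using M0 scale_facts(1) \<epsilon> by (simp add: a_def)
  qed
  define e1 where "e1 x = \<phi> (?T x) * (diff_quot u z x / h x - (z \<bullet> G (?T x)) * (1 + z \<bullet> gh x) / h (?T x))" for x
  define e2 where "e2 x = \<phi> x * (z \<bullet> G x - diff_quot u z x) / h x" for x
  have [measurable]: "e1 \<in> borel_measurable borel" "e2 \<in> borel_measurable borel"
    unfolding e1_def e2_def by measurable
  have e1B: "\<bar>e1 x\<bar> \<le> M * (2 * C + 3/2 * C\<^sup>2)" if "x \<in> \<Omega>" for x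
    unfolding e1_def abs_mult using \<phi>M commutator_bound[OF that z] M0 by (intro mult_mono) auto
  have e2B: "\<bar>e2 x\<bar> \<le> M * C" if x: "x \<in> \<Omega>" for x
  proof -
    have "\<bar>z \<bullet> G x - diff_quot u z x\<bar> / h x \<le> C"
      using diff_quot_derivative[OF x z] hpos[OF x] by (simp add: field_simps abs_minus_commute)
    then have "\<bar>\<phi> x\<bar> * (\<bar>z \<bullet> G x - diff_quot u z x\<bar> / h x) \<le> M * C"
      using \<phi>M[of x] hpos[OF x] M0 by (intro mult_mono) auto
    then show ?thesis using hpos[OF x] by (simp add: e2_def abs_mult)
  qed
  have JB: "\<bar>1 + z \<bullet> gh x\<bar> \<le> 2" for x using jacobian_bound[OF z, of x] by (simp add: abs_le_iff)
  have aTB: "\<bar>a (?T x) * (1 + z \<bullet> gh x)\<bar> \<le> (M * C / \<epsilon>) * 2" for x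
    unfolding abs_mult using aB[of "?T x"] JB[of x] by (intro mult_mono) (auto intro: order_trans[OF abs_ge_zero])
  have split: "diff_quot u z x * diff_quot \<phi> z x = e1 x + e2 x + (a (?T x) * (1 + z \<bullet> gh x) - a x)"
    if x: "x \<in> \<Omega>" for x
    using hpos[OF x] hpos[OF transport_inside(2)[OF x z]] unfolding e1_def e2_def a_def
    by (subst (2) diff_quot_def) (simp add: field_simps)
  have i: "integrable lborel (\<lambda>x. indicator \<Omega> x * e1 x)" "integrable lborel (\<lambda>x. indicator \<Omega> x * e2 x)"
    "integrable lborel (\<lambda>x. indicator \<Omega> x * (a (?T x) * (1 + z \<bullet> gh x)))" "integrable lborel (\<lambda>x. indicator \<Omega> x * a x)"
    using integrable_\<Omega>(1)[OF _ e1B] integrable_\<Omega>(1)[OF _ e2B] integrable_\<Omega>(1)[OF _ aTB] integrable_\<Omega>(1)[OF _ aB] by simp_all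
  have "(\<integral>x. indicator \<Omega> x * (a (?T x) * (1 + z \<bullet> gh x)) \<partial>lborel) = (\<integral>x. a (?T x) * (1 + z \<bullet> gh x) \<partial>lborel)"
  proof (intro Bochner_Integration.integral_cong[OF refl])
    fix x
    show "indicator \<Omega> x * (a (?T x) * (1 + z \<bullet> gh x)) = a (?T x) * (1 + z \<bullet> gh x)"
      using a\<Omega>[of x] scale_facts(3)[of x] by (cases "x \<in> \<Omega>") auto
  qed
  also have "\<dots> = (\<integral>x. a x \<partial>lborel)" by (rule integral_transport[OF z]) measurable
  also have "\<dots> = (\<integral>x. indicator \<Omega> x * a x \<partial>lborel)"
    by (intro Bochner_Integration.integral_cong[OF refl]) (use a\<Omega> in \<open>auto simp: indicator_def\<close>)
  finally have cancel: "(\<integral>x. indicator \<Omega> x * (a (?T x) * (1 + z \<bullet> gh x)) \<partial>lborel) = (\<integral>x. indicator \<Omega> x * a x \<partial>lborel)" .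
  have "form_at u \<phi> z = (\<integral>x. indicator \<Omega> x * e1 x + indicator \<Omega> x * e2 x
      + (indicator \<Omega> x * (a (?T x) * (1 + z \<bullet> gh x)) - indicator \<Omega> x * a x) \<partial>lborel)"
    unfolding form_at_def
    by (intro Bochner_Integration.integral_cong[OF refl]) (use split in \<open>auto simp: indicator_def\<close>)
  also have "\<dots> = (\<integral>x. indicator \<Omega> x * e1 x \<partial>lborel) + (\<integral>x. indicator \<Omega> x * e2 x \<partial>lborel)"
    using i cancel by simp
  finally have "form_at u \<phi> z = (\<integral>x. indicator \<Omega> x * e1 x \<partial>lborel) + (\<integral>x. indicator \<Omega> x * e2 x \<partial>lborel)" .
  moreover have "\<bar>\<integral>x. indicator \<Omega> x * e1 x \<partial>lborel\<bar> \<le> M * (2 * C + 3/2 * C\<^sup>2) * measure lborel \<Omega>"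
    by (rule integrable_\<Omega>(2)[OF _ e1B]) measurable
  moreover have "\<bar>\<integral>x. indicator \<Omega> x * e2 x \<partial>lborel\<bar> \<le> M * C * measure lborel \<Omega>"
    by (rule integrable_\<Omega>(2)[OF _ e2B]) measurable
  ultimately have "\<bar>form_at u \<phi> z\<bar> \<le> M * (2 * C + 3/2 * C\<^sup>2) * measure lborel \<Omega> + M * C * measure lborel \<Omega>"
    by linarith
  then show ?thesis by (simp add: algebra_simps)
qed

end

end

section \<open>Cutting off near the boundary\<close>

text \<open>A quadratic spline with knots \<open>1\<close>, \<open>3/2\<close>, \<open>2\<close>, rising from \<open>0\<close> to \<open>1\<close>: its derivative \<open>cutoff'\<close>
  is a hat function, and the second order Taylor bound below follows from that of \<open>pos_square\<close>.\<close>

definition cutoff :: "real \<Rightarrow> real" where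
  "cutoff t = 2 * (pos_square (t - 1) - 2 * pos_square (t - 3/2) + pos_square (t - 2))"

definition cutoff' :: "real \<Rightarrow> real" where
  "cutoff' t = 4 * (max 0 (t - 1) - 2 * max 0 (t - 3/2) + max 0 (t - 2))"

lemma cutoff_low: "t \<le> 1 \<Longrightarrow> cutoff t = 0" "t \<le> 1 \<Longrightarrow> cutoff' t = 0"
  by (auto simp: cutoff_def cutoff'_def pos_square_def)

lemma cutoff_high: "t \<ge> 2 \<Longrightarrow> cutoff t = 1" "t \<ge> 2 \<Longrightarrow> cutoff' t = 0"
  by (auto simp: cutoff_def cutoff'_def pos_square_def power2_eq_square algebra_simps)

lemma cutoff_deriv: "(cutoff has_real_derivative cutoff' t) (at t)"
proof -
  have s: "((\<lambda>t. pos_square (t - c)) has_real_derivative 2 * max 0 (t - c)) (at t)" for c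
  proof -
    have "((\<lambda>t. t - c) has_real_derivative 1) (at t)" by (auto intro!: derivative_eq_intros)
    from DERIV_chain2[OF pos_square_derivative this] show ?thesis by simp
  qed
  show ?thesis
    unfolding cutoff_def[abs_def] cutoff'_def by (auto intro!: derivative_eq_intros s)
qed

lemma cutoff_bounds: "0 \<le> cutoff t" "cutoff t \<le> 1" "\<bar>cutoff' t\<bar> \<le> 4"
proof -
  consider "t \<le> 1" | "1 \<le> t" "t \<le> 3/2" | "3/2 \<le> t" "t \<le> 2" | "2 \<le> t" by linarith
  then have "0 \<le> cutoff t \<and> cutoff t \<le> 1 \<and> \<bar>cutoff' t\<bar> \<le> 4"
  proof cases
    case 2
    then have e: "cutoff t = 2 * (t - 1)\<^sup>2" "cutoff' t = 4 * (t - 1)" by (auto simp: cutoff_def cutoff'_def pos_square_def)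
    have "(t - 1)\<^sup>2 \<le> (1/2)\<^sup>2" using 2 by (intro power_mono) auto
    then show ?thesis using 2 unfolding e by (auto simp: power2_eq_square)
  next
    case 3
    then have e: "cutoff t = 1 - 2 * (2 - t)\<^sup>2" "cutoff' t = 4 * (2 - t)"
      by (auto simp: cutoff_def cutoff'_def pos_square_def power2_eq_square algebra_simps)
    have "(2 - t)\<^sup>2 \<le> (1/2)\<^sup>2" using 3 by (intro power_mono) auto
    then show ?thesis using 3 unfolding e by (auto simp: power2_eq_square)
  qed (auto simp: cutoff_low cutoff_high)
  then show "0 \<le> cutoff t" "cutoff t \<le> 1" "\<bar>cutoff' t\<bar> \<le> 4" by auto
qed

lemma pos_square_taylor: "\<bar>pos_square b - pos_square a - 2 * max 0 a * (b - a)\<bar> \<le> (b - a)\<^sup>2"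
proof -
  consider "a \<ge> 0" "b \<ge> 0" | "a \<ge> 0" "b < 0" | "a < 0" "b \<ge> 0" | "a < 0" "b < 0" by linarith
  then show ?thesis
  proof cases
    case 1
    then have "pos_square b - pos_square a - 2 * max 0 a * (b - a) = (b - a)\<^sup>2"
      by (simp add: pos_square_def power2_eq_square algebra_simps)
    then show ?thesis by simp
  next
    case 2
    then have e: "pos_square b - pos_square a - 2 * max 0 a * (b - a) = a * (a - 2 * b)" "a * b \<le> 0"
      by (auto simp: pos_square_def power2_eq_square algebra_simps mult_nonneg_nonpos)
    have "a * (a - 2 * b) \<ge> 0" using 2 by (intro mult_nonneg_nonneg) auto
    then show ?thesis unfolding e(1) by (simp add: power2_eq_square algebra_simps)
  next
    case 3
    then have e: "pos_square b - pos_square a - 2 * max 0 a * (b - a) = b\<^sup>2"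
      by (simp add: pos_square_def)
    have "b\<^sup>2 \<le> (b - a)\<^sup>2" using 3 by (intro power_mono) auto
    then show ?thesis unfolding e by simp
  next
    case 4
    then have "pos_square b - pos_square a - 2 * max 0 a * (b - a) = 0"
      by (simp add: pos_square_def)
    then show ?thesis by simp
  qed
qed

lemma cutoff_taylor: "\<bar>cutoff b - cutoff a - cutoff' a * (b - a)\<bar> \<le> 8 * (b - a)\<^sup>2"
proof -
  define r where "r c = pos_square (b - c) - pos_square (a - c) - 2 * max 0 (a - c) * (b - a)" for c
  have rb: "\<bar>r c\<bar> \<le> (b - a)\<^sup>2" for c using pos_square_taylor[of "b - c" "a - c"] by (simp add: r_def)
  have "\<bar>2 * (r 1 - 2 * r (3/2) + r 2)\<bar> \<le> 8 * (b - a)\<^sup>2"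
  proof -
    have "\<bar>2 * (x - 2 * y + w)\<bar> \<le> 8 * s" if "\<bar>x\<bar> \<le> s" "\<bar>y\<bar> \<le> s" "\<bar>w\<bar> \<le> s" for x y w s :: real
    proof -
      have "x \<le> s" "- x \<le> s" "y \<le> s" "- y \<le> s" "w \<le> s" "- w \<le> s" using that by auto
      then have "x - 2 * y + w \<le> 4 * s" "- (x - 2 * y + w) \<le> 4 * s" by simp_all
      then show ?thesis unfolding abs_mult by (simp add: abs_le_iff)
    qed
    then show ?thesis using rb by blast
  qed
  moreover have "cutoff b - cutoff a - cutoff' a * (b - a) = 2 * (r 1 - 2 * r (3/2) + r 2)"
    by (simp add: cutoff_def cutoff'_def r_def algebra_simps)
  ultimately show ?thesis by simp
qed

context nonlocal_setting
begin

lemma cutoff_measurable [measurable]: "cutoff \<in> borel_measurable borel" "cutoff' \<in> borel_measurable borel"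
proof -
  show "cutoff \<in> borel_measurable borel"
    using cutoff_deriv by (meson DERIV_isCont borel_measurable_continuous_onI continuous_at_imp_continuous_on)
  show "cutoff' \<in> borel_measurable borel" unfolding cutoff'_def[abs_def] by measurable
qed

text \<open>On the layer where the cutoff varies, \<open>N h\<close> is bounded. There \<open>|h (T x) - h x| \<le> c h\<^sup>3\<^sup>/\<^sup>2\<close>, because
  \<open>|\<nabla>h| \<le> c \<surd>h\<close>, so the second order Taylor error \<open>N\<^sup>2 (h (T x) - h x)\<^sup>2 / h\<close> is at most of order \<open>(N h)\<^sup>2\<close>.
  The derivative of the cutoff itself is of order \<open>N \<surd>h\<close> and not bounded uniformly in \<open>N\<close>, but it is bounded after
  multiplication by \<open>h\<close>.\<close>

lemma cutoff_quotient_error: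
  obtains B where "B \<ge> 0" "\<And>N x (z::'a). N \<ge> 0 \<Longrightarrow> x \<in> \<Omega> \<Longrightarrow> norm z \<le> 1 \<Longrightarrow>
     \<bar>diff_quot (\<lambda>x. cutoff (N * h x)) z x - N * cutoff' (N * h x) * (z \<bullet> gh x)\<bar> \<le> B \<and>
     h x * \<bar>N * cutoff' (N * h x) * (z \<bullet> gh x)\<bar> \<le> B \<and>
     (N * h x > 3 \<longrightarrow> diff_quot (\<lambda>x. cutoff (N * h x)) z x = 0 \<and> cutoff' (N * h x) = 0)"
proof -
  obtain C1 where C1: "C1 > 0" "\<And>x. norm (gh x) \<le> C1 * sqrt (h x)" using grad_scale_le_sqrt by blast
  have C0: "C > 0" by (rule scale_facts(1))
  define B where "B = 8 * (18 * (C1\<^sup>2 + C^3)) + 12 * C + 12 * C1 * sqrt C"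
  have B0: "B \<ge> 0" using C0 C1 by (simp add: B_def)
  show ?thesis
  proof (rule that[of B])
    show "B \<ge> 0" by (rule B0)
    fix N :: real and x z :: 'a assume N: "N \<ge> 0" and x: "x \<in> \<Omega>" and z: "norm z \<le> 1"
    let ?y = "x + h x *\<^sub>R z"
    define h0 h1 j p' where "h0 = h x" and "h1 = h ?y" and "j = z \<bullet> gh x" and "p' = cutoff' (N * h0)"
    have h0: "h0 > 0" "h1 \<ge> 2/3 * h0" using hpos[OF x] scale_comparable[OF x z] by (auto simp: h0_def h1_def)
    have "\<bar>h x\<bar> \<le> C" using h x unfolding C2_zero_ext_def by blast
    then have h0C: "h0 \<le> C" by (simp add: h0_def)
    have far: "N * h0 > 3 \<Longrightarrow> diff_quot (\<lambda>x. cutoff (N * h x)) z x = 0 \<and> p' = 0"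
    proof -
      assume g: "N * h0 > 3"
      have "N * h1 \<ge> N * (2/3 * h0)" using h0(2) N by (rule mult_left_mono)
      then have "N * h1 \<ge> 2" using g by simp
      then show ?thesis using g cutoff_high(1)[of "N * h0"] cutoff_high(1)[of "N * h1"] cutoff_high(2)[of "N * h0"]
        by (simp add: diff_quot_def h0_def h1_def p'_def)
    qed
    have p4: "\<bar>p'\<bar> \<le> 4" unfolding p'_def by (rule cutoff_bounds)
    have jb: "\<bar>j\<bar> \<le> C1 * sqrt h0"
    proof -
      have "norm z * norm (gh x) \<le> 1 * (C1 * sqrt h0)"
        using z C1(2)[of x] by (intro mult_mono) (auto simp: h0_def)
      then show ?thesis using Cauchy_Schwarz_ineq2[of z "gh x"] by (simp add: j_def)
    qed
    have "\<bar>h ?y - h x - (h x *\<^sub>R z) \<bullet> gh x\<bar> \<le> C * (norm (h x *\<^sub>R z))\<^sup>2"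
      by (rule C2_zero_ext_segment(3)[OF h transport_inside(1)[OF x z]])
    also have "\<dots> \<le> C * h0\<^sup>2"
      using z C0 hpos[OF x] by (intro mult_left_mono power_mono) (auto simp: h0_def)
    finally have d1: "\<bar>h1 - h0 - h0 * j\<bar> \<le> C * h0\<^sup>2" by (simp add: h0_def h1_def j_def)
    have E: "\<bar>diff_quot (\<lambda>x. cutoff (N * h x)) z x - N * p' * j\<bar> \<le> B \<and> h0 * \<bar>N * p' * j\<bar> \<le> B"
    proof (cases "N * h0 > 3")
      case True
      then show ?thesis using far B0 N by simp
    next
      case False
      then have Nh: "N * h0 \<le> 3" by simp
      have "\<bar>h1 - h0\<bar> \<le> h0 * (C1 * sqrt h0 + C * h0)"
      proof -
        have "\<bar>h1 - h0\<bar> \<le> h0 * \<bar>j\<bar> + C * h0\<^sup>2" using d1 h0(1) abs_mult[of h0 j] by (simp add: abs_le_iff) linarith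
        also have "\<dots> \<le> h0 * (C1 * sqrt h0) + C * h0\<^sup>2" using jb h0(1) by (intro add_right_mono mult_left_mono) auto
        finally show ?thesis by (simp add: power2_eq_square algebra_simps)
      qed
      then have "(h1 - h0)\<^sup>2 \<le> (h0 * (C1 * sqrt h0 + C * h0))\<^sup>2"
        by (subst power2_abs[symmetric]) (intro power_mono abs_ge_zero)
      also have "\<dots> = h0\<^sup>2 * (C1 * sqrt h0 + C * h0)\<^sup>2" by (simp add: power_mult_distrib)
      also have "(C1 * sqrt h0 + C * h0)\<^sup>2 \<le> 2 * ((C1 * sqrt h0)\<^sup>2 + (C * h0)\<^sup>2)"
        using zero_le_power2[of "C1 * sqrt h0 - C * h0"] by (simp add: power2_eq_square algebra_simps)
      also have "(C1 * sqrt h0)\<^sup>2 + (C * h0)\<^sup>2 = h0 * (C1\<^sup>2 + C\<^sup>2 * h0)"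
        using h0(1) by (simp add: power_mult_distrib) (simp add: power2_eq_square algebra_simps)
      also have "C1\<^sup>2 + C\<^sup>2 * h0 \<le> C1\<^sup>2 + C^3"
        using h0C C0 by (simp add: power2_eq_square power3_eq_cube)
      finally have d2: "(h1 - h0)\<^sup>2 \<le> h0\<^sup>2 * (2 * (h0 * (C1\<^sup>2 + C^3)))" using h0(1) by (simp add: mult_left_mono)
      have Nh2: "(N * h0)\<^sup>2 \<le> 9" using power_mono[OF Nh, of 2] N h0(1) by simp
      define r where "r = cutoff (N * h1) - cutoff (N * h0) - p' * (N * h1 - N * h0)"
      have "\<bar>r\<bar> \<le> 8 * (N * h1 - N * h0)\<^sup>2" unfolding r_def p'_def by (rule cutoff_taylor)
      also have "(N * h1 - N * h0)\<^sup>2 = N\<^sup>2 * (h1 - h0)\<^sup>2" by (simp add: power_mult_distrib right_diff_distrib[symmetric])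
      also have "\<dots> \<le> N\<^sup>2 * (h0\<^sup>2 * (2 * (h0 * (C1\<^sup>2 + C^3))))" using d2 by (rule mult_left_mono) simp
      also have "\<dots> = (N * h0)\<^sup>2 * (2 * (C1\<^sup>2 + C^3)) * h0" by (simp add: power_mult_distrib)
      also have "\<dots> \<le> 9 * (2 * (C1\<^sup>2 + C^3)) * h0" using Nh2 C0 h0(1) by (intro mult_right_mono) auto
      finally have r1: "\<bar>r\<bar> \<le> 8 * (18 * (C1\<^sup>2 + C^3)) * h0" by (simp add: algebra_simps)
      have "\<bar>p' * N * (h1 - h0 - h0 * j)\<bar> \<le> (4 * N) * (C * h0\<^sup>2)"
        unfolding abs_mult using p4 d1 N by (intro mult_mono) auto
      also have "\<dots> = 4 * C * (N * h0) * h0" by (simp add: power2_eq_square)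
      also have "\<dots> \<le> 4 * C * 3 * h0" using Nh C0 h0(1) by (intro mult_right_mono mult_left_mono) auto
      finally have r2: "\<bar>p' * N * (h1 - h0 - h0 * j)\<bar> \<le> 12 * C * h0" by simp
      have "diff_quot (\<lambda>x. cutoff (N * h x)) z x - N * p' * j = (r + p' * N * (h1 - h0 - h0 * j)) / h0"
        using h0(1) by (simp add: diff_quot_def r_def h0_def h1_def field_simps)
      also have "\<bar>\<dots>\<bar> \<le> (8 * (18 * (C1\<^sup>2 + C^3)) * h0 + 12 * C * h0) / h0"
        unfolding abs_divide abs_of_pos[OF h0(1)]
        using abs_triangle_ineq[of r "p' * N * (h1 - h0 - h0 * j)"] r1 r2 h0(1) by (intro divide_right_mono) auto
      also have "\<dots> = 8 * (18 * (C1\<^sup>2 + C^3)) + 12 * C" using h0(1) by (simp add: field_simps)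
      also have "\<dots> \<le> B" using C0 C1(1) by (simp add: B_def)
      finally have 1: "\<bar>diff_quot (\<lambda>x. cutoff (N * h x)) z x - N * p' * j\<bar> \<le> B" .
      have sq: "sqrt h0 \<le> sqrt C" using h0C by simp
      have "h0 * \<bar>N * p' * j\<bar> = (N * h0) * (\<bar>p'\<bar> * \<bar>j\<bar>)" using N by (simp add: abs_mult)
      also have "\<dots> \<le> 3 * (4 * (C1 * sqrt C))"
        using Nh p4 jb C1(1) sq h0(1) N by (intro mult_mono) (auto intro: order_trans[OF jb] mult_left_mono)
      also have "\<dots> \<le> B" using C0 C1(1) by (simp add: B_def)
      finally show ?thesis using 1 by blast
    qed
    show "\<bar>diff_quot (\<lambda>x. cutoff (N * h x)) z x - N * cutoff' (N * h x) * (z \<bullet> gh x)\<bar> \<le> B \<and>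
     h x * \<bar>N * cutoff' (N * h x) * (z \<bullet> gh x)\<bar> \<le> B \<and>
     (N * h x > 3 \<longrightarrow> diff_quot (\<lambda>x. cutoff (N * h x)) z x = 0 \<and> cutoff' (N * h x) = 0)"
      using E far unfolding h0_def p'_def j_def by blast
  qed
qed

end

context nonlocal_setting
begin

context
  fixes u G H v K L
  assumes u: "C2_zero_ext \<Omega> u G H C" and v: "C2_zero_ext \<Omega> v K L C"
begin

text \<open>The derivative in direction \<open>z\<close> of \<open>v \<partial>\<^sub>zu\<close>.\<close>

definition flux_derivative :: "'a \<Rightarrow> 'a \<Rightarrow> real" where
  "flux_derivative z x = (z \<bullet> K x) * (z \<bullet> G x) + v x * (H x z \<bullet> z)"

lemmas u_measurables [measurable] = zero_ext_measurable[OF u]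
lemmas v_measurables [measurable] = zero_ext_measurable[OF v]

lemma flux_derivative_measurable [measurable]: "flux_derivative z \<in> borel_measurable borel"
  unfolding flux_derivative_def[abs_def] by measurable

lemma flux_derivative_bound: assumes x: "x \<in> \<Omega>" and z: "norm z \<le> 1"
  shows "\<bar>flux_derivative z x\<bar> \<le> 2 * C\<^sup>2"
proof -
  have C0: "C > 0" by (rule scale_facts(1))
  have 1: "\<bar>(z \<bullet> K x) * (z \<bullet> G x)\<bar> \<le> C * C"
    unfolding abs_mult using inner_bound[OF v x z] inner_bound[OF u x z] C0 by (intro mult_mono) auto
  have "norm (H x z) \<le> C * norm z"
    using norm_blinfun[of "H x" z] zero_ext_facts(4)[OF u x] by (meson mult_right_mono norm_ge_zero order_trans)
  also have "\<dots> \<le> C * 1" using z C0 by (intro mult_left_mono) auto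
  finally have "norm (H x z) * norm z \<le> C * 1" using z C0 by (intro mult_mono) auto
  then have "\<bar>H x z \<bullet> z\<bar> \<le> C" using Cauchy_Schwarz_ineq2[of "H x z" z] by simp
  then have "\<bar>v x * (H x z \<bullet> z)\<bar> \<le> C * C"
    unfolding abs_mult using zero_ext_facts(3)[OF v x] C0 by (intro mult_mono) auto
  with 1 show ?thesis unfolding flux_derivative_def
    using abs_triangle_ineq[of "(z \<bullet> K x) * (z \<bullet> G x)" "v x * (H x z \<bullet> z)"] by (simp add: power2_eq_square)
qed

lemma flux_direction: assumes x: "x \<in> \<Omega>"
  shows "((\<lambda>t. v (x + t *\<^sub>R z) * (z \<bullet> G (x + t *\<^sub>R z))) has_real_derivative flux_derivative z x) (at 0)"
proof -
  have l: "((\<lambda>t. x + t *\<^sub>R z) has_derivative (\<lambda>t. t *\<^sub>R z)) (at 0)"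
    by (auto intro!: derivative_eq_intros)
  have "((\<lambda>t. G (x + t *\<^sub>R z)) has_derivative (\<lambda>t. H x (t *\<^sub>R z))) (at 0)"
    by (rule has_derivative_compose[OF l]) (use zero_ext_facts(5)[OF u x] in simp)
  then have "((\<lambda>t. G (x + t *\<^sub>R z)) has_vector_derivative H x z) (at 0)"
    by (simp add: has_vector_derivative_def blinfun.scaleR_right)
  then have "((\<lambda>t. z \<bullet> G (x + t *\<^sub>R z)) has_real_derivative z \<bullet> H x z) (at 0)"
    using bounded_linear.has_vector_derivative[OF bounded_linear_inner_right]
    by (simp add: has_real_derivative_iff_has_vector_derivative)
  from DERIV_mult[OF GDERIV_direction[OF zero_ext_facts(1)[OF v x], of z] this]
  show ?thesis by (simp add: flux_derivative_def inner_commute mult.commute)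
qed

lemma integration_by_parts:
  assumes N: "N \<ge> 0" and z: "norm z \<le> 1"
  shows "(\<integral>x. indicator \<Omega> x * (v x * (z \<bullet> G x) * (N * cutoff' (N * h x) * (z \<bullet> gh x))) \<partial>lborel)
    = - (\<integral>x. indicator \<Omega> x * (cutoff (N * h x) * flux_derivative z x) \<partial>lborel)"
proof -
  have C0: "C > 0" by (rule scale_facts(1))
  define F where "F x = cutoff (N * h x) * (v x * (z \<bullet> G x))" for x
  define f1 where "f1 x = v x * (z \<bullet> G x) * (N * cutoff' (N * h x) * (z \<bullet> gh x))" for x
  define f2 where "f2 x = cutoff (N * h x) * flux_derivative z x" for x
  have [measurable]: "f1 \<in> borel_measurable borel" "f2 \<in> borel_measurable borel"
    unfolding f1_def f2_def by measurable
  have f1B: "\<bar>f1 x\<bar> \<le> C * C * (N * 4 * (1/3))" if x: "x \<in> \<Omega>" for x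
    unfolding f1_def abs_mult
    using inner_bound[OF u x z] zero_ext_facts(3)[OF v x] jacobian_bound[OF z, of x] cutoff_bounds(3)[of "N * h x"] N C0
    by (intro mult_mono) auto
  have f2B: "\<bar>f2 x\<bar> \<le> 1 * (2 * C\<^sup>2)" if x: "x \<in> \<Omega>" for x
    unfolding f2_def abs_mult using flux_derivative_bound[OF x z] cutoff_bounds[of "N * h x"]
    by (intro mult_mono) auto
  have out: "f1 x = 0" "f2 x = 0" "F x = 0" if "x \<notin> \<Omega>" for x
    using zero_ext_facts(6,7)[OF v that] by (auto simp: f1_def f2_def F_def flux_derivative_def)
  obtain R where R: "\<And>x. x \<in> \<Omega> \<Longrightarrow> norm x < R" using bd unfolding bounded_pos_less by blast
  have "(\<integral>x. indicator UNIV x * (f1 x + f2 x) \<partial>lborel) = 0"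
  proof (rule integral_derivative_invariant_set[where b=z and F=F and R=R and C="C * C * (N * 4 * (1/3)) + 1 * (2 * C\<^sup>2)"])
    fix x
    show "\<bar>f1 x + f2 x\<bar> \<le> C * C * (N * 4 * (1/3)) + 1 * (2 * C\<^sup>2)"
    proof (cases "x \<in> \<Omega>")
      case True
      then show ?thesis using f1B[OF True] f2B[OF True] by (meson abs_triangle_ineq add_mono order_trans)
    qed (use out N C0 in simp)
    show "F x = 0 \<and> f1 x + f2 x = 0" if "R \<le> norm x" using R[of x] out[of x] that by force
    show "((\<lambda>t. F (x + t *\<^sub>R z)) has_real_derivative f1 x + f2 x) (at 0)"
    proof (cases "x \<in> \<Omega>")
      case True
      have "((\<lambda>t. N * h (x + t *\<^sub>R z)) has_real_derivative N * (z \<bullet> gh x)) (at 0)"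
        using scale_directional_derivative by (rule DERIV_cmult)
      from DERIV_chain2[where g="\<lambda>t. N * h (x + t *\<^sub>R z)", OF cutoff_deriv this]
      have "((\<lambda>t. cutoff (N * h (x + t *\<^sub>R z))) has_real_derivative cutoff' (N * h x) * (N * (z \<bullet> gh x))) (at 0)" by simp
      from DERIV_mult[OF this flux_direction[OF True, of z]]
      show ?thesis by (simp add: F_def f1_def f2_def mult_ac)
    next
      case False
      have "isCont (\<lambda>t. N * h (x + t *\<^sub>R z)) 0"
        by (intro continuous_intros continuous_at_compose[of 0 "\<lambda>t. x + t *\<^sub>R z" h, unfolded o_def])
           (use scale_continuous in \<open>auto simp: continuous_on_eq_continuous_at\<close>)
      then have "((\<lambda>t. N * h (x + t *\<^sub>R z)) \<longlongrightarrow> N * h (x + 0 *\<^sub>R z)) (nhds 0)"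
        using tendsto_at_iff_tendsto_nhds[of "\<lambda>t. N * h (x + t *\<^sub>R z)" 0] by (simp add: isCont_def)
      then have "((\<lambda>t. N * h (x + t *\<^sub>R z)) \<longlongrightarrow> 0) (nhds 0)"
        using scale_facts(3)[OF False] by simp
      then have "\<forall>\<^sub>F t in nhds 0. N * h (x + t *\<^sub>R z) < 1" by (rule order_tendstoD) simp
      then have ev: "\<forall>\<^sub>F t in nhds 0. F (x + t *\<^sub>R z) = 0"
        by eventually_elim (simp add: F_def cutoff_low)
      show ?thesis
        using DERIV_cong_ev[OF refl ev refl] out[OF False] by simp
    qed
  qed auto
  then have "(\<integral>x. f1 x + f2 x \<partial>lborel) = 0" by simp
  moreover have "(\<integral>x. f1 x + f2 x \<partial>lborel) = (\<integral>x. indicator \<Omega> x * f1 x + indicator \<Omega> x * f2 x \<partial>lborel)"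
    by (intro Bochner_Integration.integral_cong[OF refl]) (use out in \<open>auto simp: indicator_def\<close>)
  moreover have "\<dots> = (\<integral>x. indicator \<Omega> x * f1 x \<partial>lborel) + (\<integral>x. indicator \<Omega> x * f2 x \<partial>lborel)"
    by (rule Bochner_Integration.integral_add) (use integrable_\<Omega>(1)[OF _ f1B] integrable_\<Omega>(1)[OF _ f2B] in simp_all)
  ultimately show ?thesis by (simp add: f1_def f2_def)
qed

lemma form_at_cutoff_limit:
  assumes z: "norm z \<le> 1"
  shows "(\<lambda>n. form_at u (\<lambda>x. cutoff (real n * h x) * v x) z)
    \<longlonglongrightarrow> form_at u v z - (\<integral>x. indicator \<Omega> x * flux_derivative z x \<partial>lborel)"
proof -
  have C0: "C > 0" by (rule scale_facts(1))
  have fin: "emeasure lborel \<Omega> < top" using emeasure_bounded_finite[OF bd] by simp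
  have intc: "integrable lborel (\<lambda>x. indicator \<Omega> x * c)" for c :: real
    using fin by (simp add: integrable_indicator_iff)
  obtain B where B: "B \<ge> 0" and E: "\<And>N x z. N \<ge> 0 \<Longrightarrow> x \<in> \<Omega> \<Longrightarrow> norm z \<le> 1 \<Longrightarrow>
     \<bar>diff_quot (\<lambda>x. cutoff (N * h x)) z x - N * cutoff' (N * h x) * (z \<bullet> gh x)\<bar> \<le> B \<and>
     h x * \<bar>N * cutoff' (N * h x) * (z \<bullet> gh x)\<bar> \<le> B \<and>
     (N * h x > 3 \<longrightarrow> diff_quot (\<lambda>x. cutoff (N * h x)) z x = 0 \<and> cutoff' (N * h x) = 0)"
    using cutoff_quotient_error by blast
  let ?T = "\<lambda>x. x + h x *\<^sub>R z"
  define \<zeta> where "\<zeta> n x = cutoff (real n * h x)" for n x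
  define d\<zeta> where "d\<zeta> n x = real n * cutoff' (real n * h x) * (z \<bullet> gh x)" for n x
  \<comment> \<open>The form splits into the convergent part \<open>s\<close>, the error \<open>R\<close> of replacing difference
    quotients by derivatives, and a term that is integrated by parts.\<close>
  define R where "R n x = v (?T x) * diff_quot u z x * diff_quot (\<zeta> n) z x - v x * (z \<bullet> G x) * d\<zeta> n x" for n x
  define s where "s n x = \<zeta> n x * (diff_quot u z x * diff_quot v z x)" for n x
  have \<zeta>m [measurable]: "\<zeta> n \<in> borel_measurable borel" for n unfolding \<zeta>_def by measurable
  have [measurable]: "d\<zeta> n \<in> borel_measurable borel" for n unfolding d\<zeta>_def by measurable
  have [measurable]: "R n \<in> borel_measurable borel" "s n \<in> borel_measurable borel" for n
    unfolding R_def s_def by measurable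
  have \<zeta>01: "\<bar>\<zeta> n x\<bar> \<le> 1" for n x using cutoff_bounds[of "real n * h x"] by (simp add: \<zeta>_def)
  have \<zeta>lim: "(\<lambda>n. \<zeta> n x) \<longlonglongrightarrow> 1" if x: "x \<in> \<Omega>" for x
  proof -
    have "filterlim (\<lambda>n. real n * h x) at_top sequentially"
      by (rule filterlim_at_top_mult_tendsto_pos[OF tendsto_const hpos[OF x] filterlim_real_sequentially])
    then have "\<forall>\<^sub>F n in sequentially. real n * h x \<ge> 2" by (simp add: filterlim_at_top)
    then have "\<forall>\<^sub>F n in sequentially. \<zeta> n x = 1" by eventually_elim (simp add: \<zeta>_def cutoff_high)
    then show ?thesis by (rule tendsto_eventually)
  qed
  have RB: "\<bar>R n x\<bar> \<le> C * C * B + 2 * C\<^sup>2 * B" and Rfar: "real n * h x > 3 \<Longrightarrow> R n x = 0" if x: "x \<in> \<Omega>" for n x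
  proof -
    note En = E[of "real n" x z, OF _ x z, folded \<zeta>_def d\<zeta>_def, simplified]
    let ?q = "diff_quot u z x"
    have eq: "R n x = v (?T x) * ?q * (diff_quot (\<zeta> n) z x - d\<zeta> n x) + (v (?T x) * ?q - v x * (z \<bullet> G x)) * d\<zeta> n x"
      by (simp add: R_def algebra_simps)
    have y: "?T x \<in> \<Omega>" by (rule transport_inside(2)[OF x z])
    have 1: "\<bar>v (?T x) * ?q * (diff_quot (\<zeta> n) z x - d\<zeta> n x)\<bar> \<le> C * C * B"
      unfolding abs_mult using zero_ext_facts(3)[OF v y] diff_quot_bound[OF u x z] En C0
      by (intro mult_mono) (auto simp: \<zeta>_def d\<zeta>_def)
    have "\<bar>v (?T x) - v x\<bar> \<le> C * norm (h x *\<^sub>R z)" by (rule C2_zero_ext_segment(1)[OF v transport_inside(1)[OF x z]])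
    also have "\<dots> \<le> C * h x" using z C0 hpos[OF x] by (intro mult_left_mono) auto
    finally have "\<bar>(v (?T x) - v x) * ?q\<bar> \<le> (C * h x) * C"
      unfolding abs_mult using diff_quot_bound[OF u x z] C0 hpos[OF x] by (intro mult_mono) auto
    moreover have "\<bar>v x * (?q - z \<bullet> G x)\<bar> \<le> C * (C * h x)"
      unfolding abs_mult using diff_quot_derivative[OF u x z] zero_ext_facts(3)[OF v x] C0 by (intro mult_mono) auto
    moreover have "v (?T x) * ?q - v x * (z \<bullet> G x) = (v (?T x) - v x) * ?q + v x * (?q - z \<bullet> G x)"
      by (simp add: algebra_simps)
    ultimately have "\<bar>v (?T x) * ?q - v x * (z \<bullet> G x)\<bar> \<le> 2 * C\<^sup>2 * h x"
      using abs_triangle_ineq[of "(v (?T x) - v x) * ?q" "v x * (?q - z \<bullet> G x)"] by (simp add: power2_eq_square mult_ac)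
    then have "\<bar>(v (?T x) * ?q - v x * (z \<bullet> G x)) * d\<zeta> n x\<bar> \<le> 2 * C\<^sup>2 * h x * \<bar>d\<zeta> n x\<bar>"
      unfolding abs_mult by (rule mult_right_mono) simp
    also have "\<dots> = 2 * C\<^sup>2 * (h x * \<bar>d\<zeta> n x\<bar>)" by simp
    also have "\<dots> \<le> 2 * C\<^sup>2 * B" using En C0 by (intro mult_left_mono) (auto simp: d\<zeta>_def)
    finally show "\<bar>R n x\<bar> \<le> C * C * B + 2 * C\<^sup>2 * B" unfolding eq using 1
      by (meson abs_triangle_ineq add_mono order_trans)
    show "R n x = 0" if "real n * h x > 3"
      using En that by (simp add: R_def d\<zeta>_def \<zeta>_def)
  qed
  have sB: "\<bar>s n x\<bar> \<le> 1 * (C * C)" if x: "x \<in> \<Omega>" for n x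
    unfolding s_def abs_mult using \<zeta>01[of n x] diff_quot_bound[OF u x z] diff_quot_bound[OF v x z] C0
    by (intro mult_mono) auto
  have tB: "\<bar>v x * (z \<bullet> G x) * d\<zeta> n x\<bar> \<le> C * C * (n * 4 * (1/3))" if x: "x \<in> \<Omega>" for n x
    unfolding abs_mult d\<zeta>_def
    using inner_bound[OF u x z] zero_ext_facts(3)[OF v x] jacobian_bound[OF z, of x] cutoff_bounds(3)[of "n * h x"] C0
    by (intro mult_mono) auto
  have form: "form_at u (\<lambda>x. \<zeta> n x * v x) z = (\<integral>x. indicator \<Omega> x * s n x \<partial>lborel) + (\<integral>x. indicator \<Omega> x * R n x \<partial>lborel)
     - (\<integral>x. indicator \<Omega> x * (\<zeta> n x * flux_derivative z x) \<partial>lborel)" for n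
  proof -
    have "form_at u (\<lambda>x. \<zeta> n x * v x) z = (\<integral>x. indicator \<Omega> x * s n x + indicator \<Omega> x * R n x + indicator \<Omega> x * (v x * (z \<bullet> G x) * d\<zeta> n x) \<partial>lborel)"
      unfolding form_at_def
    proof (intro Bochner_Integration.integral_cong[OF refl])
      fix x
      have "diff_quot u z x * diff_quot (\<lambda>x. \<zeta> n x * v x) z x = s n x + R n x + v x * (z \<bullet> G x) * d\<zeta> n x" if "x \<in> \<Omega>"
        using hpos[OF that] by (simp add: s_def R_def diff_quot_def field_simps)
      then show "indicator \<Omega> x * (diff_quot u z x * diff_quot (\<lambda>x. \<zeta> n x * v x) z x)
        = indicator \<Omega> x * s n x + indicator \<Omega> x * R n x + indicator \<Omega> x * (v x * (z \<bullet> G x) * d\<zeta> n x)"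
        by (auto simp: indicator_def)
    qed
    also have "\<dots> = (\<integral>x. indicator \<Omega> x * s n x \<partial>lborel) + (\<integral>x. indicator \<Omega> x * R n x \<partial>lborel)
       + (\<integral>x. indicator \<Omega> x * (v x * (z \<bullet> G x) * d\<zeta> n x) \<partial>lborel)"
      using integrable_\<Omega>(1)[OF _ sB] integrable_\<Omega>(1)[OF _ RB] integrable_\<Omega>(1)[OF _ tB] by simp
    also have "(\<integral>x. indicator \<Omega> x * (v x * (z \<bullet> G x) * d\<zeta> n x) \<partial>lborel) = - (\<integral>x. indicator \<Omega> x * (\<zeta> n x * flux_derivative z x) \<partial>lborel)"
      unfolding d\<zeta>_def \<zeta>_def by (rule integration_by_parts[OF _ z]) simp
    finally show ?thesis by simp
  qed
  have l1: "(\<lambda>n. \<integral>x. indicator \<Omega> x * s n x \<partial>lborel) \<longlonglongrightarrow> form_at u v z"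
    unfolding form_at_def
  proof (rule integral_dominated_convergence[where w="\<lambda>x. indicator \<Omega> x * (1 * (C * C))"])
    show "AE x in lborel. (\<lambda>n. indicator \<Omega> x * s n x) \<longlonglongrightarrow> indicator \<Omega> x * (diff_quot u z x * diff_quot v z x)"
    proof (rule AE_I2)
      fix x
      show "(\<lambda>n. indicator \<Omega> x * s n x) \<longlonglongrightarrow> indicator \<Omega> x * (diff_quot u z x * diff_quot v z x)"
      proof (cases "x \<in> \<Omega>")
        case True
        have "(\<lambda>n. indicator \<Omega> x * (\<zeta> n x * (diff_quot u z x * diff_quot v z x))) \<longlonglongrightarrow> indicator \<Omega> x * (1 * (diff_quot u z x * diff_quot v z x))"
          by (intro tendsto_intros \<zeta>lim[OF True])
        then show ?thesis by (simp add: s_def)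
      qed simp
    qed
  qed (use sB intc in \<open>auto simp: indicator_def\<close>)
  have l2: "(\<lambda>n. \<integral>x. indicator \<Omega> x * R n x \<partial>lborel) \<longlonglongrightarrow> (\<integral>x. 0 \<partial>(lborel :: 'a measure))"
  proof (rule integral_dominated_convergence[where w="\<lambda>x. indicator \<Omega> x * (C * C * B + 2 * C\<^sup>2 * B)"])
    show "AE x in lborel. (\<lambda>n. indicator \<Omega> x * R n x) \<longlonglongrightarrow> 0"
    proof (rule AE_I2)
      fix x
      show "(\<lambda>n. indicator \<Omega> x * R n x) \<longlonglongrightarrow> 0"
      proof (cases "x \<in> \<Omega>")
        case True
        have "filterlim (\<lambda>n. real n * h x) at_top sequentially"
          by (rule filterlim_at_top_mult_tendsto_pos[OF tendsto_const hpos[OF True] filterlim_real_sequentially])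
        then have "\<forall>\<^sub>F n in sequentially. real n * h x > 3" by (simp add: filterlim_at_top_dense)
        then have "\<forall>\<^sub>F n in sequentially. indicator \<Omega> x * R n x = 0" by eventually_elim (simp add: Rfar[OF True])
        then show ?thesis by (rule tendsto_eventually)
      qed simp
    qed
  qed (use RB intc in \<open>auto simp: indicator_def\<close>)
  have l3: "(\<lambda>n. \<integral>x. indicator \<Omega> x * (\<zeta> n x * flux_derivative z x) \<partial>lborel) \<longlonglongrightarrow> (\<integral>x. indicator \<Omega> x * flux_derivative z x \<partial>lborel)"
  proof (rule integral_dominated_convergence[where w="\<lambda>x. indicator \<Omega> x * (1 * (2 * C\<^sup>2))"])
    show "AE x in lborel. (\<lambda>n. indicator \<Omega> x * (\<zeta> n x * flux_derivative z x)) \<longlonglongrightarrow> indicator \<Omega> x * flux_derivative z x"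
    proof (rule AE_I2)
      fix x
      show "(\<lambda>n. indicator \<Omega> x * (\<zeta> n x * flux_derivative z x)) \<longlonglongrightarrow> indicator \<Omega> x * flux_derivative z x"
      proof (cases "x \<in> \<Omega>")
        case True
        have "(\<lambda>n. indicator \<Omega> x * (\<zeta> n x * flux_derivative z x)) \<longlonglongrightarrow> indicator \<Omega> x * (1 * flux_derivative z x)"
          by (intro tendsto_intros \<zeta>lim[OF True])
        then show ?thesis by simp
      qed simp
    qed
    show "AE x in lborel. norm (indicator \<Omega> x * (\<zeta> n x * flux_derivative z x)) \<le> indicator \<Omega> x * (1 * (2 * C\<^sup>2))" for n
    proof (rule AE_I2)
      fix x
      have "\<bar>\<zeta> n x\<bar> * \<bar>flux_derivative z x\<bar> \<le> 1 * (2 * C\<^sup>2)" if "x \<in> \<Omega>"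
        using flux_derivative_bound[OF that z] \<zeta>01[of n x] by (intro mult_mono) auto
      then show "norm (indicator \<Omega> x * (\<zeta> n x * flux_derivative z x)) \<le> indicator \<Omega> x * (1 * (2 * C\<^sup>2))"
        by (auto simp: indicator_def abs_mult)
    qed
  qed (use intc in auto)
  have "(\<lambda>n. form_at u (\<lambda>x. \<zeta> n x * v x) z) \<longlonglongrightarrow> form_at u v z + 0 - (\<integral>x. indicator \<Omega> x * flux_derivative z x \<partial>lborel)"
    unfolding form using l1 l2 l3 by (intro tendsto_intros) simp_all
  then show ?thesis by (simp add: \<zeta>_def)
qed

end

end

section \<open>From the kernel to the average over directions\<close>

locale nonlocal_kernel = nonlocal_setting \<Omega> h gh hh C \<kappa>
  for \<Omega> :: "'a::euclidean_space set" and h gh hh C \<kappa> +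
  fixes \<rho> :: "real \<Rightarrow> real"
  assumes \<rho>0: "r \<ge> 0 \<Longrightarrow> 0 \<le> \<rho> r" and \<rho>c: "continuous_on {0..} \<rho>" and \<rho>1: "r \<ge> 1 \<Longrightarrow> \<rho> r = 0"
begin

lemma \<rho>_bounded: "\<exists>M>0. \<forall>r\<ge>0. \<rho> r \<le> M"
proof -
  have "bounded (\<rho> ` {0..1})"
    by (intro compact_imp_bounded compact_continuous_image continuous_on_subset[OF \<rho>c]) auto
  then obtain M where M: "M > 0" "\<And>r. r \<in> {0..1} \<Longrightarrow> norm (\<rho> r) \<le> M" unfolding bounded_pos by auto
  have "\<rho> r \<le> M" if "r \<ge> 0" for r
  proof (cases "r \<le> 1")
    case True then show ?thesis using M(2)[of r] that by auto
  qed (use M \<rho>1 in auto)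
  then show ?thesis using M by blast
qed

lemma \<rho>_max_measurable: "(\<lambda>r. \<rho> (max 0 r)) \<in> borel_measurable borel"
  by (intro borel_measurable_continuous_onI continuous_on_compose2[OF \<rho>c] continuous_intros) auto

lemma \<rho>_norm_measurable [measurable]: "(\<lambda>z::'a. \<rho> (norm z)) \<in> borel_measurable borel"
  using measurable_compose[OF borel_measurable_norm \<rho>_max_measurable] by simp

text \<open>The half of the heterogeneous kernel that is scaled by \<open>h x\<close>. It vanishes unless \<open>x\<close> and \<open>y\<close> are
  both in \<open>\<Omega>\<close>.\<close>

definition K :: "'a \<Rightarrow> 'a \<Rightarrow> real" where
  "K x y = indicator \<Omega> x * (1 / h x powr (real DIM('a) + 2) * \<rho> (norm (y - x) / h x))"

lemma K_measurable [measurable]: "(\<lambda>p. K (fst p) (snd p)) \<in> borel_measurable (borel \<Otimes>\<^sub>M borel)"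
  "(\<lambda>p. K (snd p) (fst p)) \<in> borel_measurable (borel \<Otimes>\<^sub>M borel)" "(\<lambda>y. K x y) \<in> borel_measurable borel"
proof -
  have eq: "\<rho> (norm (y - x) / h x) = \<rho> (max 0 (norm (y - x) / h x))" for x y
    using scale_nonneg[of x] by simp
  note [measurable] = \<rho>_max_measurable
  show "(\<lambda>p. K (fst p) (snd p)) \<in> borel_measurable (borel \<Otimes>\<^sub>M borel)"
    "(\<lambda>p. K (snd p) (fst p)) \<in> borel_measurable (borel \<Otimes>\<^sub>M borel)" "(\<lambda>y. K x y) \<in> borel_measurable borel"
    unfolding K_def eq by measurable
qed

lemma K_nonneg: "K x y \<ge> 0"
  unfolding K_def using scale_nonneg[of x] \<rho>0 by (intro mult_nonneg_nonneg) auto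

lemma K_outside: "y \<notin> \<Omega> \<Longrightarrow> K x y = 0"
proof -
  assume y: "y \<notin> \<Omega>"
  show "K x y = 0"
  proof (cases "x \<in> \<Omega>")
    case True
    have "y \<notin> cball x (h x)" using cball_inside[OF True hdist[OF True]] y by blast
    then have "norm (y - x) / h x \<ge> 1" using hpos[OF True] by (simp add: dist_norm norm_minus_commute)
    then show ?thesis using \<rho>1 by (simp add: K_def)
  qed (simp add: K_def)
qed

lemma het_kernel_eq_K: "indicator \<Omega> x * (indicator \<Omega> y * het_kernel \<rho> h 2 x y) = 1/2 * (K x y + K y x)"
proof (cases "x \<in> \<Omega> \<and> y \<in> \<Omega>")
  case True
  then show ?thesis by (simp add: het_kernel_def K_def norm_minus_commute)
next
  case False
  then have "K x y = 0" "K y x = 0" using K_outside[of y x] K_outside[of x y] by (auto simp: K_def)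
  then show ?thesis using False by auto
qed

lemma nn_integral_K:
  assumes x: "x \<in> \<Omega>" and [measurable]: "f \<in> borel_measurable borel"
  shows "(\<integral>\<^sup>+y. ennreal (K x y) * f y \<partial>lborel) = (\<integral>\<^sup>+z. ennreal (\<rho> (norm z) / (h x)\<^sup>2) * f (x + h x *\<^sub>R z) \<partial>lborel)"
proof -
  have hp: "h x > 0" by (rule hpos[OF x])
  have "(\<integral>\<^sup>+y. ennreal (K x y) * f y \<partial>lborel)
      = (\<integral>\<^sup>+y. ennreal (K x y) * f y \<partial>(density (distr lborel borel (\<lambda>z. x + h x *\<^sub>R z)) (\<lambda>_. ennreal (\<bar>h x\<bar> ^ DIM('a)))))"
    using lborel_affine[of "h x" x] hp by simp
  also have "\<dots> = (\<integral>\<^sup>+z. ennreal (\<bar>h x\<bar> ^ DIM('a)) * (ennreal (K x (x + h x *\<^sub>R z)) * f (x + h x *\<^sub>R z)) \<partial>lborel)"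
    by (subst nn_integral_density, simp, simp, subst nn_integral_distr) auto
  also have "\<dots> = (\<integral>\<^sup>+z. ennreal (\<rho> (norm z) / (h x)\<^sup>2) * f (x + h x *\<^sub>R z) \<partial>lborel)"
  proof (rule nn_integral_cong)
    fix z
    have "real DIM('a) + 2 = real (DIM('a) + 2)" by simp
    then have "h x powr (real DIM('a) + 2) = h x ^ (DIM('a) + 2)" using powr_realpow[OF hp] by metis
    then have p: "h x powr (real DIM('a) + 2) = h x ^ DIM('a) * (h x)\<^sup>2" by (simp add: power_add power2_eq_square)
    have "\<bar>h x\<bar> ^ DIM('a) * K x (x + h x *\<^sub>R z) = \<rho> (norm z) / (h x)\<^sup>2"
      using hp x unfolding K_def p by simp
    then have "ennreal (\<bar>h x\<bar> ^ DIM('a)) * ennreal (K x (x + h x *\<^sub>R z)) = ennreal (\<rho> (norm z) / (h x)\<^sup>2)"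
      by (metis K_nonneg ennreal_mult'' )
    then show "ennreal (\<bar>h x\<bar> ^ DIM('a)) * (ennreal (K x (x + h x *\<^sub>R z)) * f (x + h x *\<^sub>R z))
      = ennreal (\<rho> (norm z) / (h x)\<^sup>2) * f (x + h x *\<^sub>R z)" by (simp add: mult.assoc[symmetric])
  qed
  finally show ?thesis .
qed

text \<open>The substitution \<open>y = x + h x z\<close> as an identity of measures, so that it applies to signed
  integrands once they are integrable.\<close>

lemma pair_transport:
  "density (lborel \<Otimes>\<^sub>M lborel) (\<lambda>p. ennreal (K (fst p) (snd p)))
    = distr (density (lborel \<Otimes>\<^sub>M lborel) (\<lambda>p. ennreal (indicator \<Omega> (fst p) * (\<rho> (norm (snd p)) / (h (fst p))\<^sup>2))))
        (borel \<Otimes>\<^sub>M borel) (\<lambda>p. (fst p, fst p + h (fst p) *\<^sub>R snd p))"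
  (is "?P = distr ?Q _ ?m")
proof (rule measure_eqI)
  show s: "sets ?P = sets (distr ?Q (borel \<Otimes>\<^sub>M borel) ?m)" by (simp cong: sets_pair_measure_cong)
  fix A assume "A \<in> sets ?P"
  then have [measurable]: "A \<in> sets (borel \<Otimes>\<^sub>M borel)" using s by simp
  have "emeasure ?P A = (\<integral>\<^sup>+p. ennreal (K (fst p) (snd p)) * indicator A p \<partial>(lborel \<Otimes>\<^sub>M lborel))"
    by (rule emeasure_density) auto
  also have "\<dots> = (\<integral>\<^sup>+x. \<integral>\<^sup>+y. ennreal (K x y) * indicator A (x, y) \<partial>lborel \<partial>lborel)"
    by (subst lborel.nn_integral_fst[symmetric]) auto
  also have "\<dots> = (\<integral>\<^sup>+x. \<integral>\<^sup>+z. ennreal (indicator \<Omega> x * (\<rho> (norm z) / (h x)\<^sup>2)) * indicator A (x, x + h x *\<^sub>R z) \<partial>lborel \<partial>lborel)"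
  proof (rule nn_integral_cong)
    fix x
    show "(\<integral>\<^sup>+y. ennreal (K x y) * indicator A (x, y) \<partial>lborel)
      = (\<integral>\<^sup>+z. ennreal (indicator \<Omega> x * (\<rho> (norm z) / (h x)\<^sup>2)) * indicator A (x, x + h x *\<^sub>R z) \<partial>lborel)"
    proof (cases "x \<in> \<Omega>")
      case True
      then show ?thesis by (subst nn_integral_K) auto
    qed (simp add: K_def)
  qed
  also have "\<dots> = (\<integral>\<^sup>+p. ennreal (indicator \<Omega> (fst p) * (\<rho> (norm (snd p)) / (h (fst p))\<^sup>2)) * indicator A (?m p) \<partial>(lborel \<Otimes>\<^sub>M lborel))"
    by (subst lborel.nn_integral_fst[symmetric]) auto
  also have "\<dots> = (\<integral>\<^sup>+p. indicator A (?m p) \<partial>?Q)"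
    by (subst nn_integral_density) auto
  also have "\<dots> = (\<integral>\<^sup>+p. indicator A p \<partial>(distr ?Q (borel \<Otimes>\<^sub>M borel) ?m))"
    by (subst nn_integral_distr) auto
  also have "\<dots> = emeasure (distr ?Q (borel \<Otimes>\<^sub>M borel) ?m) A" by simp
  finally show "emeasure ?P A = emeasure (distr ?Q (borel \<Otimes>\<^sub>M borel) ?m) A" .
qed

text \<open>The condition \<open>|W| \<le> B h\<^sup>2\<close> compensates the factor \<open>h\<^sup>-\<^sup>2\<close> that is left of the kernel after the
  substitution, and gives absolute convergence on the bounded set of pairs \<open>(x, z)\<close>.\<close>

lemma kernel_integral:
  fixes W :: "'a \<Rightarrow> 'a \<Rightarrow> real"
  assumes W[measurable]: "(\<lambda>p. W (fst p) (snd p)) \<in> borel_measurable (borel \<Otimes>\<^sub>M borel)"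
    and b: "\<And>x z. x \<in> \<Omega> \<Longrightarrow> norm z \<le> 1 \<Longrightarrow> \<bar>W x (x + h x *\<^sub>R z)\<bar> \<le> B * (h x)\<^sup>2" and B: "B \<ge> 0"
  shows "integrable (lborel \<Otimes>\<^sub>M lborel) (\<lambda>p. K (fst p) (snd p) * W (fst p) (snd p))"
    and "integrable lborel (\<lambda>z. \<rho> (norm z) * (\<integral>x. indicator \<Omega> x * (W x (x + h x *\<^sub>R z) / (h x)\<^sup>2) \<partial>lborel))"
    and "(\<integral>p. K (fst p) (snd p) * W (fst p) (snd p) \<partial>(lborel \<Otimes>\<^sub>M lborel))
      = (\<integral>z. \<rho> (norm z) * (\<integral>x. indicator \<Omega> x * (W x (x + h x *\<^sub>R z) / (h x)\<^sup>2) \<partial>lborel) \<partial>lborel)"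
proof -
  let ?m = "\<lambda>p::'a \<times> 'a. (fst p, fst p + h (fst p) *\<^sub>R snd p)"
  let ?k = "\<lambda>p::'a \<times> 'a. indicator \<Omega> (fst p) * (\<rho> (norm (snd p)) / (h (fst p))\<^sup>2)"
  let ?W = "\<lambda>p. W (fst p) (snd p)"
  let ?LL = "lborel \<Otimes>\<^sub>M lborel :: ('a \<times> 'a) measure"
  obtain M where M: "M > 0" "\<And>r. r \<ge> 0 \<Longrightarrow> \<rho> r \<le> M" using \<rho>_bounded by blast
  have k0: "?k p \<ge> 0" for p using \<rho>0 by (auto intro!: mult_nonneg_nonneg)
  define g where "g p = ?k p * W (fst p) (fst p + h (fst p) *\<^sub>R snd p)" for p
  have Wm [measurable]: "(\<lambda>p. W (fst p) (fst p + h (fst p) *\<^sub>R snd p)) \<in> borel_measurable (borel \<Otimes>\<^sub>M borel)"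
    using measurable_compose[of ?m "borel \<Otimes>\<^sub>M borel" "borel \<Otimes>\<^sub>M borel" ?W borel, OF _ W] by simp
  have gm [measurable]: "g \<in> borel_measurable (borel \<Otimes>\<^sub>M borel)" unfolding g_def by measurable
  have ig: "integrable ?LL g"
  proof -
    let ?A = "\<Omega> \<times> ball 0 1 :: ('a \<times> 'a) set"
    have [measurable]: "?A \<in> sets (borel \<Otimes>\<^sub>M borel)" by (intro pair_measureI \<Omega>_measurable borel_open open_ball)
    have "integrable ?LL (\<lambda>p. indicator ?A p *\<^sub>R g p)"
    proof (rule integrableI_bounded_set_indicator[where B="M * B"])
      show "?A \<in> sets ?LL" by (simp cong: sets_pair_measure_cong)
      show "g \<in> borel_measurable ?LL" using gm by (simp cong: measurable_cong_sets sets_pair_measure_cong)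
      have "bounded ?A" using bd bounded_Times bounded_ball by blast
      then show "emeasure ?LL ?A < \<infinity>" unfolding lborel_prod by (rule emeasure_bounded_finite)
      show "AE p in ?LL. p \<in> ?A \<longrightarrow> norm (g p) \<le> M * B"
      proof (intro AE_I2 impI)
        fix p assume "p \<in> ?A"
        then have x: "fst p \<in> \<Omega>" and z: "norm (snd p) \<le> 1" by auto
        have hp: "h (fst p) > 0" by (rule hpos[OF x])
        have "\<bar>g p\<bar> = \<rho> (norm (snd p)) * (\<bar>W (fst p) (fst p + h (fst p) *\<^sub>R snd p)\<bar> / (h (fst p))\<^sup>2)"
          using x hp \<rho>0[of "norm (snd p)"] by (simp add: g_def abs_mult)
        also have "\<dots> \<le> M * B"
          using M b[OF x z] hp \<rho>0[of "norm (snd p)"]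
          by (intro mult_mono) (auto simp: divide_le_eq)
        finally show "norm (g p) \<le> M * B" by simp
      qed
    qed
    moreover have "(\<lambda>p. indicator ?A p *\<^sub>R g p) = g"
    proof (rule ext)
      fix p show "indicator ?A p *\<^sub>R g p = g p"
        using \<rho>1[of "norm (snd p)"] by (cases p) (auto simp: g_def indicator_def not_less)
    qed
    ultimately show ?thesis by (simp only:)
  qed
  have Pm: "?W \<in> borel_measurable ?LL" "(\<lambda>p. K (fst p) (snd p)) \<in> borel_measurable ?LL" "?k \<in> borel_measurable ?LL"
    "(\<lambda>p. W (fst p) (fst p + h (fst p) *\<^sub>R snd p)) \<in> borel_measurable ?LL"
    by (simp_all cong: measurable_cong_sets sets_pair_measure_cong) 
  let ?P = "density ?LL (\<lambda>p. ennreal (K (fst p) (snd p)))" and ?Q = "density ?LL (\<lambda>p. ennreal (?k p))"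
  have mm: "?m \<in> ?Q \<rightarrow>\<^sub>M borel \<Otimes>\<^sub>M borel" by measurable
  have iQ: "integrable ?Q (\<lambda>p. ?W (?m p))"
    by (subst integrable_density) (use Pm k0 ig in \<open>auto simp: g_def[abs_def]\<close>)
  have iP: "integrable ?P ?W"
    unfolding pair_transport by (subst integrable_distr_eq[OF mm]) (use iQ in auto)
  then show 1: "integrable ?LL (\<lambda>p. K (fst p) (snd p) * W (fst p) (snd p))"
    by (subst (asm) integrable_density) (use Pm K_nonneg in auto)
  have "(\<integral>p. K (fst p) (snd p) * W (fst p) (snd p) \<partial>?LL) = (\<integral>p. ?W p \<partial>?P)"
    by (subst integral_density) (use Pm K_nonneg in auto)
  also have "\<dots> = (\<integral>p. ?W (?m p) \<partial>?Q)"
    unfolding pair_transport by (subst integral_distr[OF mm]) auto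
  also have "\<dots> = (\<integral>p. g p \<partial>?LL)"
    by (subst integral_density) (use Pm k0 in \<open>auto simp: g_def[abs_def]\<close>)
  also have "\<dots> = (\<integral>z. \<integral>x. g (x, z) \<partial>lborel \<partial>lborel)"
    using lborel_pair.integral_snd[of "\<lambda>x z. g (x, z)"] ig by simp
  finally have 2: "(\<integral>p. K (fst p) (snd p) * W (fst p) (snd p) \<partial>?LL) = (\<integral>z. \<integral>x. g (x, z) \<partial>lborel \<partial>lborel)" .
  have inner: "(\<integral>x. g (x, z) \<partial>lborel) = \<rho> (norm z) * (\<integral>x. indicator \<Omega> x * (W x (x + h x *\<^sub>R z) / (h x)\<^sup>2) \<partial>lborel)" for z
    by (subst integral_mult_right_zero[symmetric]) (auto intro!: Bochner_Integration.integral_cong simp: g_def)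
  show "(\<integral>p. K (fst p) (snd p) * W (fst p) (snd p) \<partial>?LL)
      = (\<integral>z. \<rho> (norm z) * (\<integral>x. indicator \<Omega> x * (W x (x + h x *\<^sub>R z) / (h x)\<^sup>2) \<partial>lborel) \<partial>lborel)"
    using 2 unfolding inner .
  have "integrable lborel (\<lambda>z. \<integral>x. g (x, z) \<partial>lborel)"
    using lborel_pair.integrable_snd[of "\<lambda>x z. g (x, z)"] ig by simp
  then show "integrable lborel (\<lambda>z. \<rho> (norm z) * (\<integral>x. indicator \<Omega> x * (W x (x + h x *\<^sub>R z) / (h x)\<^sup>2) \<partial>lborel))"
    unfolding inner .
qed

end

context nonlocal_kernel
begin

definition transported :: "('a \<Rightarrow> 'a \<Rightarrow> real) \<Rightarrow> 'a \<Rightarrow> real" where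
  "transported W z = (\<integral>x. indicator \<Omega> x * (W x (x + h x *\<^sub>R z) / (h x)\<^sup>2) \<partial>lborel)"

text \<open>The two halves of the kernel are exchanged by swapping \<open>x\<close> and \<open>y\<close>, so the half scaled by \<open>h y\<close> is
  treated as the other one with swapped arguments.\<close>

lemma kernel_double_integral:
  fixes W1 W2 :: "'a \<Rightarrow> 'a \<Rightarrow> real"
  assumes m1: "(\<lambda>p. W1 (fst p) (snd p)) \<in> borel_measurable (borel \<Otimes>\<^sub>M borel)"
    and m2: "(\<lambda>p. W2 (fst p) (snd p)) \<in> borel_measurable (borel \<Otimes>\<^sub>M borel)"
    and b1: "\<And>x z. x \<in> \<Omega> \<Longrightarrow> norm z \<le> 1 \<Longrightarrow> \<bar>W1 x (x + h x *\<^sub>R z)\<bar> \<le> B * (h x)\<^sup>2"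
    and b2: "\<And>x z. x \<in> \<Omega> \<Longrightarrow> norm z \<le> 1 \<Longrightarrow> \<bar>W2 x (x + h x *\<^sub>R z)\<bar> \<le> B * (h x)\<^sup>2" and B: "B \<ge> 0"
  shows "integrable lborel (\<lambda>x. \<integral>y. K x y * W1 x y + K y x * W2 y x \<partial>lborel)"
    and "(\<integral>x. \<integral>y. K x y * W1 x y + K y x * W2 y x \<partial>lborel \<partial>lborel)
      = (\<integral>z. \<rho> (norm z) * transported W1 z \<partial>lborel) + (\<integral>z. \<rho> (norm z) * transported W2 z \<partial>lborel)"
proof -
  let ?LL = "lborel \<Otimes>\<^sub>M lborel :: ('a \<times> 'a) measure"
  have k1: "integrable ?LL (\<lambda>p. K (fst p) (snd p) * W1 (fst p) (snd p))"
    "(\<integral>p. K (fst p) (snd p) * W1 (fst p) (snd p) \<partial>?LL) = (\<integral>z. \<rho> (norm z) * transported W1 z \<partial>lborel)"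
    unfolding transported_def by (rule kernel_integral[OF m1 b1 B]; assumption)+
  have k2: "integrable ?LL (\<lambda>p. K (fst p) (snd p) * W2 (fst p) (snd p))"
    "(\<integral>p. K (fst p) (snd p) * W2 (fst p) (snd p) \<partial>?LL) = (\<integral>z. \<rho> (norm z) * transported W2 z \<partial>lborel)"
    unfolding transported_def by (rule kernel_integral[OF m2 b2 B]; assumption)+
  let ?f2 = "\<lambda>p. K (fst p) (snd p) * W2 (fst p) (snd p)"
  have s: "integrable ?LL (\<lambda>p. K (snd p) (fst p) * W2 (snd p) (fst p))"
    using lborel_pair.integrable_product_swap[OF k2(1)] by (simp add: case_prod_unfold)
  have se: "(\<integral>p. K (snd p) (fst p) * W2 (snd p) (fst p) \<partial>?LL) = (\<integral>p. ?f2 p \<partial>?LL)"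
    using lborel_pair.integral_product_swap[of ?f2] k2(1) by (simp add: case_prod_unfold)
  have i: "integrable ?LL (\<lambda>p. K (fst p) (snd p) * W1 (fst p) (snd p) + K (snd p) (fst p) * W2 (snd p) (fst p))"
    using k1(1) s by (rule Bochner_Integration.integrable_add)
  show "integrable lborel (\<lambda>x. \<integral>y. K x y * W1 x y + K y x * W2 y x \<partial>lborel)"
    using lborel_pair.integrable_fst'[OF i] by simp
  have "(\<integral>x. \<integral>y. K x y * W1 x y + K y x * W2 y x \<partial>lborel \<partial>lborel)
     = (\<integral>p. K (fst p) (snd p) * W1 (fst p) (snd p) + K (snd p) (fst p) * W2 (snd p) (fst p) \<partial>?LL)"
    using lborel_pair.integral_fst'[OF i] by simp
  also have "\<dots> = (\<integral>p. K (fst p) (snd p) * W1 (fst p) (snd p) \<partial>?LL) + (\<integral>p. ?f2 p \<partial>?LL)"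
    by (simp only: Bochner_Integration.integral_add[OF k1(1) s] se)
  finally show "(\<integral>x. \<integral>y. K x y * W1 x y + K y x * W2 y x \<partial>lborel \<partial>lborel)
      = (\<integral>z. \<rho> (norm z) * transported W1 z \<partial>lborel) + (\<integral>z. \<rho> (norm z) * transported W2 z \<partial>lborel)"
    by (simp only: k1(2) k2(2))
qed

context
  fixes u G H
  assumes u: "C2_zero_ext \<Omega> u G H C"
begin

lemma nonlocal_op_eq:
  "indicator \<Omega> x * nonlocal_op \<Omega> \<rho> h u x = (\<integral>y. (K x y + K y x) * (u x - u y) \<partial>lborel)"
proof -
  have "indicator \<Omega> x * nonlocal_op \<Omega> \<rho> h u x
     = 2 * (\<integral>y. indicator \<Omega> x * (indicator \<Omega> y * (het_kernel \<rho> h 2 x y * (u x - u y))) \<partial>lborel)"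
    by (simp add: nonlocal_op_def set_lebesgue_integral_def)
  also have "\<dots> = 2 * (\<integral>y. 1/2 * ((K x y + K y x) * (u x - u y)) \<partial>lborel)"
  proof -
    have "indicator \<Omega> x * (indicator \<Omega> y * (het_kernel \<rho> h 2 x y * (u x - u y))) = 1/2 * ((K x y + K y x) * (u x - u y))" for y
      using het_kernel_eq_K[of x y] by (simp only: mult.assoc[symmetric])
    then show ?thesis by (simp only:)
  qed
  finally show ?thesis by simp
qed

lemma nonlocal_op_measurable: "(\<lambda>x. indicator \<Omega> x * nonlocal_op \<Omega> \<rho> h u x) \<in> borel_measurable borel"
proof -
  note [measurable] = zero_ext_measurable[OF u]
  have "(\<lambda>x. \<integral>y. (K x y + K y x) * (u x - u y) \<partial>lborel) \<in> borel_measurable lborel"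
    by (rule lborel.borel_measurable_lebesgue_integral) (simp add: case_prod_beta)
  then show ?thesis unfolding nonlocal_op_eq by simp
qed

text \<open>Where \<open>\<phi>\<close> is not zero, \<open>h\<close> is at least \<open>\<epsilon>\<close>, and by comparability of \<open>h\<close> along the transport
  also at least \<open>\<epsilon> / 2\<close> at the other point. Hence the singularity of the kernel is not met and the two
  summands \<open>(u x - u y) \<phi> x\<close> and \<open>(u y - u x) \<phi> y\<close> may be integrated separately.\<close>

lemma nonlocal_op_duality:
  assumes \<phi>[measurable]: "\<phi> \<in> borel_measurable borel" and \<phi>M: "\<And>x. \<bar>\<phi> x\<bar> \<le> M"
    and \<epsilon>: "\<epsilon> > 0" and van: "\<And>x. h x < \<epsilon> \<Longrightarrow> \<phi> x = 0"
  shows "integrable lborel (\<lambda>x. indicator \<Omega> x * nonlocal_op \<Omega> \<rho> h u x * \<phi> x)"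
    and "(\<integral>x. indicator \<Omega> x * nonlocal_op \<Omega> \<rho> h u x * \<phi> x \<partial>lborel) = (\<integral>z. \<rho> (norm z) * form_at u \<phi> z \<partial>lborel)"
proof -
  note [measurable] = zero_ext_measurable[OF u]
  have C0: "C > 0" by (rule scale_facts(1))
  have M0: "M \<ge> 0" using \<phi>M[of 0] by linarith
  define W1 where "W1 x y = (u x - u y) * \<phi> x" for x y
  define W2 where "W2 x y = (u y - u x) * \<phi> y" for x y
  define B where "B = 2 * C * M / (\<epsilon> / 2)\<^sup>2"
  have B0: "B \<ge> 0" using C0 M0 by (simp add: B_def)
  have uu: "\<bar>u x - u y\<bar> \<le> 2 * C" for x y
  proof -
    have "\<bar>u x\<bar> \<le> C" for x using zero_ext_facts(3,6)[OF u, of x] C0 by (cases "x \<in> \<Omega>") auto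
    from this[of x] this[of y] show ?thesis by linarith
  qed
  have large: "2 * C * M \<le> B * (h x)\<^sup>2" if "h x \<ge> \<epsilon> / 2" for x
  proof -
    have "(h x)\<^sup>2 \<ge> (\<epsilon> / 2)\<^sup>2" using that \<epsilon> by (intro power_mono) auto
    then have "B * (\<epsilon> / 2)\<^sup>2 \<le> B * (h x)\<^sup>2" using B0 by (rule mult_left_mono)
    then show ?thesis using \<epsilon> by (simp add: B_def)
  qed
  have b1: "\<bar>W1 x (x + h x *\<^sub>R z)\<bar> \<le> B * (h x)\<^sup>2" if x: "x \<in> \<Omega>" and z: "norm z \<le> 1" for x z
  proof (cases "h x < \<epsilon>")
    case False
    have "\<bar>W1 x (x + h x *\<^sub>R z)\<bar> \<le> 2 * C * M" unfolding W1_def abs_mult using uu \<phi>M C0 by (intro mult_mono) auto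
    then show ?thesis using large[of x] False \<epsilon> by linarith
  qed (use van B0 in \<open>simp add: W1_def\<close>)
  have b2: "\<bar>W2 x (x + h x *\<^sub>R z)\<bar> \<le> B * (h x)\<^sup>2" if x: "x \<in> \<Omega>" and z: "norm z \<le> 1" for x z
  proof (cases "h (x + h x *\<^sub>R z) < \<epsilon>")
    case False
    have "\<bar>W2 x (x + h x *\<^sub>R z)\<bar> \<le> 2 * C * M" unfolding W2_def abs_mult using uu \<phi>M C0 by (intro mult_mono) auto
    moreover have "h x \<ge> \<epsilon> / 2" using scale_comparable[OF x z] False \<epsilon> by linarith
    ultimately show ?thesis using large[of x] by linarith
  qed (use van B0 in \<open>simp add: W2_def\<close>)
  have m: "(\<lambda>p. W1 (fst p) (snd p)) \<in> borel_measurable (borel \<Otimes>\<^sub>M borel)"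
    "(\<lambda>p. W2 (fst p) (snd p)) \<in> borel_measurable (borel \<Otimes>\<^sub>M borel)"
    unfolding W1_def W2_def by measurable
  note kd = kernel_double_integral[OF m b1 b2 B0]
  have eq: "(\<integral>y. K x y * W1 x y + K y x * W2 y x \<partial>lborel) = indicator \<Omega> x * nonlocal_op \<Omega> \<rho> h u x * \<phi> x" for x
    unfolding nonlocal_op_eq
    by (subst integral_mult_left_zero[symmetric]) (intro Bochner_Integration.integral_cong refl, simp add: W1_def W2_def algebra_simps)
  show "integrable lborel (\<lambda>x. indicator \<Omega> x * nonlocal_op \<Omega> \<rho> h u x * \<phi> x)" using kd(1) unfolding eq .
  have iz: "integrable lborel (\<lambda>z. \<rho> (norm z) * transported W1 z)" "integrable lborel (\<lambda>z. \<rho> (norm z) * transported W2 z)"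
    using kernel_integral(2)[OF m(1) b1 B0] kernel_integral(2)[OF m(2) b2 B0] unfolding transported_def by auto
  have "\<rho> (norm z) * transported W1 z + \<rho> (norm z) * transported W2 z = \<rho> (norm z) * form_at u \<phi> z" for z
  proof (cases "norm z \<le> 1")
    case True
    have wi: "integrable lborel (\<lambda>x. indicator \<Omega> x * (W x (x + h x *\<^sub>R z) / (h x)\<^sup>2))"
      if mW: "(\<lambda>p. W (fst p) (snd p)) \<in> borel_measurable (borel \<Otimes>\<^sub>M borel)"
        and bW: "\<And>x. x \<in> \<Omega> \<Longrightarrow> \<bar>W x (x + h x *\<^sub>R z)\<bar> \<le> B * (h x)\<^sup>2" for W
    proof (rule integrable_\<Omega>(1)[where B=B])
      have [measurable]: "(\<lambda>x. W x (x + h x *\<^sub>R z)) \<in> borel_measurable borel"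
        using measurable_compose[of "\<lambda>x. (x, x + h x *\<^sub>R z)" borel "borel \<Otimes>\<^sub>M borel", OF _ mW] by simp
      show "(\<lambda>x. W x (x + h x *\<^sub>R z) / (h x)\<^sup>2) \<in> borel_measurable borel" by measurable
      show "\<bar>W x (x + h x *\<^sub>R z) / (h x)\<^sup>2\<bar> \<le> B" if "x \<in> \<Omega>" for x
        using bW[OF that] hpos[OF that] by (simp add: divide_le_eq)
    qed
    have "transported W1 z + transported W2 z
      = (\<integral>x. indicator \<Omega> x * (W1 x (x + h x *\<^sub>R z) / (h x)\<^sup>2) + indicator \<Omega> x * (W2 x (x + h x *\<^sub>R z) / (h x)\<^sup>2) \<partial>lborel)"
      unfolding transported_def
      by (rule Bochner_Integration.integral_add[symmetric]) (intro wi m b1 b2 True; assumption)+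
    also have "\<dots> = form_at u \<phi> z"
      unfolding form_at_def
      by (intro Bochner_Integration.integral_cong refl)
         (simp add: W1_def W2_def diff_quot_def power2_eq_square add_divide_distrib[symmetric] distrib_left[symmetric],
          simp add: algebra_simps)
    finally show ?thesis by (simp add: distrib_left[symmetric])
  qed (use \<rho>1[of "norm z"] in simp)
  then show "(\<integral>x. indicator \<Omega> x * nonlocal_op \<Omega> \<rho> h u x * \<phi> x \<partial>lborel) = (\<integral>z. \<rho> (norm z) * form_at u \<phi> z \<partial>lborel)"
    using kd(2) Bochner_Integration.integral_add[OF iz] unfolding eq by simp
qed

lemma nonlocal_form_eq:
  assumes v: "C2_zero_ext \<Omega> v Gv Hv C"
  shows "nonlocal_form \<Omega> \<rho> h u v = (\<integral>z. \<rho> (norm z) * form_at u v z \<partial>lborel)"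
    and "integrable lborel (\<lambda>z. \<rho> (norm z) * form_at u v z)"
proof -
  note [measurable] = zero_ext_measurable[OF u] zero_ext_measurable[OF v]
  define W where "W x y = 1/2 * ((u x - u y) * (v x - v y))" for x y
  have m: "(\<lambda>p. W (fst p) (snd p)) \<in> borel_measurable (borel \<Otimes>\<^sub>M borel)" unfolding W_def by measurable
  have Weq: "W x (x + h x *\<^sub>R z) / (h x)\<^sup>2 = 1/2 * (diff_quot u z x * diff_quot v z x)" for x z
    by (simp add: W_def diff_quot_def power2_eq_square algebra_simps)
  have C0: "C > 0" by (rule scale_facts(1))
  have b: "\<bar>W x (x + h x *\<^sub>R z)\<bar> \<le> C\<^sup>2 * (h x)\<^sup>2" if x: "x \<in> \<Omega>" and z: "norm z \<le> 1" for x z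
  proof -
    have "\<bar>diff_quot u z x * diff_quot v z x\<bar> \<le> C * C"
      unfolding abs_mult using diff_quot_bound[OF u x z] diff_quot_bound[OF v x z] C0 by (intro mult_mono) auto
    then have "\<bar>1/2 * (diff_quot u z x * diff_quot v z x)\<bar> \<le> C * C" by linarith
    then have "\<bar>W x (x + h x *\<^sub>R z) / (h x)\<^sup>2\<bar> \<le> C\<^sup>2" by (simp only: Weq power2_eq_square[of C])
    then show ?thesis using hpos[OF x] by (simp add: divide_le_eq)
  qed
  have T: "transported W z = 1/2 * form_at u v z" for z
    unfolding transported_def form_at_def Weq
    by (subst integral_mult_right_zero[symmetric]) (simp add: mult.left_commute)
  have "nonlocal_form \<Omega> \<rho> h u v = (\<integral>x. \<integral>y. K x y * W x y + K y x * W y x \<partial>lborel \<partial>lborel)"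
    unfolding nonlocal_form_def set_lebesgue_integral_def
  proof (intro Bochner_Integration.integral_cong refl)
    fix x
    have "indicator \<Omega> x *\<^sub>R (\<integral>y. indicator \<Omega> y *\<^sub>R (het_kernel \<rho> h 2 x y * (u x - u y) * (v x - v y)) \<partial>lborel)
      = (\<integral>y. indicator \<Omega> x * (indicator \<Omega> y * het_kernel \<rho> h 2 x y) * ((u x - u y) * (v x - v y)) \<partial>lborel)"
      by (simp add: mult.assoc)
    also have "\<dots> = (\<integral>y. K x y * W x y + K y x * W y x \<partial>lborel)"
      unfolding het_kernel_eq_K
      by (intro Bochner_Integration.integral_cong refl) (simp add: W_def algebra_simps)
    finally show "indicator \<Omega> x *\<^sub>R (\<integral>y. indicator \<Omega> y *\<^sub>R (het_kernel \<rho> h 2 x y * (u x - u y) * (v x - v y)) \<partial>lborel)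
      = (\<integral>y. K x y * W x y + K y x * W y x \<partial>lborel)" .
  qed
  also have "\<dots> = (\<integral>z. \<rho> (norm z) * transported W z \<partial>lborel) + (\<integral>z. \<rho> (norm z) * transported W z \<partial>lborel)"
    by (rule kernel_double_integral(2)[OF m m b b]) auto
  also have "\<dots> = (\<integral>z. \<rho> (norm z) * form_at u v z \<partial>lborel)"
    unfolding T by (simp add: mult.left_commute)
  finally show "nonlocal_form \<Omega> \<rho> h u v = (\<integral>z. \<rho> (norm z) * form_at u v z \<partial>lborel)" .
  have "integrable lborel (\<lambda>z. \<rho> (norm z) * transported W z)"
    using kernel_integral(2)[OF m b] unfolding transported_def by auto
  then have "integrable lborel (\<lambda>z. 2 * (\<rho> (norm z) * transported W z))" by simp
  then show "integrable lborel (\<lambda>z. \<rho> (norm z) * form_at u v z)" unfolding T by (simp add: mult.left_commute)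
qed

lemma \<rho>_integrable: "integrable lborel (\<lambda>z::'a. \<rho> (norm z))"
proof -
  obtain M where M: "M > 0" "\<And>r. r \<ge> 0 \<Longrightarrow> \<rho> r \<le> M" using \<rho>_bounded by blast
  show ?thesis
    by (rule integrable_bounded_support[where C=M and R=1]) (use M \<rho>0 \<rho>1 in auto)
qed

text \<open>Duality with the sign of the operator, restricted to \<open>{h \<ge> 1 / (n + 1)}\<close>, bounds the integral
  of its absolute value there; the bound does not depend on \<open>n\<close>.\<close>

lemma nonlocal_op_integrable: "integrable lborel (\<lambda>x. indicator \<Omega> x * nonlocal_op \<Omega> \<rho> h u x)"
proof -
  let ?L = "\<lambda>x. indicator \<Omega> x * nonlocal_op \<Omega> \<rho> h u x"
  note [measurable] = nonlocal_op_measurable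
  define D where "D = (3 * C + 3/2 * C\<^sup>2) * measure lborel \<Omega>"
  define I where "I = (\<integral>z. \<rho> (norm (z :: 'a)) * D \<partial>lborel)"
  define f where "f n x = (if h x \<ge> 1 / (real n + 1) then \<bar>?L x\<bar> else 0)" for n x
  have [measurable]: "f n \<in> borel_measurable borel" for n unfolding f_def by measurable
  have fI: "(\<integral>\<^sup>+x. ennreal (f n x) \<partial>lborel) \<le> ennreal I" for n
  proof -
    define \<phi> where "\<phi> x = (if h x \<ge> 1 / (real n + 1) then sgn (?L x) else 0)" for x
    have [measurable]: "\<phi> \<in> borel_measurable borel" unfolding \<phi>_def by measurable
    have \<phi>1: "\<bar>\<phi> x\<bar> \<le> 1" for x by (auto simp: \<phi>_def sgn_if)
    have e0: "1 / (real n + 1) > 0" by simp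
    have van: "h x < 1 / (real n + 1) \<Longrightarrow> \<phi> x = 0" for x by (simp add: \<phi>_def)
    note dual = nonlocal_op_duality[OF \<open>\<phi> \<in> _\<close> \<phi>1 e0 van]
    have eq: "?L x * \<phi> x = f n x" for x by (simp add: \<phi>_def f_def abs_sgn)
    have "(\<integral>x. f n x \<partial>lborel) = (\<integral>z. \<rho> (norm z) * form_at u \<phi> z \<partial>lborel)"
      using dual(2) unfolding eq .
    also have "\<dots> \<le> I"
    proof (cases "integrable lborel (\<lambda>z. \<rho> (norm z) * form_at u \<phi> z)")
      case True
      show ?thesis unfolding I_def
      proof (rule integral_mono[OF True])
        show "integrable lborel (\<lambda>z::'a. \<rho> (norm z) * D)" using \<rho>_integrable by simp
        fix z :: 'a
        show "\<rho> (norm z) * form_at u \<phi> z \<le> \<rho> (norm z) * D"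
        proof (cases "norm z \<le> 1")
          case True
          have "\<bar>form_at u \<phi> z\<bar> \<le> D"
            using form_at_bound[OF u True \<open>\<phi> \<in> _\<close> \<phi>1 e0 van] by (simp add: D_def)
          then show ?thesis using \<rho>0[of "norm z"] by (intro mult_left_mono) auto
        qed (use \<rho>1[of "norm z"] in simp)
      qed
    next
      case False
      have "I \<ge> 0" unfolding I_def D_def using \<rho>0 scale_facts(1)
        by (intro integral_nonneg_AE AE_I2 mult_nonneg_nonneg add_nonneg_nonneg) auto
      then show ?thesis using not_integrable_integral_eq[OF False] by simp
    qed
    finally have "(\<integral>x. f n x \<partial>lborel) \<le> I" .
    moreover have "(\<integral>\<^sup>+x. ennreal (f n x) \<partial>lborel) = ennreal (\<integral>x. f n x \<partial>lborel)"
      using dual(1) unfolding eq by (intro nn_integral_eq_integral) (auto simp: f_def)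
    ultimately show ?thesis by (simp add: ennreal_leI)
  qed
  have "(\<integral>\<^sup>+x. ennreal \<bar>?L x\<bar> \<partial>lborel) \<le> ennreal I"
  proof (rule LIMSEQ_le_const2[OF nn_integral_LIMSEQ])
    show "incseq (\<lambda>n x. ennreal (f n x))"
    proof (intro incseq_SucI le_funI ennreal_leI)
      fix n x
      have "1 / (real (Suc n) + 1) \<le> 1 / (real n + 1)" by (intro divide_left_mono) auto
      then show "f n x \<le> f (Suc n) x" by (auto simp: f_def)
    qed
    show "(\<lambda>n. ennreal (f n x)) \<longlonglongrightarrow> ennreal \<bar>?L x\<bar>" for x
    proof (cases "x \<in> \<Omega>")
      case True
      have "(\<lambda>n. 1 / (real n + 1)) \<longlonglongrightarrow> 0" using LIMSEQ_inverse_real_of_nat by (simp add: inverse_eq_divide add.commute)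
      then have "\<forall>\<^sub>F n in sequentially. 1 / (real n + 1) < h x" using hpos[OF True] by (rule order_tendstoD)
      then have "\<forall>\<^sub>F n in sequentially. ennreal (f n x) = ennreal \<bar>?L x\<bar>" by eventually_elim (simp add: f_def)
      then show ?thesis by (rule tendsto_eventually)
    next
      case False
      then have "f n x = 0" for n by (simp add: f_def)
      then show ?thesis using False by simp
    qed
  qed (use fI in auto)
  then have "(\<integral>\<^sup>+x. ennreal \<bar>?L x\<bar> \<partial>lborel) < \<infinity>" by (rule le_less_trans) simp
  moreover have "?L \<in> borel_measurable lborel" using nonlocal_op_measurable by (subst measurable_lborel2)
  ultimately show ?thesis unfolding integrable_iff_bounded real_norm_def by blast
qed

text \<open>Passing to the limit in the duality with \<open>\<phi> n = cutoff (n h) v\<close>: dominated convergence holds on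
  the left since the operator is integrable, and on the right by the uniform bound on the forms.\<close>

lemma green_flux_identity:
  assumes v: "C2_zero_ext \<Omega> v Gv Hv C"
  shows "nonlocal_form \<Omega> \<rho> h u v = (\<integral>x. indicator \<Omega> x * nonlocal_op \<Omega> \<rho> h u x * v x \<partial>lborel)
    + (\<integral>z. \<rho> (norm z) * (\<integral>x. indicator \<Omega> x * flux_derivative G H v Gv z x \<partial>lborel) \<partial>lborel)"
proof -
  note [measurable] = zero_ext_measurable[OF u] zero_ext_measurable[OF v]
  have C0: "C > 0" by (rule scale_facts(1))
  let ?L = "\<lambda>x. indicator \<Omega> x * nonlocal_op \<Omega> \<rho> h u x"
  let ?d = "\<lambda>z. \<integral>x. indicator \<Omega> x * flux_derivative G H v Gv z x \<partial>lborel"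
  have Li: "integrable lborel ?L" by (rule nonlocal_op_integrable)
  have vC: "\<bar>v x\<bar> \<le> C" for x using zero_ext_facts(3,6)[OF v, of x] C0 by (cases "x \<in> \<Omega>") auto
  define \<phi> where "\<phi> n x = cutoff (real n * h x) * v x" for n x
  have [measurable]: "\<phi> n \<in> borel_measurable borel" for n unfolding \<phi>_def by measurable
  have \<phi>C: "\<bar>\<phi> n x\<bar> \<le> C" for n x
  proof -
    have "\<bar>cutoff (real n * h x)\<bar> * \<bar>v x\<bar> \<le> 1 * C" using cutoff_bounds[of "real n * h x"] vC by (intro mult_mono) auto
    then show ?thesis by (simp add: \<phi>_def abs_mult)
  qed
  have van: "h x < 1 / (real n + 1) \<Longrightarrow> \<phi> n x = 0" for n x
  proof -
    assume "h x < 1 / (real n + 1)"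
    then have "h x * (real n + 1) < 1" by (simp add: less_divide_eq)
    then have "real n * h x \<le> 1" using scale_nonneg[of x] by (simp add: algebra_simps)
    then show "\<phi> n x = 0" by (simp add: \<phi>_def cutoff_low)
  qed
  have e0: "1 / (real n + 1) > 0" for n by simp
  note dual = nonlocal_op_duality(2)[OF _ \<phi>C e0 van]
  define D where "D = C * (3 * C + 3/2 * C\<^sup>2) * measure lborel \<Omega>"
  have fb: "\<bar>\<rho> (norm z) * form_at u (\<phi> n) z\<bar> \<le> \<rho> (norm z) * D" for n z
  proof (cases "norm z \<le> 1")
    case True
    have "\<bar>form_at u (\<phi> n) z\<bar> \<le> D"
      using form_at_bound[OF u True _ \<phi>C e0 van] by (simp add: D_def)
    then show ?thesis using \<rho>0[of "norm z"] by (simp add: abs_mult mult_left_mono)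
  qed (use \<rho>1[of "norm z"] in simp)
  have lim: "(\<lambda>n. \<rho> (norm z) * form_at u (\<phi> n) z) \<longlonglongrightarrow> \<rho> (norm z) * (form_at u v z - ?d z)" for z
  proof (cases "norm z \<le> 1")
    case True
    show ?thesis unfolding \<phi>_def by (intro tendsto_mult tendsto_const form_at_cutoff_limit[OF u v True])
  qed (use \<rho>1[of "norm z"] in simp)
  have fm: "(\<lambda>z. form_at u (\<phi> n) z) \<in> borel_measurable lborel" for n
    unfolding form_at_def
  proof (rule lborel.borel_measurable_lebesgue_integral)
    have [measurable]: "(\<lambda>p. diff_quot f (fst p) (snd p)) \<in> borel_measurable (borel \<Otimes>\<^sub>M borel)"
      if [measurable]: "f \<in> borel_measurable borel" for f unfolding diff_quot_def by measurable
    show "(\<lambda>(z, x). indicator \<Omega> x * (diff_quot u z x * diff_quot (\<phi> n) z x)) \<in> borel_measurable (lborel \<Otimes>\<^sub>M lborel)"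
      by (simp add: case_prod_beta)
  qed
  have l1: "(\<lambda>n. \<integral>z. \<rho> (norm z) * form_at u (\<phi> n) z \<partial>lborel) \<longlonglongrightarrow> (\<integral>z. \<rho> (norm z) * (form_at u v z - ?d z) \<partial>lborel)"
  proof (rule integral_dominated_convergence[where w="\<lambda>z. \<rho> (norm z) * D"])
    show "(\<lambda>z. \<rho> (norm z) * form_at u (\<phi> n) z) \<in> borel_measurable lborel" for n using fm by simp
    then show "(\<lambda>z. \<rho> (norm z) * (form_at u v z - ?d z)) \<in> borel_measurable lborel"
      by (rule borel_measurable_LIMSEQ_metric) (rule lim)
    show "integrable lborel (\<lambda>z::'a. \<rho> (norm z) * D)" using \<rho>_integrable by simp
  qed (use lim fb in auto)
  have l2: "(\<lambda>n. \<integral>x. ?L x * \<phi> n x \<partial>lborel) \<longlonglongrightarrow> (\<integral>x. ?L x * v x \<partial>lborel)"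
  proof (rule integral_dominated_convergence[where w="\<lambda>x. C * \<bar>?L x\<bar>"])
    show "integrable lborel (\<lambda>x. C * \<bar>?L x\<bar>)" using Li by (intro integrable_mult_right integrable_abs)
    show "(\<lambda>x. ?L x * v x) \<in> borel_measurable lborel" "(\<lambda>x. ?L x * \<phi> n x) \<in> borel_measurable lborel" for n
      using nonlocal_op_measurable by simp_all
    show "AE x in lborel. norm (?L x * \<phi> n x) \<le> C * \<bar>?L x\<bar>" for n
    proof (rule AE_I2)
      fix x
      have "\<bar>?L x\<bar> * \<bar>\<phi> n x\<bar> \<le> \<bar>?L x\<bar> * C" using \<phi>C by (intro mult_left_mono) auto
      then show "norm (?L x * \<phi> n x) \<le> C * \<bar>?L x\<bar>" by (simp add: abs_mult mult.commute)
    qed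
    show "AE x in lborel. (\<lambda>n. ?L x * \<phi> n x) \<longlonglongrightarrow> ?L x * v x"
    proof (rule AE_I2)
      fix x
      show "(\<lambda>n. ?L x * \<phi> n x) \<longlonglongrightarrow> ?L x * v x"
      proof (cases "x \<in> \<Omega>")
        case True
        have "filterlim (\<lambda>n. real n * h x) at_top sequentially"
          by (rule filterlim_at_top_mult_tendsto_pos[OF tendsto_const hpos[OF True] filterlim_real_sequentially])
        then have "\<forall>\<^sub>F n in sequentially. real n * h x \<ge> 2" by (simp add: filterlim_at_top)
        then have "\<forall>\<^sub>F n in sequentially. ?L x * \<phi> n x = ?L x * v x"
          by eventually_elim (simp add: \<phi>_def cutoff_high)
        then show ?thesis by (rule tendsto_eventually)
      qed simp
    qed
  qed
  have "(\<integral>x. ?L x * \<phi> n x \<partial>lborel) = (\<integral>z. \<rho> (norm z) * form_at u (\<phi> n) z \<partial>lborel)" for n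
    using dual by simp
  from l2[unfolded this] l1 have main: "(\<integral>x. ?L x * v x \<partial>lborel) = (\<integral>z. \<rho> (norm z) * (form_at u v z - ?d z) \<partial>lborel)"
    by (rule LIMSEQ_unique)
  have i1: "integrable lborel (\<lambda>z. \<rho> (norm z) * form_at u v z)" by (rule nonlocal_form_eq(2)[OF v])
  have i2: "integrable lborel (\<lambda>z. \<rho> (norm z) * (form_at u v z - ?d z))"
  proof (rule integrable_dominated_convergence[where w="\<lambda>z. \<rho> (norm z) * D" and s="\<lambda>n z. \<rho> (norm z) * form_at u (\<phi> n) z"])
    show "(\<lambda>z. \<rho> (norm z) * form_at u (\<phi> n) z) \<in> borel_measurable lborel" for n using fm by simp
    then show "(\<lambda>z. \<rho> (norm z) * (form_at u v z - ?d z)) \<in> borel_measurable lborel"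
      by (rule borel_measurable_LIMSEQ_metric) (rule lim)
    show "integrable lborel (\<lambda>z::'a. \<rho> (norm z) * D)" using \<rho>_integrable by simp
  qed (use lim fb in auto)
  have "(\<integral>z. \<rho> (norm z) * form_at u v z \<partial>lborel) - (\<integral>z. \<rho> (norm z) * (form_at u v z - ?d z) \<partial>lborel)
     = (\<integral>z. \<rho> (norm z) * ?d z \<partial>lborel)"
    unfolding Bochner_Integration.integral_diff[OF i1 i2, symmetric] by (simp add: algebra_simps)
  then show ?thesis using main nonlocal_form_eq(1)[OF v] by simp
qed

end

end

section \<open>Isotropy and the Green formula\<close>

text \<open>On each line in direction \<open>a\<close> the reflection in the hyperplane orthogonal to \<open>a\<close> is a
  reflection of the parameter.\<close>

lemma integral_reflection:
  fixes f :: "'a::euclidean_space \<Rightarrow> real"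
  assumes a: "a \<noteq> 0" and f[measurable]: "f \<in> borel_measurable borel"
  shows "(\<integral>x. f (x - (2 * (x \<bullet> a) / (a \<bullet> a)) *\<^sub>R a) \<partial>lborel) = (\<integral>x. f x \<partial>lborel)"
proof -
  let ?R = "\<lambda>x. x - (2 * (x \<bullet> a) / (a \<bullet> a)) *\<^sub>R a"
  have aa: "a \<bullet> a > 0" using a by simp
  have "lborel = distr lborel borel ?R"
  proof (rule measure_eqI)
    fix A :: "'a set" assume "A \<in> sets lborel"
    then have [measurable]: "A \<in> sets borel" by simp
    have line: "(\<integral>\<^sup>+t. indicator A (?R (x + t *\<^sub>R a)) \<partial>lborel) = (\<integral>\<^sup>+t. indicator A (x + t *\<^sub>R a) \<partial>lborel)" for x
    proof -
      let ?c = "- (2 * (x \<bullet> a) / (a \<bullet> a))"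
      have "?R (x + t *\<^sub>R a) = x + (?c + (-1) * t) *\<^sub>R a" for t
      proof -
        have c: "2 * ((x + t *\<^sub>R a) \<bullet> a) / (a \<bullet> a) = 2 * (x \<bullet> a) / (a \<bullet> a) + 2 * t"
          using aa by (simp add: inner_add_left distrib_left add_divide_distrib)
        have e: "x + t *\<^sub>R a - (c + 2 * t) *\<^sub>R a = x + (- c + (-1) * t) *\<^sub>R a" for c
        proof -
          have "(c + 2 * t) *\<^sub>R a = c *\<^sub>R a + t *\<^sub>R a + t *\<^sub>R a"
            by (metis scaleR_add_left add.assoc mult_2)
          then show ?thesis by (simp add: scaleR_diff_left)
        qed
        show ?thesis unfolding c by (rule e)
      qed
      then have "(\<integral>\<^sup>+t. indicator A (?R (x + t *\<^sub>R a)) \<partial>lborel)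
          = (\<integral>\<^sup>+t. indicator A (x + (?c + (-1) * t) *\<^sub>R a) \<partial>lborel)" by (simp only:)
      also have "\<dots> = (\<integral>\<^sup>+t. indicator A (x + t *\<^sub>R a) \<partial>lborel)"
        using nn_integral_real_affine[of "\<lambda>t. indicator A (x + t *\<^sub>R a)" "-1" ?c] by simp
      finally show ?thesis .
    qed
    have "emeasure (distr lborel borel ?R) A = (\<integral>\<^sup>+x. indicator A (?R x) \<partial>lborel)"
      by (subst nn_integral_indicator[symmetric], simp, subst nn_integral_distr) auto
    also have "\<dots> = (\<integral>\<^sup>+x. indicator A x \<partial>lborel)"
      by (subst (1 2) nn_integral_slab[OF a]) (simp_all add: nn_integral_cmult line)
    finally show "emeasure lborel A = emeasure (distr lborel borel ?R) A" by simp
  qed simp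
  then have "(\<integral>x. f x \<partial>lborel) = (\<integral>x. f x \<partial>(distr lborel borel ?R))" by simp
  also have "\<dots> = (\<integral>x. f (?R x) \<partial>lborel)" by (subst integral_distr) auto
  finally show ?thesis by simp
qed

lemma norm_reflection:
  fixes a :: "'a::euclidean_space"
  assumes "a \<noteq> 0" shows "norm (x - (2 * (x \<bullet> a) / (a \<bullet> a)) *\<^sub>R a) = norm x"
proof -
  have "a \<bullet> a \<noteq> 0" using assms by simp
  then have "(x - (2 * (x \<bullet> a) / (a \<bullet> a)) *\<^sub>R a) \<bullet> (x - (2 * (x \<bullet> a) / (a \<bullet> a)) *\<^sub>R a) = x \<bullet> x"
    by (simp add: inner_diff_left inner_diff_right inner_commute[of a x] field_simps)
  then show ?thesis by (simp add: norm_eq_sqrt_inner)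
qed

context nonlocal_kernel
begin

text \<open>The reflection in direction \<open>i\<close> changes the sign of the mixed moments, and the one in direction
  \<open>i - j\<close> exchanges the two coordinates, so all diagonal moments are equal; the normalization
  says that their sum is the dimension.\<close>

lemma second_moments:
  assumes norm: "normalized_kernel TYPE('a) \<rho>" and ij: "i \<in> Basis" "j \<in> Basis"
  shows "integrable lborel (\<lambda>z::'a. \<rho> (norm z) * ((z \<bullet> i) * (z \<bullet> j)))"
    and "(\<integral>z. \<rho> (norm z) * ((z \<bullet> i) * (z \<bullet> j)) \<partial>lborel) = (if i = j then 1 else 0)"
proof -
  obtain M where M: "M > 0" "\<And>r. r \<ge> 0 \<Longrightarrow> \<rho> r \<le> M" using \<rho>_bounded by blast
  have int: "integrable lborel (\<lambda>z::'a. \<rho> (norm z) * ((z \<bullet> i) * (z \<bullet> j)))"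
    if ij: "i \<in> Basis" "j \<in> Basis" for i j
  proof (rule integrable_bounded_support[where C=M and R=1])
    fix z :: 'a
    show "\<bar>\<rho> (norm z) * ((z \<bullet> i) * (z \<bullet> j))\<bar> \<le> M"
    proof (cases "norm z \<le> 1")
      case True
      have "\<bar>z \<bullet> i\<bar> \<le> 1" "\<bar>z \<bullet> j\<bar> \<le> 1" using Basis_le_norm[OF ij(1), of z] Basis_le_norm[OF ij(2), of z] True by auto
      then have "\<bar>z \<bullet> i\<bar> * \<bar>z \<bullet> j\<bar> \<le> 1 * 1" by (intro mult_mono) auto
      then have "\<bar>\<rho> (norm z)\<bar> * (\<bar>z \<bullet> i\<bar> * \<bar>z \<bullet> j\<bar>) \<le> M * 1"
        using M \<rho>0[of "norm z"] by (intro mult_mono) auto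
      then show ?thesis by (simp add: abs_mult)
    qed (use M \<rho>1[of "norm z"] in simp)
  qed (use \<rho>1 in simp_all)
  then show "integrable lborel (\<lambda>z::'a. \<rho> (norm z) * ((z \<bullet> i) * (z \<bullet> j)))" using ij .
  define m where "m i j = (\<integral>z. \<rho> (norm z) * ((z \<bullet> i) * (z \<bullet> j)) \<partial>lborel)" for i j :: 'a
  have off: "m i j = 0" if ij: "i \<in> Basis" "j \<in> Basis" "i \<noteq> j" for i j
  proof -
    have i0: "i \<noteq> 0" using ij by auto
    have ii: "i \<bullet> i = 1" "i \<bullet> j = 0" using ij by (auto simp: inner_Basis)
    have "m i j = (\<integral>z. \<rho> (norm (z - (2 * (z \<bullet> i) / (i \<bullet> i)) *\<^sub>R i)) *
       (((z - (2 * (z \<bullet> i) / (i \<bullet> i)) *\<^sub>R i) \<bullet> i) * ((z - (2 * (z \<bullet> i) / (i \<bullet> i)) *\<^sub>R i) \<bullet> j)) \<partial>lborel)"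
      unfolding m_def by (rule integral_reflection[symmetric, OF i0]) measurable
    also have "\<dots> = (\<integral>z. - (\<rho> (norm z) * ((z \<bullet> i) * (z \<bullet> j))) \<partial>lborel)"
      unfolding norm_reflection[OF i0]
      by (intro Bochner_Integration.integral_cong refl) (simp add: inner_diff_left ii)
    also have "\<dots> = - m i j" by (simp add: m_def)
    finally show ?thesis by simp
  qed
  have diag: "m i i = m j j" if ij: "i \<in> Basis" "j \<in> Basis" for i j
  proof (cases "i = j")
    case False
    let ?a = "i - j"
    have a0: "?a \<noteq> 0" using False by simp
    have d: "i \<bullet> i = 1" "j \<bullet> j = 1" "i \<bullet> j = 0" "j \<bullet> i = 0" using ij False by (auto simp: inner_Basis)
    have aa: "?a \<bullet> ?a = 2" by (simp add: inner_diff_left inner_diff_right d)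
    have "m i i = (\<integral>z. \<rho> (norm (z - (2 * (z \<bullet> ?a) / (?a \<bullet> ?a)) *\<^sub>R ?a)) *
       (((z - (2 * (z \<bullet> ?a) / (?a \<bullet> ?a)) *\<^sub>R ?a) \<bullet> i) * ((z - (2 * (z \<bullet> ?a) / (?a \<bullet> ?a)) *\<^sub>R ?a) \<bullet> i)) \<partial>lborel)"
      unfolding m_def by (rule integral_reflection[symmetric, OF a0]) measurable
    also have "\<dots> = m j j"
      unfolding norm_reflection[OF a0] m_def
    proof (intro Bochner_Integration.integral_cong refl)
      fix z
      have "(z - (2 * (z \<bullet> ?a) / (?a \<bullet> ?a)) *\<^sub>R ?a) \<bullet> i = z \<bullet> j"
        unfolding aa by (simp add: inner_diff_left inner_diff_right d diff_divide_distrib)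
      then show "\<rho> (norm z) * (((z - (2 * (z \<bullet> ?a) / (?a \<bullet> ?a)) *\<^sub>R ?a) \<bullet> i) * ((z - (2 * (z \<bullet> ?a) / (?a \<bullet> ?a)) *\<^sub>R ?a) \<bullet> i))
        = \<rho> (norm z) * ((z \<bullet> j) * (z \<bullet> j))" by (simp only:)
    qed
    finally show ?thesis .
  qed simp
  have "(\<Sum>k\<in>Basis. m k k) = (\<integral>z. (\<Sum>k\<in>Basis. \<rho> (norm z) * ((z \<bullet> k) * (z \<bullet> k))) \<partial>(lborel :: 'a measure))"
    unfolding m_def by (rule Bochner_Integration.integral_sum[symmetric]) (rule int)
  also have "\<dots> = (LINT z:ball (0::'a) 1|lborel. (norm z)\<^sup>2 * \<rho> (norm z))"
    unfolding set_lebesgue_integral_def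
  proof (intro Bochner_Integration.integral_cong refl)
    fix z :: 'a
    have "(norm z)\<^sup>2 = (\<Sum>k\<in>Basis. (z \<bullet> k) * (z \<bullet> k))"
      unfolding power2_norm_eq_inner by (rule euclidean_inner)
    then show "(\<Sum>k\<in>Basis. \<rho> (norm z) * ((z \<bullet> k) * (z \<bullet> k))) = indicator (ball 0 1) z *\<^sub>R ((norm z)\<^sup>2 * \<rho> (norm z))"
      using \<rho>1[of "norm z"] by (auto simp: sum_distrib_left[symmetric] indicator_def mult.commute)
  qed
  also have "\<dots> = real DIM('a)" using norm by (simp add: normalized_kernel_def)
  finally have s: "(\<Sum>k\<in>Basis. m k k) = real DIM('a)" .
  have "(\<Sum>k\<in>Basis. m k k) = real DIM('a) * m i i" using diag[OF _ ij(1)] by simp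
  then have "m i i = 1" using s by simp
  then show "(\<integral>z. \<rho> (norm z) * ((z \<bullet> i) * (z \<bullet> j)) \<partial>lborel) = (if i = j then 1 else 0)"
    using off[OF ij] by (auto simp: m_def[symmetric])
qed

text \<open>The flux derivative is a quadratic form in \<open>z\<close>, and the second moments of the kernel turn it into
  the trace of that form, the divergence of \<open>v \<nabla>u\<close>.\<close>

lemma averaged_flux:
  assumes norm: "normalized_kernel TYPE('a) \<rho>"
    and u: "C2_zero_ext \<Omega> u G H C" and v: "C2_zero_ext \<Omega> v Gv Hv C"
  shows "(\<integral>z. \<rho> (norm z) * (\<integral>x. indicator \<Omega> x * flux_derivative G H v Gv z x \<partial>lborel) \<partial>lborel)
    = (\<Sum>i\<in>Basis. \<integral>x. indicator \<Omega> x * ((Gv x \<bullet> i) * (G x \<bullet> i) + v x * (H x i \<bullet> i)) \<partial>lborel)"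
proof -
  note [measurable] = zero_ext_measurable[OF u] zero_ext_measurable[OF v]
  define D where "D i j x = (Gv x \<bullet> i) * (G x \<bullet> j) + v x * (H x j \<bullet> i)" for i j x
  define A where "A i j = (\<integral>x. indicator \<Omega> x * D i j x \<partial>lborel)" for i j
  have C0: "C > 0" by (rule scale_facts(1))
  have int: "integrable lborel (\<lambda>x. indicator \<Omega> x * D i j x)" if ij: "i \<in> Basis" "j \<in> Basis" for i j
  proof (rule integrable_\<Omega>(1)[where B="C * C + C * C"])
    show "D i j \<in> borel_measurable borel" unfolding D_def by measurable
    fix x assume x: "x \<in> \<Omega>"
    have "\<bar>(Gv x \<bullet> i) * (G x \<bullet> j)\<bar> \<le> C * C"
      unfolding abs_mult using Basis_le_norm[OF ij(1), of "Gv x"] Basis_le_norm[OF ij(2), of "G x"] zero_ext_facts(2)[OF v x] zero_ext_facts(2)[OF u x] C0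
      by (intro mult_mono) auto
    moreover have "\<bar>v x * (H x j \<bullet> i)\<bar> \<le> C * C"
    proof -
      have "norm (H x j) \<le> C" using norm_blinfun[of "H x" j] zero_ext_facts(4)[OF u x] ij by simp
      then have "\<bar>H x j \<bullet> i\<bar> \<le> C" using Basis_le_norm[OF ij(1), of "H x j"] by simp
      then show ?thesis unfolding abs_mult using zero_ext_facts(3)[OF v x] C0 by (intro mult_mono) auto
    qed
    ultimately show "\<bar>D i j x\<bar> \<le> C * C + C * C" unfolding D_def
      by (meson abs_triangle_ineq add_mono order_trans)
  qed
  have flux: "flux_derivative G H v Gv z x = (\<Sum>i\<in>Basis. \<Sum>j\<in>Basis. (z \<bullet> i) * (z \<bullet> j) * D i j x)" for z x
  proof -
    have g: "z \<bullet> y = (\<Sum>i\<in>Basis. (z \<bullet> i) * (y \<bullet> i))" for y by (rule euclidean_inner)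
    have "H x z = H x (\<Sum>j\<in>Basis. (z \<bullet> j) *\<^sub>R j)" by (simp add: euclidean_representation)
    then have "H x z \<bullet> z = (\<Sum>j\<in>Basis. (z \<bullet> j) * (H x j \<bullet> z))"
      by (simp add: blinfun.sum_right blinfun.scaleR_right inner_sum_left)
    also have "\<dots> = (\<Sum>j\<in>Basis. \<Sum>i\<in>Basis. (z \<bullet> j) * ((z \<bullet> i) * (H x j \<bullet> i)))"
      by (subst inner_commute, subst g) (simp add: sum_distrib_left)
    also have "\<dots> = (\<Sum>i\<in>Basis. \<Sum>j\<in>Basis. (z \<bullet> j) * ((z \<bullet> i) * (H x j \<bullet> i)))" by (rule sum.swap)
    finally have 1: "H x z \<bullet> z = (\<Sum>i\<in>Basis. \<Sum>j\<in>Basis. (z \<bullet> j) * ((z \<bullet> i) * (H x j \<bullet> i)))" .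
    have 2: "(z \<bullet> Gv x) * (z \<bullet> G x) = (\<Sum>i\<in>Basis. \<Sum>j\<in>Basis. ((z \<bullet> i) * (Gv x \<bullet> i)) * ((z \<bullet> j) * (G x \<bullet> j)))"
      by (subst g[of "Gv x"], subst g[of "G x"]) (rule sum_product)
    show ?thesis
      unfolding flux_derivative_def[OF u v] 1 2 D_def sum_distrib_left sum.distrib[symmetric]
      by (intro sum.cong refl) (simp add: algebra_simps)
  qed
  have inner: "(\<integral>x. indicator \<Omega> x * flux_derivative G H v Gv z x \<partial>lborel) = (\<Sum>i\<in>Basis. \<Sum>j\<in>Basis. (z \<bullet> i) * (z \<bullet> j) * A i j)" for z
  proof -
    have "(\<integral>x. indicator \<Omega> x * flux_derivative G H v Gv z x \<partial>lborel)
      = (\<integral>x. (\<Sum>i\<in>Basis. \<Sum>j\<in>Basis. (z \<bullet> i) * (z \<bullet> j) * (indicator \<Omega> x * D i j x)) \<partial>lborel)"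
      unfolding flux by (intro Bochner_Integration.integral_cong refl) (simp add: sum_distrib_left mult_ac)
    also have "\<dots> = (\<Sum>i\<in>Basis. \<integral>x. (\<Sum>j\<in>Basis. (z \<bullet> i) * (z \<bullet> j) * (indicator \<Omega> x * D i j x)) \<partial>lborel)"
      by (rule Bochner_Integration.integral_sum) (intro Bochner_Integration.integrable_sum integrable_mult_right int)
    also have "\<dots> = (\<Sum>i\<in>Basis. \<Sum>j\<in>Basis. \<integral>x. (z \<bullet> i) * (z \<bullet> j) * (indicator \<Omega> x * D i j x) \<partial>lborel)"
      by (intro sum.cong refl Bochner_Integration.integral_sum integrable_mult_right int)
    finally show ?thesis by (simp add: A_def)
  qed
  have "(\<integral>z. \<rho> (norm z) * (\<integral>x. indicator \<Omega> x * flux_derivative G H v Gv z x \<partial>lborel) \<partial>lborel)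
    = (\<integral>z. (\<Sum>i\<in>Basis. \<Sum>j\<in>Basis. A i j * (\<rho> (norm z) * ((z \<bullet> i) * (z \<bullet> j)))) \<partial>lborel)"
    unfolding inner by (intro Bochner_Integration.integral_cong refl) (simp add: sum_distrib_left mult_ac)
  also have "\<dots> = (\<Sum>i\<in>Basis. \<integral>z. (\<Sum>j\<in>Basis. A i j * (\<rho> (norm z) * ((z \<bullet> i) * (z \<bullet> j)))) \<partial>lborel)"
    by (rule Bochner_Integration.integral_sum)
       (intro Bochner_Integration.integrable_sum integrable_mult_right second_moments(1)[OF norm])
  also have "\<dots> = (\<Sum>i\<in>Basis. \<Sum>j\<in>Basis. \<integral>z. A i j * (\<rho> (norm z) * ((z \<bullet> i) * (z \<bullet> j))) \<partial>lborel)"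
    by (intro sum.cong refl Bochner_Integration.integral_sum integrable_mult_right second_moments(1)[OF norm])
  also have "\<dots> = (\<Sum>i\<in>Basis. \<Sum>j\<in>Basis. if i = j then A i i else 0)"
    by (intro sum.cong refl) (simp add: second_moments(2)[OF norm])
  also have "\<dots> = (\<Sum>i\<in>Basis. A i i)" by (simp add: sum.delta)
  finally show ?thesis by (simp add: A_def D_def)
qed

end

theorem theorem1p1:
  fixes \<Omega> :: "'a::euclidean_space set"
    and \<eta> :: "real \<Rightarrow> 'a \<Rightarrow> real"
    and \<rho> :: "real \<Rightarrow> real"
    and u v :: "'a \<Rightarrow> real"
    and \<kappa>0 \<kappa>1 \<kappa>2 \<kappa>b \<delta> :: real
  assumes "bounded \<Omega>" and "C2_domain \<Omega>"
    and "localization_family \<Omega> \<kappa>0 \<kappa>1 \<kappa>2 \<kappa>b \<eta>"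
    and "admissible_kernel \<rho>" and "normalized_kernel TYPE('a) \<rho>"
    and "0 < \<delta>" and "\<delta> < localization_bound \<kappa>1 \<kappa>b"
    and "C2_closure \<Omega> u" and "C2_closure \<Omega> v"
  shows "nonlocal_form \<Omega> \<rho> (\<eta> \<delta>) u v =
           (LINT x:\<Omega>|lborel. nonlocal_op \<Omega> \<rho> (\<eta> \<delta>) u x * v x)
         + (LINT x:frontier \<Omega>|surface_measure \<Omega>. normal_derivative \<Omega> u x * v x)"
proof -
  note bd = assms(1) and dom = assms(2)
  have op: "open \<Omega>" using dom by (simp add: C2_domain_def)
  have sub: "\<Omega> \<subseteq> closure \<Omega>" by (rule closure_subset)
  have pos: "\<kappa>1 > 0" "\<kappa>b > 0" using assms(3) by (auto simp: localization_family_def)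
  have loc: "\<And>x. x \<in> \<Omega> \<Longrightarrow> 0 < \<eta> \<delta> x" "C2_closure \<Omega> (\<eta> \<delta>)"
    "\<And>x. x \<in> \<Omega> \<Longrightarrow> norm (grad (\<eta> \<delta>) x) \<le> \<kappa>1 * sqrt \<delta>"
    "\<And>x. x \<in> \<Omega> \<Longrightarrow> \<eta> \<delta> x \<le> \<kappa>b * min \<delta> ((infdist x (frontier \<Omega>))\<^sup>2)"
    using assms(3)[unfolded localization_family_def, THEN conjunct2, THEN conjunct2, THEN conjunct2, THEN conjunct2,
        THEN conjunct2, THEN spec, of \<delta>, THEN mp, OF conjI[OF assms(6,7)]] by blast+
  have \<delta>: "\<delta> < 1 / (9 * \<kappa>1\<^sup>2)" "\<delta> < 1 / (2 * \<kappa>b\<^sup>2)"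
    using assms(7) by (auto simp: localization_bound_def)
  have \<kappa>1\<delta>: "\<kappa>1 * sqrt \<delta> \<le> 1/3"
  proof (rule power2_le_imp_le)
    have "(\<kappa>1 * sqrt \<delta>)\<^sup>2 = \<kappa>1\<^sup>2 * \<delta>" using assms(6) by (simp add: power_mult_distrib)
    also have "\<dots> \<le> (1/3)\<^sup>2" using \<delta>(1) pos by (simp add: less_divide_eq power2_eq_square mult_ac)
    finally show "(\<kappa>1 * sqrt \<delta>)\<^sup>2 \<le> (1/3)\<^sup>2" .
  qed simp
  have \<kappa>b\<delta>: "\<kappa>b\<^sup>2 * \<delta> < 1" using \<delta>(2) pos by (simp add: less_divide_eq mult_ac)
  obtain gh hh Ch where hd: "\<And>x. x \<in> \<Omega> \<Longrightarrow> GDERIV (\<eta> \<delta>) x :> gh x"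
    and hz: "C2_zero_ext \<Omega> (\<lambda>x. if x \<in> \<Omega> then \<eta> \<delta> x else 0) (\<lambda>x. if x \<in> \<Omega> then gh x else 0) (\<lambda>x. if x \<in> \<Omega> then hh x else 0) Ch"
    by (rule C2_closure_zero_ext[OF bd op loc(2)]) blast
  obtain G H Cu where cG: "continuous_on (closure \<Omega>) G" and cH: "continuous_on (closure \<Omega>) H"
    and ud: "\<And>x. x \<in> \<Omega> \<Longrightarrow> GDERIV u x :> G x" "\<And>x. x \<in> \<Omega> \<Longrightarrow> (G has_derivative blinfun_apply (H x)) (at x)"
    and uz: "C2_zero_ext \<Omega> (\<lambda>x. if x \<in> \<Omega> then u x else 0) (\<lambda>x. if x \<in> \<Omega> then G x else 0) (\<lambda>x. if x \<in> \<Omega> then H x else 0) Cu"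
    by (rule C2_closure_zero_ext[OF bd op assms(8)]) blast
  obtain Gv Hv Cv where cv: "continuous_on (closure \<Omega>) v" and cGv: "continuous_on (closure \<Omega>) Gv"
    and vd: "\<And>x. x \<in> \<Omega> \<Longrightarrow> GDERIV v x :> Gv x"
    and vz: "C2_zero_ext \<Omega> (\<lambda>x. if x \<in> \<Omega> then v x else 0) (\<lambda>x. if x \<in> \<Omega> then Gv x else 0) (\<lambda>x. if x \<in> \<Omega> then Hv x else 0) Cv"
    by (rule C2_closure_zero_ext[OF bd op assms(9)]) blast
  define h u' v' where "h = (\<lambda>x. if x \<in> \<Omega> then \<eta> \<delta> x else 0)" and "u' = (\<lambda>x. if x \<in> \<Omega> then u x else 0)" and "v' = (\<lambda>x. if x \<in> \<Omega> then v x else 0)"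
  define G' H' Gv' where "G' = (\<lambda>x. if x \<in> \<Omega> then G x else 0)" and "H' = (\<lambda>x. if x \<in> \<Omega> then H x else 0)" and "Gv' = (\<lambda>x. if x \<in> \<Omega> then Gv x else 0)"
  define C where "C = max Ch (max Cu Cv)"
  have u: "C2_zero_ext \<Omega> u' G' H' C" unfolding u'_def G'_def H'_def by (rule C2_zero_ext_mono[OF uz]) (simp add: C_def)
  have v: "C2_zero_ext \<Omega> v' Gv' (\<lambda>x. if x \<in> \<Omega> then Hv x else 0) C"
    unfolding v'_def Gv'_def by (rule C2_zero_ext_mono[OF vz]) (simp add: C_def)
  obtain \<rho>d where \<rho>d: "\<And>r. r \<ge> 0 \<Longrightarrow> 0 \<le> \<rho> r" "\<And>r. r \<ge> 0 \<Longrightarrow> (\<rho> has_real_derivative \<rho>d r) (at r within {0..})"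
    using assms(4) unfolding admissible_kernel_def by blast
  obtain R0 where R0: "R0 < 1" "closure {r. 0 \<le> r \<and> \<rho> r \<noteq> 0} \<subseteq> {0..<R0}"
    using assms(4) unfolding admissible_kernel_def by blast
  interpret nonlocal_kernel \<Omega> h "\<lambda>x. if x \<in> \<Omega> then gh x else 0" "\<lambda>x. if x \<in> \<Omega> then hh x else 0" C \<kappa>b \<rho>
  proof
    show "C2_zero_ext \<Omega> h (\<lambda>x. if x \<in> \<Omega> then gh x else 0) (\<lambda>x. if x \<in> \<Omega> then hh x else 0) C"
      unfolding h_def by (rule C2_zero_ext_mono[OF hz]) (simp add: C_def)
    fix x assume x: "x \<in> \<Omega>"
    let ?d = "infdist x (frontier \<Omega>)"
    show "0 < h x" using loc(1)[OF x] x by (simp add: h_def)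
    show "norm (if x \<in> \<Omega> then gh x else 0) \<le> 1/3"
      using loc(3)[OF x] \<kappa>1\<delta> grad_eqI[OF hd[OF x]] x by simp
    have "min \<delta> (?d\<^sup>2) \<le> ?d\<^sup>2" by simp
    then have "\<kappa>b * min \<delta> (?d\<^sup>2) \<le> \<kappa>b * ?d\<^sup>2" using pos by (intro mult_left_mono) auto
    then show k: "h x \<le> \<kappa>b * ?d\<^sup>2" using loc(4)[OF x] x by (simp add: h_def)
    \<comment> \<open>The minimum of \<open>\<delta>\<close> and the squared distance is at most their geometric mean, and \<open>\<kappa>b\<^sup>2 \<delta> < 1\<close>.\<close>
    show "h x < ?d"
    proof (rule power2_less_imp_less)
      have d0: "?d\<^sup>2 > 0"
      proof (rule ccontr)
        assume "\<not> ?d\<^sup>2 > 0"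
        then have "?d\<^sup>2 = 0" by (simp add: not_less)
        then show False using k \<open>0 < h x\<close> by simp
      qed
      have "(min \<delta> (?d\<^sup>2))\<^sup>2 \<le> \<delta> * ?d\<^sup>2"
        using assms(6) unfolding power2_eq_square[of "min _ _"] by (intro mult_mono) auto
      then have "\<kappa>b\<^sup>2 * (min \<delta> (?d\<^sup>2))\<^sup>2 \<le> \<kappa>b\<^sup>2 * (\<delta> * ?d\<^sup>2)" by (intro mult_left_mono) auto
      moreover have "(h x)\<^sup>2 \<le> (\<kappa>b * min \<delta> (?d\<^sup>2))\<^sup>2"
        using loc(4)[OF x] \<open>0 < h x\<close> x by (intro power_mono) (auto simp: h_def)
      moreover have "(\<kappa>b\<^sup>2 * \<delta>) * ?d\<^sup>2 < 1 * ?d\<^sup>2" using \<kappa>b\<delta> d0 by (intro mult_strict_right_mono)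
      ultimately show "(h x)\<^sup>2 < ?d\<^sup>2" by (simp add: power_mult_distrib mult.assoc)
    qed (rule infdist_nonneg)
  next
    show "continuous_on {0..} \<rho>"
      using \<rho>d(2) by (meson DERIV_continuous atLeast_iff continuous_on_eq_continuous_within)
    fix r :: real assume r: "r \<ge> 1"
    show "\<rho> r = 0"
    proof (rule ccontr)
      assume "\<rho> r \<noteq> 0"
      then have "r \<in> {r. 0 \<le> r \<and> \<rho> r \<noteq> 0}" using r by simp
      then have "r \<in> {0..<R0}" by (rule subsetD[OF R0(2) subsetD[OF closure_subset]])
      then show False using r R0(1) by simp
    qed
  qed (use op bd pos \<rho>d in auto)
  have green: "nonlocal_form \<Omega> \<rho> h u' v' = (\<integral>x. indicator \<Omega> x * nonlocal_op \<Omega> \<rho> h u' x * v' x \<partial>lborel)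
    + (\<Sum>i\<in>Basis. \<integral>x. indicator \<Omega> x * ((Gv' x \<bullet> i) * (G' x \<bullet> i) + v' x * (H' x i \<bullet> i)) \<partial>lborel)"
    using green_flux_identity[OF u v] averaged_flux[OF assms(5) u v] by simp
  have hk: "het_kernel \<rho> (\<eta> \<delta>) 2 x y = het_kernel \<rho> h 2 x y" if "x \<in> \<Omega>" "y \<in> \<Omega>" for x y
    using that by (simp add: het_kernel_def h_def)
  have form: "nonlocal_form \<Omega> \<rho> (\<eta> \<delta>) u v = nonlocal_form \<Omega> \<rho> h u' v'"
    unfolding nonlocal_form_def
    by (intro set_lebesgue_integral_cong) (use op hk in \<open>auto intro!: set_lebesgue_integral_cong simp: u'_def v'_def\<close>)
  have opeq: "nonlocal_op \<Omega> \<rho> (\<eta> \<delta>) u x = nonlocal_op \<Omega> \<rho> h u' x" if x: "x \<in> \<Omega>" for x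
    unfolding nonlocal_op_def
    by (intro arg_cong[where f="\<lambda>t. 2 * t"] set_lebesgue_integral_cong) (use op hk x in \<open>auto simp: u'_def\<close>)
  have opint: "(LINT x:\<Omega>|lborel. nonlocal_op \<Omega> \<rho> (\<eta> \<delta>) u x * v x) = (\<integral>x. indicator \<Omega> x * nonlocal_op \<Omega> \<rho> h u' x * v' x \<partial>lborel)"
    unfolding set_lebesgue_integral_def
    by (intro Bochner_Integration.integral_cong refl) (auto simp: indicator_def opeq v'_def)
  \<comment> \<open>The components of the field \<open>v \<nabla>u\<close> and their gradients.\<close>
  define f where "f i x = v x * (G x \<bullet> i)" for i x
  define ga where "ga i x = (\<Sum>j\<in>Basis. (H x j \<bullet> i) *\<^sub>R j)" for i x
  define g where "g i x = v x *\<^sub>R ga i x + (G x \<bullet> i) *\<^sub>R Gv x" for i x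
  have ga: "GDERIV (\<lambda>x. G x \<bullet> i) x :> ga i x" if x: "x \<in> \<Omega>" for i x
  proof -
    have "((\<lambda>x. G x \<bullet> i) has_derivative (\<lambda>w. H x w \<bullet> i)) (at x)"
      using ud(2)[OF x] by (rule has_derivative_inner_left)
    moreover have "H x w \<bullet> i = w \<bullet> ga i x" for w
    proof -
      have "H x w = H x (\<Sum>j\<in>Basis. (w \<bullet> j) *\<^sub>R j)" by (simp add: euclidean_representation)
      then show ?thesis
        by (simp add: ga_def blinfun.sum_right blinfun.scaleR_right inner_sum_left inner_sum_right mult.commute)
    qed
    ultimately show ?thesis by (simp add: gderiv_def)
  qed
  have gf: "GDERIV (f i) x :> g i x" if x: "x \<in> \<Omega>" for i x
    unfolding f_def[abs_def] g_def by (rule GDERIV_mult[OF vd[OF x] ga[OF x]])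
  have cf: "continuous_on (closure \<Omega>) (f i)" for i
    unfolding f_def[abs_def] by (intro continuous_intros cv cG)
  have cg: "continuous_on (closure \<Omega>) (g i)" for i
    unfolding g_def[abs_def] ga_def by (intro continuous_intros cv cG cGv cH)
  note div = C2_domain_divergence[OF bd dom gf cf cg]
  have trace: "(\<integral>x. indicator \<Omega> x * ((Gv' x \<bullet> i) * (G' x \<bullet> i) + v' x * (H' x i \<bullet> i)) \<partial>lborel)
    = (\<integral>x. indicator \<Omega> x * (g i x \<bullet> i) \<partial>lborel)" if i: "i \<in> Basis" for i
  proof (intro Bochner_Integration.integral_cong refl)
    fix x
    have "ga i x \<bullet> i = H x i \<bullet> i"
      using i by (simp add: ga_def inner_sum_left inner_Basis if_distrib[of "\<lambda>t. _ * t"] sum.delta cong: if_cong)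
    then show "indicator \<Omega> x * ((Gv' x \<bullet> i) * (G' x \<bullet> i) + v' x * (H' x i \<bullet> i)) = indicator \<Omega> x * (g i x \<bullet> i)"
      by (auto simp: indicator_def g_def G'_def Gv'_def H'_def v'_def inner_add_left)
  qed
  have "(LINT x:frontier \<Omega>|surface_measure \<Omega>. normal_derivative \<Omega> u x * v x)
    = (\<integral>x. (\<Sum>i\<in>Basis. indicator (frontier \<Omega>) x * (f i x * (outward_normal \<Omega> x \<bullet> i))) \<partial>surface_measure \<Omega>)"
    unfolding set_lebesgue_integral_def
  proof (intro Bochner_Integration.integral_cong refl)
    fix x
    show "indicator (frontier \<Omega>) x *\<^sub>R (normal_derivative \<Omega> u x * v x)
      = (\<Sum>i\<in>Basis. indicator (frontier \<Omega>) x * (f i x * (outward_normal \<Omega> x \<bullet> i)))"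
    proof (cases "x \<in> frontier \<Omega>")
      case True
      have "normal_derivative \<Omega> u x = G x \<bullet> outward_normal \<Omega> x"
        by (rule normal_derivative_eq[OF op ud(1) cG True])
      also have "\<dots> = (\<Sum>i\<in>Basis. (G x \<bullet> i) * (outward_normal \<Omega> x \<bullet> i))" by (rule euclidean_inner)
      finally show ?thesis using True by (simp add: f_def sum_distrib_left sum_distrib_right mult_ac)
    qed simp
  qed
  also have "\<dots> = (\<Sum>i\<in>Basis. \<integral>x. indicator (frontier \<Omega>) x * (f i x * (outward_normal \<Omega> x \<bullet> i)) \<partial>surface_measure \<Omega>)"
    by (rule Bochner_Integration.integral_sum) (rule div(2))
  also have "\<dots> = (\<Sum>i\<in>Basis. \<integral>x. indicator \<Omega> x * (g i x \<bullet> i) \<partial>lborel)" using div(1) by simp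
  also have "\<dots> = (\<Sum>i\<in>Basis. \<integral>x. indicator \<Omega> x * ((Gv' x \<bullet> i) * (G' x \<bullet> i) + v' x * (H' x i \<bullet> i)) \<partial>lborel)"
    using trace by simp
  finally show ?thesis unfolding form opint green by simp
qed

end
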